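(* Let $\alpha\in(0,1)$ and let $\lambda>0$ satisfy the non-resonance condition: $\lambda\neq\lambda_n$ and $\lambda_n-\lambda\neq\lambda_k$ for all $k,n\in\mathbb N^*$. Then there exists a unique sequence $(c_n)_{n\in\mathbb N^*}$ of scalars with $(c_n-1)_{n\in\mathbb N^*}\in\ell^2(\mathbb N^* )$ such that the functions $\psi_n:=\phi_n-c_n\widetilde\xi_n$, $n\in\mathbb N^*$, satisfy, for every $n\in\mathbb N^*$, $$\lambda_n\psi_n(x)+(x^\alpha\psi_n'(x))'-\lambda\psi_n(x)=-\lambda\phi_n(x)\quad (x\in(0,1)),\qquad \psi_n(0)=0,$$ together with $$\sum_{m\in\mathbb N^*}\phi_m'(1)\,\psi_m=0\quad\text{(convergence in } D(A^{1/2})').$$ Moreover, the corresponding kernel $k(x,y)=\sum_{n\in\mathbb N^*}\psi_n(x)\phi_n(y)$ belongs to $L^2((0,1)^2)$.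
   Context: $\mathbb N^*=\{1,2,\dots\}$; scalars are complex and function spaces consist of complex-valued functions. Let $\alpha\in(0,1)$, $\nu=\frac{1-\alpha}{2-\alpha}$, $\kappa=\frac{2-\alpha}{2}$. $J_\nu$ is the Bessel function of the first kind of order $\nu$, and $0<j_{\nu,1}<j_{\nu,2}<\cdots$ are its positive zeros. $H^1_{\alpha,0}(0,1)=\{f\in L^2(0,1): x^{\alpha/2}f'\in L^2(0,1),\ f(0)=f(1)=0\}$. The operator $A$ on $L^2(0,1)$ is $Au=(x^\alpha u')'$ with $D(A)=\{u\in H^1_{\alpha,0}(0,1): x^\alpha u'\in H^1(0,1)\}$. $-A$ is self-adjoint, positive definite with compact resolvent; its eigenvalues are $\lambda_n=(\kappa j_{\nu,n})^2$ and the functions $\phi_n(x)=\frac{(2\kappa)^{1/2}}{J_\nu'(j_{\nu,n})}x^{(1-\alpha)/2}J_\nu(j_{\nu,n}x^\kappa)$ ($n\in\mathbb N^*$) are corresponding eigenfunctions ($-A\phi_n=\lambda_n\phi_n$) forming a Hilbert basis of $L^2(0,1)$. One has $\phi_n'(1)=(2\kappa)^{1/2}\kappa j_{\nu,n}$. $D(A^{1/2})'$ is the Hilbert space of formal series $f=\sum_n a_n\phi_n$ with $\|f\|^2=\sum_n |a_n|^2/\lambda_n<\infty$; it contains $L^2(0,1)$. For $\lambda$ as in the claim, $\widetilde\xi_n(x)=\frac{(2\kappa)^{1/2}}{J_\nu'(j_{\nu,n})}x^{(1-\alpha)/2}J_\nu\!\left(\frac{\sqrt{\lambda_n-\lambda}}{\kappa}x^\kappa\right)$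 for $x\in(0,1)$, where $\sqrt{\lambda_n-\lambda}$ means $i\sqrt{\lambda-\lambda_n}$ if $\lambda>\lambda_n$ (principal branch for $z\mapsto z^\nu$). *)

theory Defs
  imports "HOL-Analysis.Analysis"
begin

text \<open>
  Sequences indexed by the positive integers are functions on \<^typ>\<open>nat\<close> whose value at 0 is never
  used; all sums and quantifiers over the index range over \<open>{1..}\<close>.
\<close>

definition Ltwo :: "'a::euclidean_space set \<Rightarrow> ('a \<Rightarrow> complex) set" where
  "Ltwo S = {f. set_borel_measurable lborel S f \<and>
                set_integrable lborel S (\<lambda>x. (cmod (f x))\<^sup>2)}"

definition Ltwo_norm :: "'a::euclidean_space set \<Rightarrow> ('a \<Rightarrow> complex) \<Rightarrow> real" where
  "Ltwo_norm S f = sqrt (LINT x:S|lborel. (cmod (f x))\<^sup>2)"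

definition Ltwo_sums ::
  "'a::euclidean_space set \<Rightarrow> (nat \<Rightarrow> 'a \<Rightarrow> complex) \<Rightarrow> ('a \<Rightarrow> complex) \<Rightarrow> bool" where
  "Ltwo_sums S F g \<longleftrightarrow>
     (\<forall>n\<ge>1. F n \<in> Ltwo S) \<and> g \<in> Ltwo S \<and>
     (\<lambda>N. Ltwo_norm S (\<lambda>x. (\<Sum>n=1..N. F n x) - g x)) \<longlonglongrightarrow> 0"

text \<open>
  The complex \<open>powr\<close> is the principal branch. Since \<open>0 powr a = 0\<close> for all \<open>a\<close>, the value at the
  origin is the usual one only for order \<open>\<nu> > 0\<close>, the only case used here.
\<close>
definition bessel_J :: "real \<Rightarrow> complex \<Rightarrow> complex" where
  "bessel_J \<nu> z = (z / 2) powr of_real \<nu> *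
     (\<Sum>m. (-1) ^ m * rGamma (of_real \<nu> + of_nat m + 1) / fact m * (z / 2) ^ (2 * m))"

text \<open>The \<open>n\<close>-th positive zero: the one having exactly \<open>n\<close> zeros in \<open>(0, x]\<close>.\<close>
definition bessel_zero :: "real \<Rightarrow> nat \<Rightarrow> real" where
  "bessel_zero \<nu> n = (THE x. x > 0 \<and> bessel_J \<nu> (of_real x) = 0 \<and>
     card {y \<in> {0<..x}. bessel_J \<nu> (of_real y) = 0} = n)"

definition nu :: "real \<Rightarrow> real" where
  "nu \<alpha> = (1 - \<alpha>) / (2 - \<alpha>)"

definition kappa :: "real \<Rightarrow> real" where
  "kappa \<alpha> = (2 - \<alpha>) / 2"

definition eigval :: "real \<Rightarrow> nat \<Rightarrow> real" where
  "eigval \<alpha> n = (kappa \<alpha> * bessel_zero (nu \<alpha>) n)\<^sup>2"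

definition phi :: "real \<Rightarrow> nat \<Rightarrow> real \<Rightarrow> complex" where
  "phi \<alpha> n x =
     of_real (sqrt (2 * kappa \<alpha>)) / deriv (bessel_J (nu \<alpha>)) (of_real (bessel_zero (nu \<alpha>) n)) *
     of_real (x powr ((1 - \<alpha>) / 2)) *
     bessel_J (nu \<alpha>) (of_real (bessel_zero (nu \<alpha>) n * x powr kappa \<alpha>))"

text \<open>For a negative real \<open>r\<close>, \<open>csqrt r\<close> is \<open>\<i> * sqrt (- r)\<close>.\<close>
definition xi :: "real \<Rightarrow> real \<Rightarrow> nat \<Rightarrow> real \<Rightarrow> complex" where
  "xi \<alpha> lam n x =
     of_real (sqrt (2 * kappa \<alpha>)) / deriv (bessel_J (nu \<alpha>)) (of_real (bessel_zero (nu \<alpha>) n)) *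
     of_real (x powr ((1 - \<alpha>) / 2)) *
     bessel_J (nu \<alpha>) (csqrt (of_real (eigval \<alpha> n - lam)) / of_real (kappa \<alpha>) * of_real (x powr kappa \<alpha>))"

definition psi :: "real \<Rightarrow> real \<Rightarrow> (nat \<Rightarrow> complex) \<Rightarrow> nat \<Rightarrow> real \<Rightarrow> complex" where
  "psi \<alpha> lam c n x = phi \<alpha> n x - c n * xi \<alpha> lam n x"

definition dphi_one :: "real \<Rightarrow> nat \<Rightarrow> complex" where
  "dphi_one \<alpha> n = vector_derivative (phi \<alpha> n) (at 1 within {0..1})"

text \<open>
  An element of \<open>D(A\<^sup>1\<^sup>/\<^sup>2)'\<close>, a formal series \<open>\<Sum>n. a n * phi \<alpha> n\<close>, is represented by its
  coefficient sequence \<open>a\<close>; a function in \<open>L\<^sup>2(0,1)\<close> is embedded through its coefficients in the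
  basis \<open>phi \<alpha> n\<close>. Only functions are summed below, so the terms of a series are embedded after
  forming the partial sums.
\<close>
definition dual_space :: "real \<Rightarrow> (nat \<Rightarrow> complex) set" where
  "dual_space \<alpha> = {a. (\<lambda>n. (cmod (a n))\<^sup>2 / eigval \<alpha> n) summable_on {1..}}"

definition dual_norm :: "real \<Rightarrow> (nat \<Rightarrow> complex) \<Rightarrow> real" where
  "dual_norm \<alpha> a = sqrt (\<Sum>\<^sub>\<infinity>n\<in>{1..}. (cmod (a n))\<^sup>2 / eigval \<alpha> n)"

definition basis_coeff :: "real \<Rightarrow> (real \<Rightarrow> complex) \<Rightarrow> nat \<Rightarrow> complex" where
  "basis_coeff \<alpha> f n = (LINT x:{0<..<1}|lborel. f x * cnj (phi \<alpha> n x))"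

definition dual_sums :: "real \<Rightarrow> (nat \<Rightarrow> real \<Rightarrow> complex) \<Rightarrow> (nat \<Rightarrow> complex) \<Rightarrow> bool" where
  "dual_sums \<alpha> F a \<longleftrightarrow>
     (\<forall>m\<ge>1. F m \<in> Ltwo {0<..<1}) \<and> a \<in> dual_space \<alpha> \<and>
     (\<forall>N. (\<lambda>n. basis_coeff \<alpha> (\<lambda>x. \<Sum>m=1..N. F m x) n - a n) \<in> dual_space \<alpha>) \<and>
     (\<lambda>N. dual_norm \<alpha> (\<lambda>n. basis_coeff \<alpha> (\<lambda>x. \<Sum>m=1..N. F m x) n - a n)) \<longlonglongrightarrow> 0"

definition weighted_deriv :: "real \<Rightarrow> (real \<Rightarrow> complex) \<Rightarrow> real \<Rightarrow> complex" where
  "weighted_deriv \<alpha> u x = of_real (x powr \<alpha>) * vector_derivative u (at x)"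

text \<open>
  The boundary condition at 0 is a limit: the formula for \<open>psi\<close> vanishes at \<open>x = 0\<close> merely because
  \<open>0 powr a = 0\<close>.
\<close>
definition kernel_coeffs :: "real \<Rightarrow> real \<Rightarrow> (nat \<Rightarrow> complex) \<Rightarrow> bool" where
  "kernel_coeffs \<alpha> lam c \<longleftrightarrow>
     (\<lambda>n. (cmod (c n - 1))\<^sup>2) summable_on {1..} \<and>
     (\<forall>n\<ge>1.
        (\<forall>x\<in>{0<..<1}.
           psi \<alpha> lam c n differentiable (at x) \<and>
           weighted_deriv \<alpha> (psi \<alpha> lam c n) differentiable (at x) \<and>
           of_real (eigval \<alpha> n) * psi \<alpha> lam c n x
             + vector_derivative (weighted_deriv \<alpha> (psi \<alpha> lam c n)) (at x)
             - of_real lam * psi \<alpha> lam c n x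
           = - of_real lam * phi \<alpha> n x) \<and>
        (psi \<alpha> lam c n \<longlongrightarrow> 0) (at_right 0)) \<and>
     dual_sums \<alpha> (\<lambda>m x. dphi_one \<alpha> m * psi \<alpha> lam c m x) (\<lambda>_. 0)"

end

theory Submission
  imports Defs "HOL-Complex_Analysis.Complex_Analysis"
begin

text \<open>
  Let \<open>E\<close> be the entire function with \<open>J\<^sub>\<nu>(z) = (z/2)\<^bsup>\<nu>\<^esup> E(z\<^sup>2/4)\<close>; its zeros \<open>t\<^sub>k = (j\<^sub>k/2)\<^sup>2\<close> are
  positive and simple. With \<open>\<beta> = 2 - \<alpha>\<close> and \<open>U\<^sub>z(x) = x\<^bsup>1-\<alpha>\<^esup> E(z x\<^bsup>\<beta>\<^esup>)\<close>, the solution of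
  \<open>- A u = \<beta>\<^sup>2 z u\<close> vanishing at the origin, the eigenfunction of index \<open>k\<close> is \<open>N\<^sub>k U(t\<^sub>k)\<close> and the
  shifted one is \<open>q\<^sub>k N\<^sub>k U(s\<^sub>k)\<close>, where \<open>s\<^sub>k = t\<^sub>k - \<sigma>\<close>, \<open>\<sigma> = \<lambda>/\<beta>\<^sup>2\<close> and \<open>q\<^sub>k\<close> is the quotient of
  the principal powers \<open>(\<surd>s\<^sub>k)\<^bsup>\<nu>\<^esup>\<close> and \<open>(\<surd>t\<^sub>k)\<^bsup>\<nu>\<^esup>\<close>. The differential equation and the condition at
  the origin therefore hold for every choice of \<open>c\<close>; only the series condition has content.

  A Wronskian identity evaluates all inner products. The \<open>k\<close>-th coefficient of the \<open>N\<close>-th partial sum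
  is \<open>\<surd>t\<^sub>k\<close>, up to a constant factor, times \<open>[k \<le> N] - (\<Sum>m\<le>N. \<gamma>\<^sub>m b\<^sub>m / (t\<^sub>k - s\<^sub>m))\<close>, with
  \<open>\<gamma>\<^sub>m = c\<^sub>m q\<^sub>m\<close> and \<open>b\<^sub>m = - E(s\<^sub>m) / E'(t\<^sub>m)\<close>. So the series condition asks that \<open>\<gamma>\<close> solve an infinite
  Cauchy system with right-hand side one. The solution is \<open>\<gamma> = 1\<close>, that is \<open>c\<^sub>m = 1/q\<^sub>m\<close>: the quotient
  \<open>E(z)/E(z + \<sigma>)\<close> has the partial fraction expansion \<open>1 - (\<Sum>m. b\<^sub>m / (z - s\<^sub>m))\<close>, and it vanishes at
  every \<open>t\<^sub>k\<close>.

  The system is handled through its truncations to the first \<open>N\<close> zeros, where existence, and the inverse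
  matrix that gives uniqueness, are statements about divided differences of polynomials
  (\<open>cauchy_system_finite\<close>, \<open>cauchy_inverse_finite\<close>). Two analytic facts allow \<open>N \<rightarrow> \<infinity>\<close> by dominated
  convergence of series. First, the zeros are spaced quadratically: between two zeros \<open>a < b\<close> the equation
  at an extremum of \<open>E\<close> forces \<open>b - a \<ge> \<surd>(2a)\<close> (\<open>bclif_zero_gap\<close>), and hence
  \<open>\<Sum>j\<noteq>k. 1/\<bar>t\<^sub>k - t\<^sub>j\<bar>\<close> is square summable in \<open>k\<close>. Secondly, \<open>E\<close> is the product of its zeros
  (\<open>bclif_hadamard\<close>), which identifies the limits of the truncated coefficients with the numbers \<open>b\<^sub>m\<close>.

  The product formula comes from the orthogonality of the functions \<open>E(t\<^sub>k x)\<close>: Bessel's inequality says that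
  \<open>- z E'/E\<close>, with finitely many of its poles removed, has nonnegative imaginary part in the upper
  half-plane. If all poles of modulus below \<open>R\<close> are removed, the result is a typically real function on a
  disc of radius \<open>R\<close>, and the Schwarz lemma makes it almost linear on compact sets when \<open>R\<close> is large. So
  \<open>E(z)\<close> is the product of its zeros times \<open>E(0) exp(- b z)\<close> with \<open>b \<ge> 0\<close>, and the subexponential growth
  of \<open>E\<close> along the negative axis gives \<open>b = 0\<close>.

  Differentiating the same statement turns Bessel's inequality for \<open>U(s\<^sub>k)\<close> into an equality, so that
  \<open>\<parallel>\<psi>\<^sub>n\<parallel>\<^sup>2 = (1 - b\<^sub>n/\<sigma>)\<^sup>2 + b\<^sub>n\<^sup>2 (\<Sum>k\<noteq>n. (t\<^sub>k/t\<^sub>n) / (t\<^sub>k - s\<^sub>n)\<^sup>2)\<close> (\<open>psi_energy\<close>). This is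
  summable, and the \<open>\<phi>\<^sub>n\<close> are orthonormal, so the kernel series is a Cauchy sequence in the complete space
  of square integrable functions on the square.

  Sequences of zeros are indexed from \<open>0\<close> below.
\<close>

section \<open>The Bessel--Clifford function\<close>

text \<open>
  The Taylor coefficients of the Bessel--Clifford function in the variable \<open>- z\<close>; the sign makes the
  zeros positive.
\<close>
definition bclif_coeff :: "real \<Rightarrow> nat \<Rightarrow> real" where
  "bclif_coeff \<nu> m = (-1) ^ m * rGamma (\<nu> + of_nat m + 1) / fact m"

text \<open>
  The definition is polymorphic because the zeros are studied on the real line, whereas the product
  formula needs the complex plane.
\<close>
definition bclif :: "real \<Rightarrow> 'a \<Rightarrow> 'a::{real_normed_field,banach}" where
  "bclif \<nu> z = (\<Sum>m. of_real (bclif_coeff \<nu> m) * z ^ m)"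

lemma rGamma_Suc_bound:
  fixes \<nu> :: real
  assumes "\<nu> \<ge> 0"
  shows "0 < rGamma (\<nu> + of_nat m + 1)" "rGamma (\<nu> + of_nat m + 1) \<le> rGamma (\<nu> + 1) / fact m"
proof -
  show pos: "0 < rGamma (\<nu> + of_nat m + 1)" for m
    using Gamma_real_pos[of "\<nu> + of_nat m + 1"] assms by (simp add: rGamma_inverse_Gamma)
  show "rGamma (\<nu> + of_nat m + 1) \<le> rGamma (\<nu> + 1) / fact m"
  proof (induction m)
    case (Suc m)
    have "(\<nu> + real m + 1) * rGamma (\<nu> + real m + 1 + 1) = rGamma (\<nu> + real m + 1)"
      by (rule rGamma_plus1)
    moreover have "(real m + 1) * rGamma (\<nu> + real (Suc m) + 1) \<le> (\<nu> + real m + 1) * rGamma (\<nu> + real (Suc m) + 1)"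
      using pos[of "Suc m"] assms by (intro mult_right_mono) auto
    ultimately have "(real m + 1) * rGamma (\<nu> + real (Suc m) + 1) \<le> rGamma (\<nu> + real m + 1)"
      by (simp add: add_ac)
    also have "\<dots> \<le> rGamma (\<nu> + 1) / fact m" by (rule Suc)
    finally have "(real m + 1) * rGamma (\<nu> + real (Suc m) + 1) \<le> rGamma (\<nu> + 1) / fact m" .
    then have "rGamma (\<nu> + real (Suc m) + 1) \<le> rGamma (\<nu> + 1) / fact m / (real m + 1)"
      by (simp add: pos_le_divide_eq mult.commute)
    then show ?case by (simp add: field_simps)
  qed simp
qed

lemma abs_bclif_coeff_le:
  assumes "\<nu> \<ge> 0"
  shows "\<bar>bclif_coeff \<nu> m\<bar> \<le> rGamma (\<nu> + 1) / (fact m)\<^sup>2"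
  using rGamma_Suc_bound[OF assms, of m]
  by (simp add: bclif_coeff_def abs_mult power2_eq_square field_simps)

lemma bclif_coeff_Suc: "real (Suc m) * bclif_coeff \<nu> (Suc m) = - bclif_coeff (\<nu> + 1) m"
proof -
  have "\<nu> + real (Suc m) + 1 = \<nu> + 1 + real m + 1" by simp
  then have g: "rGamma (\<nu> + real (Suc m) + 1) = rGamma (\<nu> + 1 + real m + 1)" by (rule arg_cong)
  show ?thesis unfolding bclif_coeff_def g by (simp del: of_nat_Suc)
qed

lemma bclif_coeff_plus1: "bclif_coeff \<nu> m = (\<nu> + 1 + real m) * bclif_coeff (\<nu> + 1) m"
  using rGamma_plus1[of "\<nu> + real m + 1"]
  by (simp add: bclif_coeff_def add_ac mult_ac)

lemma summable_norm_bclif: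
  fixes z :: "'a::{real_normed_field,banach}"
  assumes "\<nu> \<ge> 0"
  shows "summable (\<lambda>m. norm (of_real (bclif_coeff \<nu> m) * z ^ m))"
proof (rule summable_comparison_test')
  show "summable (\<lambda>m. rGamma (\<nu> + 1) * (norm z ^ m /\<^sub>R fact m))"
    by (intro summable_mult summable_exp_generic)
  fix m :: nat
  have "\<bar>bclif_coeff \<nu> m\<bar> \<le> rGamma (\<nu> + 1) / (fact m)\<^sup>2" by (rule abs_bclif_coeff_le[OF assms])
  also have "\<dots> \<le> rGamma (\<nu> + 1) / fact m"
    using rGamma_Suc_bound(1)[OF assms, of 0] fact_ge_1[of m, where 'a=real]
    by (intro divide_left_mono) (auto simp: power2_eq_square)
  finally have "\<bar>bclif_coeff \<nu> m\<bar> * norm z ^ m \<le> rGamma (\<nu> + 1) / fact m * norm z ^ m"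
    by (intro mult_right_mono) auto
  then show "norm (norm (of_real (bclif_coeff \<nu> m) * z ^ m)) \<le> rGamma (\<nu> + 1) * (norm z ^ m /\<^sub>R fact m)"
    by (simp add: norm_mult norm_power field_simps)
qed

lemma summable_bclif:
  fixes z :: "'a::{real_normed_field,banach}"
  assumes "\<nu> \<ge> 0"
  shows "summable (\<lambda>m. of_real (bclif_coeff \<nu> m) * z ^ m)"
  by (rule summable_norm_cancel[OF summable_norm_bclif[OF assms]])

lemma bclif_of_real:
  assumes "\<nu> \<ge> 0"
  shows "bclif \<nu> (of_real x) = (of_real (bclif \<nu> x) :: complex)"
proof -
  have "summable (\<lambda>m. bclif_coeff \<nu> m * x ^ m)" using summable_bclif[OF assms, of x] by simp
  from suminf_of_real[OF this, where 'a=complex] show ?thesis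
    by (simp add: bclif_def)
qed

lemma bclif_cnj:
  assumes "\<nu> \<ge> 0"
  shows "bclif \<nu> (cnj z) = cnj (bclif \<nu> z)"
proof -
  have "(\<lambda>m. of_real (bclif_coeff \<nu> m) * z ^ m) sums bclif \<nu> z"
    using summable_bclif[OF assms, of z] by (simp add: bclif_def summable_sums)
  then have "(\<lambda>m. cnj (of_real (bclif_coeff \<nu> m) * z ^ m)) sums cnj (bclif \<nu> z)"
    by (simp only: sums_cnj)
  then show ?thesis by (simp add: bclif_def sums_iff)
qed

lemma bclif_has_field_derivative:
  fixes z :: "'a::{real_normed_field,banach}"
  assumes "\<nu> \<ge> 0"
  shows "(bclif \<nu> has_field_derivative - bclif (\<nu> + 1) z) (at z)"
proof -
  have "((\<lambda>z. \<Sum>m. of_real (bclif_coeff \<nu> m) * z ^ m) has_field_derivative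
      (\<Sum>m. diffs (\<lambda>m. of_real (bclif_coeff \<nu> m)) m * z ^ m)) (at z)"
    by (rule termdiffs_strong_converges_everywhere) (rule summable_bclif[OF assms])
  also have "(\<lambda>m. diffs (\<lambda>m. of_real (bclif_coeff \<nu> m)) m * z ^ m)
      = (\<lambda>m. - (of_real (bclif_coeff (\<nu> + 1) m) * z ^ m))"
  proof
    fix m
    have "of_real (real (Suc m) * bclif_coeff \<nu> (Suc m)) = (of_real (- bclif_coeff (\<nu> + 1) m) :: 'a)"
      by (simp only: bclif_coeff_Suc)
    then show "diffs (\<lambda>m. of_real (bclif_coeff \<nu> m)) m * z ^ m
      = - (of_real (bclif_coeff (\<nu> + 1) m) * z ^ m)"
      by (simp add: diffs_def del: of_nat_Suc)
  qed
  finally show ?thesis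
    using summable_bclif[of "\<nu> + 1" z] assms by (simp add: bclif_def[abs_def] suminf_minus)
qed

lemma bclif_DERIV [derivative_intros]:
  fixes f :: "'a::{real_normed_field,banach} \<Rightarrow> 'a"
  assumes "\<nu> \<ge> 0" "(f has_field_derivative f') (at x within S)"
  shows "((\<lambda>x. bclif \<nu> (f x)) has_field_derivative - bclif (\<nu> + 1) (f x) * f') (at x within S)"
  by (rule DERIV_chain2[OF bclif_has_field_derivative[OF assms(1)] assms(2)])

lemma bclif_continuous_on [continuous_intros]:
  fixes f :: "'b::topological_space \<Rightarrow> 'a::{real_normed_field,banach}"
  assumes "\<nu> \<ge> 0" "continuous_on S f"
  shows "continuous_on S (\<lambda>x. bclif \<nu> (f x))"
proof -
  have "continuous_on UNIV (bclif \<nu> :: 'a \<Rightarrow> 'a)"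
    using bclif_has_field_derivative[OF assms(1)] DERIV_isCont continuous_at_imp_continuous_on by blast
  from continuous_on_compose2[OF this assms(2)] show ?thesis by auto
qed

lemma bclif_ode:
  fixes z :: "'a::{real_normed_field,banach}"
  assumes "\<nu> \<ge> 0"
  shows "z * bclif (\<nu> + 2) z - of_real (\<nu> + 1) * bclif (\<nu> + 1) z + bclif \<nu> z = 0"
proof -
  have s: "(\<lambda>m. of_real (bclif_coeff a m) * z ^ m) sums bclif a z" if "a \<ge> 0" for a
    using summable_bclif[OF that, of z] by (simp add: bclif_def summable_sums)
  have "(\<lambda>m. z * (of_real (bclif_coeff (\<nu> + 2) m) * z ^ m)) sums (z * bclif (\<nu> + 2) z)"
    using s[of "\<nu> + 2"] assms by (intro sums_mult) auto
  also have "(\<lambda>m. z * (of_real (bclif_coeff (\<nu> + 2) m) * z ^ m)) =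
    (\<lambda>m. - (of_real (real (Suc m) * bclif_coeff (\<nu> + 1) (Suc m)) * z ^ Suc m))"
    unfolding bclif_coeff_Suc by (simp add: add.assoc mult_ac)
  finally have "(\<lambda>m. - (of_real (real m * bclif_coeff (\<nu> + 1) m) * z ^ m)) sums (z * bclif (\<nu> + 2) z)"
    by (subst (asm) sums_Suc_iff) simp
  moreover have "(\<lambda>m. of_real (\<nu> + 1) * (of_real (bclif_coeff (\<nu> + 1) m) * z ^ m)) sums
      (of_real (\<nu> + 1) * bclif (\<nu> + 1) z)"
    using s[of "\<nu> + 1"] assms by (intro sums_mult) auto
  ultimately have "(\<lambda>m. - (of_real (real m * bclif_coeff (\<nu> + 1) m) * z ^ m)
      - of_real (\<nu> + 1) * (of_real (bclif_coeff (\<nu> + 1) m) * z ^ m) + of_real (bclif_coeff \<nu> m) * z ^ m)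
     sums (z * bclif (\<nu> + 2) z - of_real (\<nu> + 1) * bclif (\<nu> + 1) z + bclif \<nu> z)"
    using s[OF assms] by (intro sums_add sums_diff)
  also have "(\<lambda>m. - (of_real (real m * bclif_coeff (\<nu> + 1) m) * z ^ m)
      - of_real (\<nu> + 1) * (of_real (bclif_coeff (\<nu> + 1) m) * z ^ m) + of_real (bclif_coeff \<nu> m) * z ^ m)
      = (\<lambda>m. 0)"
    by (subst (3) bclif_coeff_plus1) (simp add: algebra_simps)
  finally show ?thesis by (simp add: sums_iff)
qed

text \<open>
  The coefficients carry a second factor \<open>1/m!\<close> besides that of the exponential series, and it is eventually
  smaller than every geometric sequence. This is what excludes an exponential factor in the product formula.
\<close>
lemma bclif_uminus_le:
  fixes x :: real
  assumes "\<nu> \<ge> 0" "x \<ge> 0" "e > 0"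
  shows "bclif \<nu> (- x) \<le> rGamma (\<nu> + 1) * exp (1 / e) * exp (e * x)"
proof -
  have f: "1 / fact m \<le> exp (1 / e) * e ^ m" for m
  proof -
    have "(1 / e) ^ m /\<^sub>R fact m \<le> (\<Sum>m. (1 / e) ^ m /\<^sub>R fact m)"
      using sum_le_suminf[OF summable_exp_generic, of "{m}" "1 / e"] assms by auto
    then show ?thesis using assms by (simp add: exp_def field_simps)
  qed
  have sm: "summable (\<lambda>m. rGamma (\<nu> + 1) * exp (1 / e) * ((e * x) ^ m /\<^sub>R fact m))"
    by (intro summable_mult summable_exp_generic)
  have "bclif \<nu> (- x) \<le> (\<Sum>m. rGamma (\<nu> + 1) * exp (1 / e) * ((e * x) ^ m /\<^sub>R fact m))"
    unfolding bclif_def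
  proof (rule suminf_le)
    fix m :: nat
    have "of_real (bclif_coeff \<nu> m) * (- x) ^ m \<le> \<bar>bclif_coeff \<nu> m\<bar> * x ^ m"
      using assms by (simp add: abs_mult power_abs flip: abs_le_iff) (smt (verit) abs_mult abs_ge_self power_abs abs_minus_cancel abs_of_nonneg)
    also have "\<dots> \<le> (rGamma (\<nu> + 1) / (fact m)\<^sup>2) * x ^ m"
      using assms by (intro mult_right_mono abs_bclif_coeff_le) auto
    also have "\<dots> = (rGamma (\<nu> + 1) * x ^ m / fact m) * (1 / fact m)"
      by (simp add: power2_eq_square)
    also have "\<dots> \<le> (rGamma (\<nu> + 1) * x ^ m / fact m) * (exp (1 / e) * e ^ m)"
      using assms rGamma_Suc_bound(1)[OF assms(1), of 0] by (intro mult_left_mono f) auto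
    also have "\<dots> = rGamma (\<nu> + 1) * exp (1 / e) * ((e * x) ^ m /\<^sub>R fact m)"
      by (simp add: field_simps power_mult_distrib)
    finally show "of_real (bclif_coeff \<nu> m) * (- x) ^ m \<le> rGamma (\<nu> + 1) * exp (1 / e) * ((e * x) ^ m /\<^sub>R fact m)" .
  qed (use summable_bclif[OF assms(1), of "-x"] sm in auto)
  also have "\<dots> = rGamma (\<nu> + 1) * exp (1 / e) * exp (e * x)"
    unfolding exp_def by (intro suminf_mult summable_exp_generic)
  finally show ?thesis .
qed

lemma bclif_0: "bclif \<nu> 0 = of_real (rGamma (\<nu> + 1))"
  unfolding bclif_def by (subst powser_zero) (simp add: bclif_coeff_def)

lemma bclif_term_nonneg:
  assumes "\<nu> \<ge> 0" "x \<le> 0"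
  shows "0 \<le> bclif_coeff \<nu> m * x ^ m"
proof -
  have "bclif_coeff \<nu> m * x ^ m = rGamma (\<nu> + real m + 1) / fact m * (- x) ^ m"
    by (simp add: bclif_coeff_def power_mult_distrib[symmetric] mult_ac)
  also have "\<dots> \<ge> 0" using rGamma_Suc_bound(1)[OF assms(1), of m] assms by simp
  finally show ?thesis .
qed

lemma bclif_nonpos_pos:
  fixes x :: real
  assumes "\<nu> \<ge> 0" "x \<le> 0"
  shows "bclif \<nu> x > 0"
proof -
  have "0 < bclif_coeff \<nu> 0 * x ^ 0"
    using rGamma_Suc_bound(1)[OF assms(1), of 0] by (simp add: bclif_coeff_def)
  also have "\<dots> \<le> (\<Sum>m. bclif_coeff \<nu> m * x ^ m)"
    using sum_le_suminf[of "\<lambda>m. bclif_coeff \<nu> m * x ^ m" "{0}"] bclif_term_nonneg[OF assms] summable_bclif[OF assms(1), of x] by auto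
  finally show ?thesis by (simp add: bclif_def)
qed

section \<open>Lommel integrals and the zeros\<close>

text \<open>
  If \<open>z B' + (\<nu> + 1) B = g\<close>, then \<open>z\<^bsup>\<nu>+1\<^esup> B\<close> is an antiderivative of \<open>z\<^bsup>\<nu>\<^esup> g\<close>. The substitution
  \<open>z = x\<^bsup>\<beta>\<^esup>\<close> is built in: \<open>\<beta> = 1\<close> serves the study of the zeros, \<open>\<beta> = 2 - \<alpha>\<close> the eigenfunctions.
\<close>
lemma weighted_chain_has_integral:
  fixes B B' g :: "complex \<Rightarrow> complex" and \<beta> \<nu> :: real
  assumes \<beta>: "\<beta> > 0" and \<nu>: "\<nu> \<ge> 0"
    and B: "\<And>z. (B has_field_derivative B' z) (at z)"
    and g: "\<And>z. z * B' z + of_real (\<nu> + 1) * B z = g z"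
  shows "((\<lambda>x. of_real (\<beta> * x powr (\<beta> * (\<nu> + 1) - 1)) * g (of_real (x powr \<beta>))) has_integral B 1) {0..1}"
proof -
  define F where "F = (\<lambda>x. of_real (x powr (\<beta> * (\<nu> + 1))) * B (of_real (x powr \<beta>)))"
  have pos: "\<beta> * (\<nu> + 1) > 0" using \<beta> \<nu> by simp
  have "(( \<lambda>x. of_real (\<beta> * x powr (\<beta> * (\<nu> + 1) - 1)) * g (of_real (x powr \<beta>))) has_integral (F 1 - F 0)) {0..1}"
  proof (rule fundamental_theorem_of_calculus_interior)
    have contB: "continuous_on UNIV B"
      using B DERIV_isCont continuous_at_imp_continuous_on by blast
    have "continuous_on {0..1} (\<lambda>x::real. B (of_real (x powr \<beta>)))"
      by (rule continuous_on_compose2[OF contB])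
         (use \<beta> in \<open>auto intro!: continuous_intros continuous_on_powr'\<close>)
    then show "continuous_on {0..1} F"
      unfolding F_def using pos by (auto intro!: continuous_intros continuous_on_powr')
  next
    fix x :: real assume "x \<in> {0<..<1}"
    then have x: "x > 0" by simp
    define X where "X = x powr \<beta>"
    have dX: "((\<lambda>x. complex_of_real (x powr \<beta>)) has_vector_derivative of_real (\<beta> * x powr (\<beta> - 1))) (at x)"
      using x by (intro has_vector_derivative_of_real) (auto intro!: derivative_eq_intros)
    have dP: "((\<lambda>x. complex_of_real (x powr (\<beta> * (\<nu> + 1)))) has_vector_derivative
         of_real (\<beta> * (\<nu> + 1) * x powr (\<beta> * (\<nu> + 1) - 1))) (at x)"
      using x by (intro has_vector_derivative_of_real) (auto intro!: derivative_eq_intros)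
    have dB: "((\<lambda>x. B (complex_of_real (x powr \<beta>))) has_vector_derivative
         of_real (\<beta> * x powr (\<beta> - 1)) * B' (of_real X)) (at x)"
      using field_vector_diff_chain_at[OF dX B] by (simp add: o_def X_def)
    have eq: "x powr (\<beta> * (\<nu> + 1)) * x powr (\<beta> - 1) = x powr (\<beta> * (\<nu> + 1) - 1) * X"
      by (simp add: X_def flip: powr_add) (simp add: algebra_simps)
    have "(F has_vector_derivative of_real (x powr (\<beta> * (\<nu> + 1))) * (of_real (\<beta> * x powr (\<beta> - 1)) * B' (of_real X))
        + of_real (\<beta> * (\<nu> + 1) * x powr (\<beta> * (\<nu> + 1) - 1)) * B (of_real X)) (at x)"
      unfolding F_def X_def by (rule has_vector_derivative_mult[OF dP dB[unfolded X_def]])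
    also have "of_real (x powr (\<beta> * (\<nu> + 1))) * (of_real (\<beta> * x powr (\<beta> - 1)) * B' (of_real X))
        = of_real \<beta> * of_real (x powr (\<beta> * (\<nu> + 1)) * x powr (\<beta> - 1)) * B' (of_real X)"
      by simp
    also have "\<dots> = of_real (\<beta> * x powr (\<beta> * (\<nu> + 1) - 1)) * (of_real X * B' (of_real X))"
      unfolding eq by simp
    also have "\<dots> + of_real (\<beta> * (\<nu> + 1) * x powr (\<beta> * (\<nu> + 1) - 1)) * B (of_real X)
       = of_real (\<beta> * x powr (\<beta> * (\<nu> + 1) - 1)) * g (of_real X)"
      unfolding g[symmetric] by (simp add: algebra_simps)
    finally show "(F has_vector_derivative of_real (\<beta> * x powr (\<beta> * (\<nu> + 1) - 1)) * g (of_real (x powr \<beta>))) (at x)"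
      by (simp add: X_def)
  qed simp
  then show ?thesis by (simp add: F_def)
qed

text \<open>
  The inner product of \<open>E(z x)\<close> and \<open>E(w x)\<close> for the weight \<open>x\<^bsup>\<nu>\<^esup>\<close>. The off-diagonal branch is the
  Wronskian divided by \<open>z - w\<close>, the diagonal branch its limit.
\<close>
definition bclif_kernel :: "real \<Rightarrow> 'a \<Rightarrow> 'a \<Rightarrow> 'a::{real_normed_field,banach}" where
  "bclif_kernel \<nu> z w =
     (if z = w then z * (bclif (\<nu> + 1) z)\<^sup>2 + (bclif \<nu> z)\<^sup>2 - of_real \<nu> * bclif \<nu> z * bclif (\<nu> + 1) z
      else (z * bclif (\<nu> + 1) z * bclif \<nu> w - w * bclif \<nu> z * bclif (\<nu> + 1) w) / (z - w))"

lemma bclif_kernel_of_real: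
  assumes "\<nu> \<ge> 0"
  shows "bclif_kernel \<nu> (of_real x) (of_real y) = (of_real (bclif_kernel \<nu> x y) :: complex)"
  using assms by (simp add: bclif_kernel_def bclif_of_real)

lemma bclif_kernel_has_integral:
  fixes z w :: complex and \<beta> \<nu> :: real
  assumes \<beta>: "\<beta> > 0" and \<nu>: "\<nu> \<ge> 0"
  shows "((\<lambda>x. of_real (\<beta> * x powr (\<beta> * (\<nu> + 1) - 1)) *
            (bclif \<nu> (z * of_real (x powr \<beta>)) * bclif \<nu> (w * of_real (x powr \<beta>)))) has_integral bclif_kernel \<nu> z w) {0..1}"
proof (cases "z = w")
  case True
  define B where "B = (\<lambda>Z. w * Z * (bclif (\<nu> + 1) (w * Z))\<^sup>2 + (bclif \<nu> (w * Z))\<^sup>2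
       - of_real \<nu> * bclif \<nu> (w * Z) * bclif (\<nu> + 1) (w * Z))"
  define B' where "B' = (\<lambda>Z. w * (bclif (\<nu> + 1) (w * Z))\<^sup>2
       - 2 * w\<^sup>2 * Z * bclif (\<nu> + 1) (w * Z) * bclif (\<nu> + 2) (w * Z)
       - 2 * w * bclif \<nu> (w * Z) * bclif (\<nu> + 1) (w * Z)
       + of_real \<nu> * w * (bclif (\<nu> + 1) (w * Z))\<^sup>2
       + of_real \<nu> * w * bclif \<nu> (w * Z) * bclif (\<nu> + 2) (w * Z))"
  have "((\<lambda>x. of_real (\<beta> * x powr (\<beta> * (\<nu> + 1) - 1)) * (bclif \<nu> (w * of_real (x powr \<beta>)))\<^sup>2) has_integral B 1) {0..1}"
  proof (rule weighted_chain_has_integral[OF \<beta> \<nu>])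
    fix Z :: complex
    show "(B has_field_derivative B' Z) (at Z)"
      unfolding B_def B'_def using \<nu>
      by (auto intro!: derivative_eq_intros simp: power2_eq_square algebra_simps)
    define e0 e1 e2 where "e0 = bclif \<nu> (w * Z)" and "e1 = bclif (\<nu> + 1) (w * Z)" and "e2 = bclif (\<nu> + 2) (w * Z)"
    have e0: "e0 = of_real (\<nu> + 1) * e1 - w * Z * e2"
      using bclif_ode[OF \<nu>, of "w * Z"] by (simp add: e0_def e1_def e2_def algebra_simps)
    show "Z * B' Z + of_real (\<nu> + 1) * B Z = (bclif \<nu> (w * Z))\<^sup>2"
      unfolding B_def B'_def e0_def[symmetric] e1_def[symmetric] e2_def[symmetric]
      unfolding e0 by (simp add: power2_eq_square algebra_simps)
  qed
  then show ?thesis using True by (simp add: B_def bclif_kernel_def power2_eq_square)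
next
  case False
  define B where "B = (\<lambda>Z. z * bclif (\<nu> + 1) (z * Z) * bclif \<nu> (w * Z) - w * bclif \<nu> (z * Z) * bclif (\<nu> + 1) (w * Z))"
  define B' where "B' = (\<lambda>Z. w\<^sup>2 * bclif \<nu> (z * Z) * bclif (\<nu> + 2) (w * Z) - z\<^sup>2 * bclif (\<nu> + 2) (z * Z) * bclif \<nu> (w * Z))"
  have "((\<lambda>x. of_real (\<beta> * x powr (\<beta> * (\<nu> + 1) - 1)) *
      ((z - w) * (bclif \<nu> (z * of_real (x powr \<beta>)) * bclif \<nu> (w * of_real (x powr \<beta>))))) has_integral B 1) {0..1}"
  proof (rule weighted_chain_has_integral[OF \<beta> \<nu>])
    fix Z :: complex
    show "(B has_field_derivative B' Z) (at Z)"
      unfolding B_def B'_def using \<nu>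
      by (auto intro!: derivative_eq_intros simp: power2_eq_square algebra_simps)
    define e0 e1 e2 where "e0 = bclif \<nu> (z * Z)" and "e1 = bclif (\<nu> + 1) (z * Z)" and "e2 = bclif (\<nu> + 2) (z * Z)"
    have e0: "e0 = of_real (\<nu> + 1) * e1 - z * Z * e2"
      using bclif_ode[OF \<nu>, of "z * Z"] by (simp add: e0_def e1_def e2_def algebra_simps)
    define f0 f1 f2 where "f0 = bclif \<nu> (w * Z)" and "f1 = bclif (\<nu> + 1) (w * Z)" and "f2 = bclif (\<nu> + 2) (w * Z)"
    have f0: "f0 = of_real (\<nu> + 1) * f1 - w * Z * f2"
      using bclif_ode[OF \<nu>, of "w * Z"] by (simp add: f0_def f1_def f2_def algebra_simps)
    show "Z * B' Z + of_real (\<nu> + 1) * B Z = (z - w) * (bclif \<nu> (z * Z) * bclif \<nu> (w * Z))"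
      unfolding B_def B'_def e0_def[symmetric] e1_def[symmetric] e2_def[symmetric]
        f0_def[symmetric] f1_def[symmetric] f2_def[symmetric]
      unfolding e0 f0 by (simp add: power2_eq_square algebra_simps)
  qed
  then have "((\<lambda>x. inverse (z - w) * (of_real (\<beta> * x powr (\<beta> * (\<nu> + 1) - 1)) *
      ((z - w) * (bclif \<nu> (z * of_real (x powr \<beta>)) * bclif \<nu> (w * of_real (x powr \<beta>)))))) has_integral inverse (z - w) * B 1) {0..1}"
    by (rule has_integral_mult_right)
  moreover have "inverse (z - w) * (c * ((z - w) * p)) = c * p" for c p
    using False by simp
  ultimately show ?thesis using False by (simp only:) (simp add: B_def bclif_kernel_def divide_inverse mult_ac)
qed

lemma bclif_kernel_has_integral_1:
  fixes z w :: complex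
  assumes \<nu>: "\<nu> \<ge> 0"
  shows "((\<lambda>x. of_real (x powr \<nu>) * (bclif \<nu> (z * of_real x) * bclif \<nu> (w * of_real x))) has_integral bclif_kernel \<nu> z w) {0..1}"
proof -
  have "((\<lambda>x. of_real (1 * x powr (1 * (\<nu> + 1) - 1)) *
            (bclif \<nu> (z * of_real (x powr 1)) * bclif \<nu> (w * of_real (x powr 1)))) has_integral bclif_kernel \<nu> z w) {0..1}"
    using \<nu> by (intro bclif_kernel_has_integral) auto
  then show ?thesis
    by (rule has_integral_eq[rotated]) auto
qed

text \<open>
  The kernel at a pair of conjugate points is the integral of a squared modulus. It follows that the zeros
  are real, because the Wronskian vanishes at a pair of conjugate zeros, and simple, because the diagonal
  kernel vanishes at a double zero.
\<close>
lemma bclif_kernel_cnj_nonzero: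
  assumes \<nu>: "\<nu> > 0"
  shows "bclif_kernel \<nu> z (cnj z) \<noteq> 0"
proof
  assume 0: "bclif_kernel \<nu> z (cnj z) = 0"
  define f where "f = (\<lambda>x::real. x powr \<nu> * (cmod (bclif \<nu> (z * of_real x)))\<^sup>2)"
  have "((\<lambda>x. of_real (x powr \<nu>) * (bclif \<nu> (z * of_real x) * bclif \<nu> (cnj z * of_real x))) has_integral 0) {0..1}"
    using bclif_kernel_has_integral_1[of \<nu> z "cnj z"] \<nu> 0 by simp
  also have "(\<lambda>x. of_real (x powr \<nu>) * (bclif \<nu> (z * of_real x) * bclif \<nu> (cnj z * of_real x))) = (\<lambda>x. complex_of_real (f x))"
  proof
    fix x :: real
    have "bclif \<nu> (cnj z * of_real x) = cnj (bclif \<nu> (z * of_real x))"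
      using bclif_cnj[of \<nu> "z * of_real x"] \<nu> by simp
    then show "of_real (x powr \<nu>) * (bclif \<nu> (z * of_real x) * bclif \<nu> (cnj z * of_real x)) = complex_of_real (f x)"
      by (simp add: f_def complex_norm_square del: of_real_power)
  qed
  finally have "((\<lambda>x. Re (complex_of_real (f x))) has_integral Re 0) {0..1}"
    by (rule has_integral_linear[OF _ bounded_linear_Re, unfolded o_def])
  then have int: "(f has_integral 0) (cbox 0 1)" by simp
  have cont: "continuous_on (cbox 0 1) f"
    unfolding f_def using \<nu> by (auto intro!: continuous_intros continuous_on_powr')
  have fz: "f x = 0" if "x \<in> cbox 0 1" for x
    by (rule has_integral_0_cbox_imp_0[OF cont _ int _ that]) (auto simp: f_def)
  have ev: "\<forall>\<^sub>F n in sequentially. bclif \<nu> (z * of_real (inverse (real (Suc n)))) = 0"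
  proof (intro always_eventually allI)
    fix n show "bclif \<nu> (z * of_real (inverse (real (Suc n)))) = 0"
      using fz[of "inverse (real (Suc n))"] by (simp add: f_def field_simps del: of_nat_Suc)
  qed
  have "isCont (bclif \<nu> :: complex \<Rightarrow> complex) 0"
    using bclif_has_field_derivative[of \<nu> "0::complex"] \<nu> by (auto intro: DERIV_isCont)
  moreover have "(\<lambda>n. z * of_real (inverse (real (Suc n)))) \<longlonglongrightarrow> z * of_real 0"
    by (intro tendsto_intros LIMSEQ_inverse_real_of_nat)
  ultimately have "(\<lambda>n. bclif \<nu> (z * of_real (inverse (real (Suc n))))) \<longlonglongrightarrow> bclif \<nu> 0"
    using isCont_tendsto_compose[of 0 "bclif \<nu>"] by simp
  then have "bclif \<nu> (0::complex) = 0"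
    using tendsto_eventually[OF ev] LIMSEQ_unique by blast
  then show False using rGamma_Suc_bound(1)[of \<nu> 0] \<nu> by (simp add: bclif_0)
qed

lemma bclif_nonreal_nonzero:
  fixes z :: complex
  assumes \<nu>: "\<nu> > 0" and z: "z \<notin> \<real>"
  shows "bclif \<nu> z \<noteq> 0"
proof
  assume 0: "bclif \<nu> z = 0"
  have "bclif \<nu> (cnj z) = 0" using bclif_cnj[of \<nu> z] \<nu> 0 by simp
  moreover have "z \<noteq> cnj z" using z by (metis Reals_cnj_iff)
  ultimately have "bclif_kernel \<nu> z (cnj z) = 0" using 0 by (simp add: bclif_kernel_def)
  then show False using bclif_kernel_cnj_nonzero[OF \<nu>] by blast
qed

lemma bclif_simple_zero:
  fixes t :: real
  assumes \<nu>: "\<nu> > 0" and t: "bclif \<nu> t = 0"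
  shows "bclif (\<nu> + 1) t \<noteq> 0"
proof
  assume 0: "bclif (\<nu> + 1) t = 0"
  have "bclif_kernel \<nu> (of_real t) (of_real t) = (of_real (bclif_kernel \<nu> t t) :: complex)"
    using \<nu> by (intro bclif_kernel_of_real) auto
  also have "\<dots> = 0" using t 0 by (simp add: bclif_kernel_def)
  finally show False using bclif_kernel_cnj_nonzero[OF \<nu>, of "of_real t"] by simp
qed

lemma bclif_zero_pos: "\<nu> \<ge> 0 \<Longrightarrow> bclif \<nu> (t::real) = 0 \<Longrightarrow> t > 0"
  using bclif_nonpos_pos[of \<nu> t] by (cases "t \<le> 0") auto

text \<open>
  Let \<open>c\<close> be the point between the zeros at which \<open>s E\<close> has its maximum \<open>M\<close>. Since
  \<open>(x E' + \<nu> E)' = - E\<close>, the function cannot fall faster than \<open>M - M (x - c)\<^sup>2 / (2 c)\<close> to the right of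
  \<open>c\<close>, so that the next zero has distance at least \<open>\<surd>(2 c)\<close> from \<open>c\<close>.
\<close>
lemma bclif_zero_gap_aux:
  fixes a b c M s :: real
  assumes \<nu>: "\<nu> > 0" and s: "s = 1 \<or> s = - 1" and ab: "0 < a" "a < c" "c < b"
    and M: "M > 0" "s * bclif \<nu> c = M" "\<And>x. x \<in> {a..b} \<Longrightarrow> s * bclif \<nu> x \<le> M"
    and b: "bclif \<nu> b = 0"
  shows "b - a \<ge> sqrt (2 * a)"
proof -
  have \<nu>0: "\<nu> \<ge> 0" using \<nu> by simp
  have "DERIV (\<lambda>x. s * bclif \<nu> x) c :> s * (- bclif (\<nu> + 1) c)"
    using \<nu> by (auto intro!: derivative_eq_intros)
  then have dc: "s * bclif (\<nu> + 1) c = 0"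
    using DERIV_local_max[of "\<lambda>x. s * bclif \<nu> x" "s * (- bclif (\<nu> + 1) c)" c "min (c - a) (b - c)"] ab M
    by (auto simp: abs_if split: if_splits)
  have dq: "- M * (x - c) \<le> x * (- s * bclif (\<nu> + 1) x)" if x: "x \<in> {c..b}" for x
  proof -
    \<comment> \<open>By the equation, \<open>q\<close> has derivative \<open>M - s E\<close>, which is nonnegative.\<close>
    define q where "q = (\<lambda>x. x * (- s * bclif (\<nu> + 1) x) + \<nu> * (s * bclif \<nu> x) + M * (x - c))"
    have "q c \<le> q x"
    proof (rule DERIV_nonneg_imp_nondecreasing[of c x q])
      fix y assume y: "c \<le> y" "y \<le> x"
      have "y * bclif (\<nu> + 2) y - (\<nu> + 1) * bclif (\<nu> + 1) y = - bclif \<nu> y"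
        using bclif_ode[OF \<nu>0, of y] by simp
      then have ode: "s * (y * bclif (\<nu> + 2) y - (\<nu> + 1) * bclif (\<nu> + 1) y) = s * (- bclif \<nu> y)" by simp
      have "DERIV q y :> M + s * (y * bclif (\<nu> + 2) y - (\<nu> + 1) * bclif (\<nu> + 1) y)"
        unfolding q_def using \<nu> by (auto intro!: derivative_eq_intros simp: algebra_simps)
      then have "DERIV q y :> M - s * bclif \<nu> y" using ode by simp
      then show "\<exists>d. DERIV q y :> d \<and> 0 \<le> d" using M(3)[of y] y x ab by (intro exI[of _ "M - s * bclif \<nu> y"]) auto
    qed (use x in auto)
    then have "\<nu> * M \<le> x * (- s * bclif (\<nu> + 1) x) + \<nu> * (s * bclif \<nu> x) + M * (x - c)"
      using dc M(2) by (simp add: q_def)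
    moreover have "\<nu> * (s * bclif \<nu> x) \<le> \<nu> * M" using M(3)[of x] x ab \<nu> by (intro mult_left_mono) auto
    ultimately show ?thesis by simp
  qed
  \<comment> \<open>The preceding bound, divided by \<open>x \<ge> c\<close>, says that \<open>h\<close> increases.\<close>
  define h where "h = (\<lambda>x. s * bclif \<nu> x + M * (x - c)\<^sup>2 / (2 * c))"
  have "h c \<le> h b"
  proof (rule DERIV_nonneg_imp_nondecreasing[of c b h])
    fix x assume x: "c \<le> x" "x \<le> b"
    have c0: "c > 0" using ab by simp
    have "DERIV h x :> - s * bclif (\<nu> + 1) x + M * (x - c) / c"
      unfolding h_def using \<nu> c0 by (auto intro!: derivative_eq_intros simp: field_simps)
    moreover have "- s * bclif (\<nu> + 1) x + M * (x - c) / c \<ge> 0"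
    proof -
      have "- M * (x - c) / x \<le> - s * bclif (\<nu> + 1) x"
        using dq[of x] x c0 by (subst pos_divide_le_eq) (auto simp: mult_ac)
      moreover have "M * (x - c) / x \<le> M * (x - c) / c"
        using x c0 M by (intro divide_left_mono) auto
      ultimately show ?thesis by simp
    qed
    ultimately show "\<exists>d. DERIV h x :> d \<and> 0 \<le> d" by blast
  qed (use ab in auto)
  then have "M \<le> M * (b - c)\<^sup>2 / (2 * c)" using M(2) b by (simp add: h_def)
  then have "2 * c \<le> (b - c)\<^sup>2" using M(1) ab by (simp add: field_simps)
  also have "\<dots> \<le> (b - a)\<^sup>2" using ab by (intro power_mono) auto
  finally have "2 * a \<le> (b - a)\<^sup>2" using ab by simp
  then show ?thesis using ab by (simp add: real_le_lsqrt)
qed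

lemma bclif_zero_gap:
  fixes a b :: real
  assumes \<nu>: "\<nu> > 0" and ab: "a < b" and za: "bclif \<nu> a = 0" and zb: "bclif \<nu> b = 0"
  shows "b - a \<ge> sqrt (2 * a)"
proof -
  have \<nu>0: "\<nu> \<ge> 0" using \<nu> by simp
  have a0: "a > 0" using bclif_zero_pos[OF \<nu>0 za] .
  have "continuous_on {a..b} (\<lambda>x. \<bar>bclif \<nu> x\<bar>)"
    using \<nu> by (auto intro!: continuous_intros)
  then obtain c where c: "c \<in> {a..b}" "\<And>x. x \<in> {a..b} \<Longrightarrow> \<bar>bclif \<nu> x\<bar> \<le> \<bar>bclif \<nu> c\<bar>"
    using continuous_attains_sup[of "{a..b}" "\<lambda>x. \<bar>bclif \<nu> x\<bar>"] ab by auto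
  have nz: "bclif \<nu> c \<noteq> 0"
  proof
    assume "bclif \<nu> c = 0"
    then have z: "bclif \<nu> x = 0" if "x \<in> {a..b}" for x using c(2)[OF that] by simp
    define m where "m = (a + b) / 2"
    have "DERIV (bclif \<nu>) m :> - bclif (\<nu> + 1) m" using bclif_has_field_derivative[OF \<nu>0] .
    moreover have "\<forall>y. \<bar>m - y\<bar> < (b - a) / 2 \<longrightarrow> bclif \<nu> m = bclif \<nu> y"
      using z ab by (auto simp: m_def abs_if field_simps split: if_splits)
    ultimately have "- bclif (\<nu> + 1) m = 0"
      using DERIV_local_const[of "bclif \<nu>" "- bclif (\<nu> + 1) m" m "(b - a) / 2"] ab by simp
    moreover have "bclif \<nu> m = 0" using z ab by (simp add: m_def)
    ultimately show False using bclif_simple_zero[OF \<nu>] by simp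
  qed
  then have "c \<noteq> a" "c \<noteq> b" using za zb by auto
  then have c': "a < c" "c < b" using c(1) by auto
  have "sgn (bclif \<nu> c) = 1 \<or> sgn (bclif \<nu> c) = - 1" using nz by (auto simp: sgn_if)
  moreover have "sgn (bclif \<nu> c) * bclif \<nu> c = \<bar>bclif \<nu> c\<bar>" by (simp add: abs_sgn)
  moreover have "sgn (bclif \<nu> c) * bclif \<nu> x \<le> \<bar>bclif \<nu> c\<bar>" if "x \<in> {a..b}" for x
    using c(2)[OF that] by (auto simp: sgn_if abs_if split: if_splits)
  ultimately show ?thesis
    using bclif_zero_gap_aux[OF \<nu> _ a0 c', of "sgn (bclif \<nu> c)" "\<bar>bclif \<nu> c\<bar>"] nz zb by auto
qed

text \<open>
  Expanding \<open>0 \<le> \<parallel>u - (\<Sum>t\<in>F. a\<^sub>t u\<^sub>t)\<parallel>\<^sup>2\<close> with \<open>u = E(z x)\<close>, \<open>u\<^sub>t = E(t x)\<close> and the Fourier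
  coefficients \<open>a\<^sub>t\<close>. The right-hand side is \<open>\<parallel>u\<parallel>\<^sup>2 / \<bar>E z\<bar>\<^sup>2\<close>.
\<close>
lemma bclif_bessel_inequality:
  fixes z :: complex and F :: "real set"
  assumes \<nu>: "\<nu> > 0" and z: "Im z \<noteq> 0" and F: "finite F" "\<And>t. t \<in> F \<Longrightarrow> bclif \<nu> t = 0"
  shows "(\<Sum>t\<in>F. t / (cmod (z - of_real t))\<^sup>2)
    \<le> Im (z * bclif (\<nu> + 1) z * cnj (bclif \<nu> z)) / (Im z * (cmod (bclif \<nu> z))\<^sup>2)"
proof -
  have \<nu>0: "\<nu> \<ge> 0" using \<nu> by simp
  have zR: "z \<notin> \<real>" using z by (simp add: complex_is_Real_iff)
  have Ez: "bclif \<nu> z \<noteq> 0" by (rule bclif_nonreal_nonzero[OF \<nu> zR])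
  have zt: "z \<noteq> of_real t" "cnj z \<noteq> of_real t" for t using zR by (auto simp: complex_eq_iff z)
  have F0: "bclif \<nu> (of_real t) = (0::complex)" if "t \<in> F" for t
    using F(2)[OF that] bclif_of_real[OF \<nu>0, of t] by simp
  define e where "e = (\<lambda>t::real. bclif (\<nu> + 1) t)"
  have e: "bclif (\<nu> + 1) (of_real t) = complex_of_real (e t)" for t
    using bclif_of_real[of "\<nu> + 1" t] \<nu> by (simp add: e_def)
  have e0: "e t \<noteq> 0" if "t \<in> F" for t using bclif_simple_zero[OF \<nu> F(2)[OF that]] by (simp add: e_def)
  define a where "a = (\<lambda>t. - bclif \<nu> z / (of_real (e t) * (z - of_real t)))"
  let ?K = "bclif_kernel \<nu>"
  let ?J = "\<lambda>z w x. of_real (x powr \<nu>) * (bclif \<nu> (z * of_real x) * bclif \<nu> (w * of_real x)) :: complex"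
  define f where "f = (\<lambda>x. ?J z (cnj z) x - (\<Sum>t\<in>F. cnj (a t) * ?J z (of_real t) x)
      - (\<Sum>t\<in>F. a t * ?J (of_real t) (cnj z) x)
      + (\<Sum>t\<in>F. \<Sum>s\<in>F. a t * cnj (a s) * ?J (of_real t) (of_real s) x))"
  have int: "(f has_integral (?K z (cnj z) - (\<Sum>t\<in>F. cnj (a t) * ?K z (of_real t))
      - (\<Sum>t\<in>F. a t * ?K (of_real t) (cnj z))
      + (\<Sum>t\<in>F. \<Sum>s\<in>F. a t * cnj (a s) * ?K (of_real t) (of_real s)))) {0..1}"
    unfolding f_def using F(1) \<nu>0
    by (intro has_integral_add has_integral_diff has_integral_sum has_integral_mult_right
          bclif_kernel_has_integral_1) auto
  have fRe: "0 \<le> Re (f x)" if "x \<in> {0..1}" for x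
  proof -
    define q where "q = bclif \<nu> (z * of_real x) - (\<Sum>t\<in>F. a t * bclif \<nu> (of_real t * of_real x))"
    have c1: "cnj (bclif \<nu> (z * of_real x)) = bclif \<nu> (cnj z * of_real x)"
      using bclif_cnj[OF \<nu>0, of "z * of_real x"] by simp
    have c2: "cnj (bclif \<nu> (of_real t * of_real x)) = bclif \<nu> (of_real t * of_real x)" for t
      using bclif_cnj[OF \<nu>0, of "of_real t * of_real x"] by simp
    define P u u' v where "P = complex_of_real (x powr \<nu>)" and "u = bclif \<nu> (z * of_real x)"
      and "u' = bclif \<nu> (cnj z * of_real x)" and "v = (\<lambda>t. bclif \<nu> (complex_of_real t * of_real x))"
    define A A' where "A = (\<Sum>t\<in>F. a t * v t)" and "A' = (\<Sum>t\<in>F. cnj (a t) * v t)"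
    have "(\<Sum>t\<in>F. cnj (a t) * (P * (u * v t))) = P * (u * A')"
      by (simp add: A'_def sum_distrib_left mult_ac)
    moreover have "(\<Sum>t\<in>F. a t * (P * (v t * u'))) = P * (A * u')"
      by (simp add: A_def sum_distrib_left sum_distrib_right mult_ac)
    moreover have "(\<Sum>t\<in>F. \<Sum>s\<in>F. a t * cnj (a s) * (P * (v t * v s))) = P * (A * A')"
      unfolding A_def A'_def sum_product by (simp add: sum_distrib_left mult_ac)
    ultimately have "f x = P * (u * u') - P * (u * A') - P * (A * u') + P * (A * A')"
      unfolding f_def P_def u_def u'_def v_def by simp
    also have "\<dots> = P * ((u - A) * (u' - A'))" by (simp add: algebra_simps)
    also have "u - A = q" by (simp add: q_def u_def A_def v_def)
    also have "u' - A' = cnj q"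
      unfolding q_def u'_def A'_def v_def by (simp add: c1 c2)
    finally have "f x = of_real (x powr \<nu>) * (q * cnj q)" by (simp add: P_def)
    also have "\<dots> = of_real (x powr \<nu> * (cmod q)\<^sup>2)" by (simp add: complex_norm_square del: of_real_power)
    finally show ?thesis by simp
  qed
  have K1: "?K z (of_real t) = a t * of_real (t * (e t)\<^sup>2)" if "t \<in> F" for t
  proof -
    have "?K z (of_real t) = - (of_real t * bclif \<nu> z * of_real (e t)) / (z - of_real t)"
      using zt[of t] F0[OF that] by (simp add: bclif_kernel_def e)
    also have "\<dots> = a t * of_real (t * (e t)\<^sup>2)"
      using zt(1)[of t] e0[OF that] by (simp add: a_def field_simps power2_eq_square)
    finally show ?thesis .
  qed
  have K2: "?K (of_real t) (cnj z) = cnj (a t) * of_real (t * (e t)\<^sup>2)" if "t \<in> F" for t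
  proof -
    have "?K (of_real t) (cnj z) = of_real t * of_real (e t) * cnj (bclif \<nu> z) / (of_real t - cnj z)"
      using zt[of t] F0[OF that] bclif_cnj[OF \<nu>0, of z] by (auto simp add: bclif_kernel_def e)
    also have "\<dots> = cnj (a t) * of_real (t * (e t)\<^sup>2)"
      using zt(2)[of t] e0[OF that] by (simp add: a_def field_simps power2_eq_square)
    finally show ?thesis .
  qed
  have K3: "?K (of_real t) (of_real s) = (if t = s then of_real (t * (e t)\<^sup>2) else (0::complex))" if "t \<in> F" "s \<in> F" for t s
    using F0[OF that(1)] F0[OF that(2)] by (simp add: bclif_kernel_def e)
  define S where "S = (\<Sum>t\<in>F. (cmod (a t))\<^sup>2 * (t * (e t)\<^sup>2))"
  have S1: "(\<Sum>t\<in>F. cnj (a t) * ?K z (of_real t)) = of_real S"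
    unfolding S_def of_real_sum by (intro sum.cong refl) (simp add: K1 complex_norm_square mult_ac del: of_real_power)
  have S2: "(\<Sum>t\<in>F. a t * ?K (of_real t) (cnj z)) = of_real S"
    unfolding S_def of_real_sum by (intro sum.cong refl) (simp add: K2 complex_norm_square mult_ac del: of_real_power)
  have S3: "(\<Sum>t\<in>F. \<Sum>s\<in>F. a t * cnj (a s) * ?K (of_real t) (of_real s)) = of_real S"
  proof -
    have "(\<Sum>s\<in>F. a t * cnj (a s) * ?K (of_real t) (of_real s)) = of_real ((cmod (a t))\<^sup>2 * (t * (e t)\<^sup>2))" if t: "t \<in> F" for t
    proof -
      have "(\<Sum>s\<in>F. a t * cnj (a s) * ?K (of_real t) (of_real s)) =
         (\<Sum>s\<in>F. if t = s then a t * cnj (a t) * of_real (t * (e t)\<^sup>2) else 0)"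
        using t by (intro sum.cong refl) (simp add: K3)
      then show ?thesis using t F(1) by (simp add: complex_norm_square del: of_real_power)
    qed
    then show ?thesis by (simp add: S_def)
  qed
  have "(f has_integral (?K z (cnj z) - of_real S)) {0..1}"
    using int unfolding S1 S2 S3 by simp
  from has_integral_linear[OF this bounded_linear_Re]
  have "((\<lambda>x. Re (f x)) has_integral Re (?K z (cnj z) - of_real S)) {0..1}" by (simp add: o_def)
  from has_integral_nonneg[OF this] fRe have *: "S \<le> Re (?K z (cnj z))" by simp
  have "S = (cmod (bclif \<nu> z))\<^sup>2 * (\<Sum>t\<in>F. t / (cmod (z - of_real t))\<^sup>2)"
    unfolding S_def sum_distrib_left
    by (intro sum.cong refl) (use e0 zt in \<open>simp add: a_def norm_divide norm_mult power_divide power_mult_distrib\<close>)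
  moreover have "Re (?K z (cnj z)) = Im (z * bclif (\<nu> + 1) z * cnj (bclif \<nu> z)) / Im z"
  proof -
    define w where "w = z * bclif (\<nu> + 1) z * cnj (bclif \<nu> z)"
    have ne: "z \<noteq> cnj z" using zR by (metis Reals_cnj_iff)
    have "?K z (cnj z) = (w - cnj w) / (z - cnj z)"
      using ne bclif_cnj[OF \<nu>0, of z] bclif_cnj[of "\<nu> + 1" z] \<nu>
      by (simp add: bclif_kernel_def w_def mult_ac)
    also have "w - cnj w = of_real (2 * Im w) * \<i>" by (simp add: complex_eq_iff)
    also have "z - cnj z = of_real (2 * Im z) * \<i>" by (simp add: complex_eq_iff)
    also have "of_real (2 * Im w) * \<i> / (of_real (2 * Im z) * \<i>) = complex_of_real (Im w / Im z)"
      using z by simp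
    finally show ?thesis by (simp add: w_def)
  qed
  ultimately have "(\<Sum>t\<in>F. t / (cmod (z - of_real t))\<^sup>2) * (cmod (bclif \<nu> z))\<^sup>2
      \<le> Im (z * bclif (\<nu> + 1) z * cnj (bclif \<nu> z)) / Im z"
    using * by (simp only: mult.commute)
  moreover have "(cmod (bclif \<nu> z))\<^sup>2 > 0" using Ez by simp
  ultimately have "(\<Sum>t\<in>F. t / (cmod (z - of_real t))\<^sup>2)
      \<le> Im (z * bclif (\<nu> + 1) z * cnj (bclif \<nu> z)) / Im z / (cmod (bclif \<nu> z))\<^sup>2"
    by (subst pos_le_divide_eq)
  then show ?thesis by (simp only: divide_divide_eq_left)
qed

section \<open>Dividing out zeros; typically real functions\<close>

text \<open>
  Rogosinski's observation on the typically real function \<open>z p(z)\<close>: since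
  \<open>(1 - z\<^sup>2/r\<^sup>2) / z = - 2 \<i> Im z / r\<^sup>2\<close> on the circle of radius \<open>r\<close>, the function
  \<open>(1 - z\<^sup>2/r\<^sup>2) p(z)\<close> has nonnegative real part on it, hence inside. The Schwarz lemma then keeps it close to its
  value at the origin.
\<close>
lemma typically_real_bound:
  fixes p :: "complex \<Rightarrow> complex" and R h :: real
  assumes hol: "p holomorphic_on ball 0 R"
    and Im: "\<And>z. z \<in> ball 0 R \<Longrightarrow> Im z * Im (z * p z) \<ge> 0"
    and p0: "p 0 = of_real h" and z: "cmod z < R"
  shows "h \<ge> 0" "cmod ((1 - (z / of_real R)\<^sup>2) * p z - of_real h) \<le> 2 * (h + 1) * cmod z / (R - cmod z)"
proof -
  have R: "R > 0" using z norm_ge_zero[of z] by linarith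
  have Re_r: "Re ((1 - (w / of_real r)\<^sup>2) * p w) \<ge> 0" if w: "cmod w < r" "r < R" for w r
  proof -
    have r: "r > 0" using w norm_ge_zero[of w] by linarith
    have sub: "cball 0 r \<subseteq> ball (0::complex) R" using w by auto
    define q where "q = (\<lambda>w. - ((1 - (w / of_real r)\<^sup>2) * p w))"
    have hq: "q holomorphic_on cball 0 r"
      unfolding q_def using hol holomorphic_on_subset[OF hol sub] r by (auto intro!: holomorphic_intros)
    \<comment> \<open>The exponential turns a bound on a real part into a bound on a modulus.\<close>
    have "norm (exp (q w)) \<le> 1"
    proof (rule maximum_modulus_frontier[of "\<lambda>w. exp (q w)" "ball 0 r"])
      show "(\<lambda>w. exp (q w)) holomorphic_on interior (ball 0 r)"
        using holomorphic_on_subset[OF hq ball_subset_cball] by (auto intro!: holomorphic_intros)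
      show "continuous_on (closure (ball 0 r)) (\<lambda>w. exp (q w))"
        using r continuous_on_exp[OF holomorphic_on_imp_continuous_on[OF hq]] by simp
      fix u assume "u \<in> frontier (ball (0::complex) r)"
      then have u: "cmod u = r" using r by (simp add: frontier_def)
      then have u0: "u \<noteq> 0" using r by auto
      have "u * cnj u = of_real (r\<^sup>2)" using u complex_norm_square[of u] by simp
      then have "(1 - (u / of_real r)\<^sup>2) * p u = ((cnj u - u) / of_real (r\<^sup>2)) * (u * p u)"
        using r by (simp add: field_simps power2_eq_square)
      also have "cnj u - u = - 2 * of_real (Im u) * \<i>" by (simp add: complex_eq_iff)
      also have "Re (- 2 * of_real (Im u) * \<i> / of_real (r\<^sup>2) * (u * p u)) = 2 * (Im u * Im (u * p u)) / r\<^sup>2"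
      proof -
        have "- 2 * of_real (Im u) * \<i> / of_real (r\<^sup>2) * (u * p u) = of_real (- 2 * Im u / r\<^sup>2) * (\<i> * (u * p u))"
          by simp
        also have "Re \<dots> = (- 2 * Im u / r\<^sup>2) * Re (\<i> * (u * p u))" by (simp del: of_real_divide of_real_mult)
        also have "Re (\<i> * (u * p u)) = - Im (u * p u)" by (rule Re_i_times)
        finally show ?thesis by simp
      qed
      finally have "Re (q u) \<le> 0" using Im[of u] u w by (simp add: q_def)
      then show "norm (exp (q u)) \<le> 1" by simp
    qed (use w in auto)
    then show ?thesis by (simp add: q_def)
  qed
  define P where "P = (\<lambda>w. (1 - (w / of_real R)\<^sup>2) * p w)"
  have RePos: "Re (P w) \<ge> 0" if w: "cmod w < R" for w
  proof -
    have "((\<lambda>r. Re ((1 - (w / of_real r)\<^sup>2) * p w)) \<longlongrightarrow> Re (P w)) (at_left R)"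
      unfolding P_def using R by (intro tendsto_intros) auto
    moreover have "\<forall>\<^sub>F r in at_left R. 0 \<le> Re ((1 - (w / of_real r)\<^sup>2) * p w)"
      using eventually_at_left_real[OF w]
      by eventually_elim (use Re_r in auto)
    ultimately show ?thesis by (rule tendsto_lowerbound) simp
  qed
  have P0: "P 0 = of_real h" by (simp add: P_def p0)
  show h: "h \<ge> 0" using RePos[of 0] R by (simp add: P0)
  \<comment> \<open>The Cayley transform of \<open>P + 1\<close>, rescaled to the unit disc. Adding one keeps the denominator away from zero even if \<open>h = 0\<close>.\<close>
  define \<phi> where "\<phi> = (\<lambda>w. (P (of_real R * w) - of_real h) / (P (of_real R * w) + of_real (h + 2)))"
  have ne: "P w + of_real (h + 2) \<noteq> 0" if "cmod w < R" for w
    using RePos[OF that] h by (auto simp: complex_eq_iff)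
  have hP: "P holomorphic_on ball 0 R"
    unfolding P_def using R by (auto intro!: holomorphic_intros hol)
  have "(P \<circ> (\<lambda>w. of_real R * w)) holomorphic_on ball 0 1"
    by (rule holomorphic_on_compose_gen[OF _ hP])
       (use R in \<open>auto intro!: holomorphic_intros simp: norm_mult\<close>)
  then have hP': "(\<lambda>w. P (of_real R * w)) holomorphic_on ball 0 1" by (simp add: o_def)
  have h\<phi>: "\<phi> holomorphic_on ball 0 1"
    unfolding \<phi>_def using hP' ne R by (intro holomorphic_intros) (auto simp: norm_mult)
  have b\<phi>: "norm (\<phi> w) < 1" if "norm w < 1" for w
  proof -
    have wR: "cmod (of_real R * w) < R" using that R by (simp add: norm_mult)
    define a where "a = P (of_real R * w)"
    have ra: "Re a \<ge> 0" using RePos[OF wR] by (simp add: a_def)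
    have "(cmod (a - of_real h))\<^sup>2 < (cmod (a + of_real (h + 2)))\<^sup>2"
      unfolding cmod_power2 using ra h by (simp add: power2_eq_square algebra_simps)
        (smt (verit, best) mult_nonneg_nonneg)
    then have "cmod (a - of_real h) < cmod (a + of_real (h + 2))"
      using power2_less_imp_less norm_ge_zero by blast
    then show ?thesis using ne[OF wR] by (simp add: \<phi>_def norm_divide a_def)
  qed
  have "norm (\<phi> (z / of_real R)) \<le> norm (z / of_real R)"
    by (rule Schwarz_Lemma(1)[OF h\<phi> _ b\<phi>]) (use z R in \<open>auto simp: \<phi>_def P0 norm_divide\<close>)
  then have "cmod (P z - of_real h) / cmod (P z + of_real (h + 2)) \<le> cmod z / R"
    using R by (simp add: \<phi>_def norm_divide)
  then have "cmod (P z - of_real h) * R \<le> cmod z * cmod (P z + of_real (h + 2))"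
    using ne[OF z] R by (simp add: field_simps)
  also have "\<dots> \<le> cmod z * (cmod (P z - of_real h) + 2 * (h + 1))"
  proof (intro mult_left_mono)
    have "P z + of_real (h + 2) = (P z - of_real h) + of_real (2 * (h + 1))" by (simp add: algebra_simps)
    also have "cmod \<dots> \<le> cmod (P z - of_real h) + cmod (of_real (2 * (h + 1)))" by (rule norm_triangle_ineq)
    finally show "cmod (P z + of_real (h + 2)) \<le> cmod (P z - of_real h) + 2 * (h + 1)"
      using h by (simp del: of_real_mult of_real_add)
  qed simp
  finally have "cmod (P z - of_real h) * (R - cmod z) \<le> 2 * (h + 1) * cmod z" by (simp add: algebra_simps)
  then show "cmod ((1 - (z / of_real R)\<^sup>2) * p z - of_real h) \<le> 2 * (h + 1) * cmod z / (R - cmod z)"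
    using z by (simp add: P_def pos_le_divide_eq)
qed

text \<open>
  Only finitely many zeros are divided out at a time, so that no infinite product of functions is
  needed.
\<close>
lemma divide_out_zeros:
  fixes f :: "complex \<Rightarrow> complex"
  assumes hol: "f holomorphic_on UNIV" and "finite F" "0 \<notin> F" "\<And>t. t \<in> F \<Longrightarrow> f t = 0"
  shows "\<exists>G. G holomorphic_on UNIV \<and> (\<forall>z. f z = (\<Prod>t\<in>F. 1 - z / t) * G z)"
  using assms(2-)
proof (induction F rule: finite_induct)
  case empty
  then show ?case using hol by auto
next
  case (insert t F)
  then obtain G where G: "G holomorphic_on UNIV" "\<And>z. f z = (\<Prod>t\<in>F. 1 - z / t) * G z" by auto
  have "(\<Prod>s\<in>F. 1 - t / s) \<noteq> 0" using insert by (auto simp: field_simps)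
  moreover have "f t = 0" using insert by simp
  ultimately have Gt: "G t = 0" using G(2)[of t] by simp
  define K where "K = (\<lambda>z. - t * (if z = t then deriv G t else (G z - G t) / (z - t)))"
  have "K holomorphic_on UNIV" unfolding K_def
    using pole_lemma_open[OF G(1) open_UNIV, of t] by (intro holomorphic_intros) auto
  moreover have "f z = (\<Prod>t\<in>insert t F. 1 - z / t) * K z" for z
  proof -
    have "(1 - z / t) * K z = G z"
      using Gt insert.prems by (auto simp: K_def field_simps)
    then show ?thesis using insert.hyps G(2)[of z] by (simp add: mult_ac)
  qed
  ultimately show ?case by blast
qed

lemma deriv_at_divided_zero:
  fixes f G :: "complex \<Rightarrow> complex"
  assumes G: "G holomorphic_on UNIV" "\<And>z. f z = (\<Prod>t\<in>F. 1 - z / t) * G z"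
    and F: "finite F" "0 \<notin> F" "t \<in> F" and f': "(f has_field_derivative f') (at t)"
  shows "f' = - (\<Prod>s\<in>F - {t}. 1 - t / s) * G t / t"
proof -
  have t0: "t \<noteq> 0" using F by auto
  define Q where "Q = (\<lambda>z. (\<Prod>s\<in>F - {t}. 1 - z / s) * G z)"
  have "Q holomorphic_on UNIV" unfolding Q_def using F by (intro holomorphic_intros G(1)) auto
  then have "Q field_differentiable (at t)" using holomorphic_on_imp_differentiable_at by blast
  then obtain Q' where Q': "(Q has_field_derivative Q') (at t)" by (auto simp: field_differentiable_def)
  have fQ: "f = (\<lambda>z. (1 - z / t) * Q z)"
    using G(2) F by (auto simp: Q_def prod.remove[OF F(1,3)] mult_ac)
  have "(f has_field_derivative - Q t / t) (at t)"
    unfolding fQ using Q' t0 by (auto intro!: derivative_eq_intros)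
  then have "f' = - Q t / t" using f' DERIV_unique by blast
  then show ?thesis by (simp add: Q_def)
qed

definition bclif_zeros :: "real \<Rightarrow> real set" where
  "bclif_zeros \<nu> = {t. bclif \<nu> t = 0}"

lemma bclif_holomorphic: "\<nu> \<ge> 0 \<Longrightarrow> bclif \<nu> holomorphic_on S"
  using bclif_has_field_derivative[of \<nu>]
  by (meson field_differentiable_at_within field_differentiable_def holomorphic_onI)

text \<open>
  All zeros are positive, so the bound \<open>t < R\<close> confines them to a compact disc.
\<close>
lemma finite_bclif_zeros_less:
  assumes \<nu>: "\<nu> > 0"
  shows "finite {t \<in> bclif_zeros \<nu>. t < R}"
proof -
  have \<nu>0: "\<nu> \<ge> 0" using \<nu> by simp
  have "finite {z \<in> cball 0 \<bar>R\<bar>. bclif \<nu> z = (0::complex)}"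
  proof (rule holomorphic_compact_finite_zeros[of _ UNIV])
    show "\<not> bclif \<nu> constant_on (UNIV :: complex set)"
    proof
      assume "bclif \<nu> constant_on (UNIV :: complex set)"
      then obtain c where c: "\<And>z::complex. bclif \<nu> z = c" by (auto simp: constant_on_def)
      then have "bclif \<nu> = (\<lambda>z::complex. c)" by auto
      then have "(bclif \<nu> has_field_derivative 0) (at (0::complex))" by simp
      from DERIV_unique[OF this bclif_has_field_derivative[OF \<nu>0]]
      have "bclif (\<nu> + 1) (0::complex) = 0" by simp
      then show False using rGamma_Suc_bound(1)[of "\<nu> + 1" 0] \<nu> by (simp add: bclif_0)
    qed
  qed (use bclif_holomorphic[OF \<nu>0] in auto)
  moreover have "complex_of_real ` {t \<in> bclif_zeros \<nu>. t < R} \<subseteq> {z \<in> cball 0 \<bar>R\<bar>. bclif \<nu> z = 0}"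
    using bclif_zero_pos[OF \<nu>0] bclif_of_real[OF \<nu>0] by (force simp: bclif_zeros_def)
  ultimately have "finite (complex_of_real ` {t \<in> bclif_zeros \<nu>. t < R})" by (rule rev_finite_subset)
  then show ?thesis by (rule finite_imageD) (auto simp: inj_on_def)
qed

text \<open>
  The function \<open>p = - G'/G\<close> is the negative logarithmic derivative of the quotient \<open>G\<close> that remains when the
  zeros below \<open>R\<close> are divided out of \<open>E\<close>; its value at the origin is \<open>h\<close>. Bessel's inequality makes
  \<open>z p(z)\<close> typically real. Integrating the resulting bound on \<open>p - h\<close> shows that \<open>G\<close> is nearly
  \<open>E(0) exp(- h z)\<close>.
\<close>
lemma bclif_quotient:
  fixes R :: real
  assumes \<nu>: "\<nu> > 0" and R: "R > 0"
  defines "F \<equiv> {t \<in> bclif_zeros \<nu>. t < R}"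
  defines "h \<equiv> bclif (\<nu> + 1) 0 / bclif \<nu> 0 - (\<Sum>t\<in>F. 1 / t)"
  obtains G p where "G holomorphic_on UNIV"
    and "\<And>z. bclif \<nu> z = (\<Prod>t\<in>F. 1 - z / of_real t) * G z"
    and "\<And>t. t \<in> F \<Longrightarrow> of_real t * bclif (\<nu> + 1) (of_real t) = (\<Prod>s\<in>F - {t}. 1 - of_real t / of_real s) * G (of_real t)"
    and "p holomorphic_on ball 0 R" and "h \<ge> 0"
    and "\<And>z. cmod z < R \<Longrightarrow> bclif \<nu> z \<noteq> 0 \<Longrightarrow> p z = bclif (\<nu> + 1) z / bclif \<nu> z + (\<Sum>t\<in>F. 1 / (z - of_real t))"
    and "\<And>z. 2 * cmod z \<le> R \<Longrightarrow> cmod (p z - of_real h) \<le> 12 * cmod z / R"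
    and "\<And>z \<rho>. cmod z \<le> \<rho> \<Longrightarrow> 2 * \<rho> \<le> R \<Longrightarrow>
           \<exists>d. G z = of_real (bclif \<nu> 0) * exp (d - of_real h * z) \<and> cmod d \<le> 12 * \<rho>\<^sup>2 / R"
proof -
  have \<nu>0: "\<nu> \<ge> 0" using \<nu> by simp
  have finF: "finite F" unfolding F_def by (rule finite_bclif_zeros_less[OF \<nu>])
  have Fz: "bclif \<nu> t = 0" "t > 0" if "t \<in> F" for t
    using that bclif_zero_pos[OF \<nu>0] by (auto simp: F_def bclif_zeros_def)
  define CF where "CF = complex_of_real ` F"
  have CF: "finite CF" "0 \<notin> CF" using finF Fz(2)[of 0] by (auto simp: CF_def)
  have injF: "inj_on complex_of_real A" for A by (auto simp: inj_on_def)
  have Cz: "bclif \<nu> t = 0" if "t \<in> CF" for t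
    using that Fz bclif_of_real[OF \<nu>0] by (auto simp: CF_def)
  obtain G where G: "G holomorphic_on UNIV" "\<And>z. bclif \<nu> z = (\<Prod>t\<in>CF. 1 - z / t) * G z"
    using divide_out_zeros[OF bclif_holomorphic[OF \<nu>0] CF Cz] by blast
  have G2: "bclif \<nu> z = (\<Prod>t\<in>F. 1 - z / of_real t) * G z" for z
    using G(2)[of z] by (simp add: CF_def prod.reindex[OF injF])
  have G3: "of_real t * bclif (\<nu> + 1) (of_real t) = (\<Prod>s\<in>F - {t}. 1 - of_real t / of_real s) * G (of_real t)"
    if t: "t \<in> F" for t
  proof -
    have "- bclif (\<nu> + 1) (of_real t) = - (\<Prod>s\<in>CF - {of_real t}. 1 - of_real t / s) * G (of_real t) / of_real t"
      by (rule deriv_at_divided_zero[OF G CF _ bclif_has_field_derivative[OF \<nu>0]]) (use t in \<open>auto simp: CF_def\<close>)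
    also have "CF - {of_real t} = complex_of_real ` (F - {t})" by (auto simp: CF_def)
    finally show ?thesis using Fz[OF t] by (simp add: prod.reindex[OF injF] field_simps)
  qed
  have Gnz: "G z \<noteq> 0" if z: "z \<in> ball 0 R" for z
  proof
    assume Gz: "G z = 0"
    then have Ez: "bclif \<nu> z = 0" using G(2)[of z] by simp
    then have "z \<in> \<real>" using bclif_nonreal_nonzero[OF \<nu>] by blast
    then obtain t where t: "z = of_real t" by (auto elim: Reals_cases)
    have "bclif \<nu> t = 0" using Ez bclif_of_real[OF \<nu>0, of t] t by simp
    then have tF: "t \<in> F" using z t by (auto simp: F_def bclif_zeros_def)
    have "of_real t * bclif (\<nu> + 1) (of_real t) = (0::complex)" using G3[OF tF] Gz t by simp
    then show False using bclif_simple_zero[OF \<nu>, of t] Fz[OF tF] bclif_of_real[of "\<nu> + 1" t] \<nu> by auto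
  qed
  have dG: "(G has_field_derivative deriv G z) (at z)" for z
    using holomorphic_derivI[OF G(1) open_UNIV] by simp
  define p where "p = (\<lambda>z. - deriv G z / G z)"
  have hp: "p holomorphic_on ball 0 R"
    unfolding p_def using Gnz holomorphic_on_subset[OF G(1)] by (intro holomorphic_intros holomorphic_deriv) auto
  have pE: "p z = bclif (\<nu> + 1) z / bclif \<nu> z + (\<Sum>t\<in>F. 1 / (z - of_real t))" if z: "bclif \<nu> z \<noteq> 0" for z
  proof -
    define Q where "Q = (\<lambda>z. \<Prod>t\<in>CF. 1 - z / t)"
    have zt: "1 - z / t \<noteq> 0" if t: "t \<in> CF" for t
    proof
      assume "1 - z / t = 0"
      then have "z = t" using CF t by (auto simp: field_simps)
      then show False using Cz[OF t] z by simp
    qed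
    have dQ: "(Q has_field_derivative Q z * (\<Sum>t\<in>CF. (- 1 / t) / (1 - z / t))) (at z)"
      unfolding Q_def using zt CF by (intro has_field_derivative_prod') (auto intro!: derivative_eq_intros)
    have "((\<lambda>z. Q z * G z) has_field_derivative (Q z * (\<Sum>t\<in>CF. (- 1 / t) / (1 - z / t)) * G z + deriv G z * Q z)) (at z)"
      by (rule DERIV_mult[OF dQ dG])
    moreover have "bclif \<nu> = (\<lambda>z. Q z * G z)" using G(2) by (auto simp: Q_def)
    ultimately have eq: "- bclif (\<nu> + 1) z = Q z * (\<Sum>t\<in>CF. (- 1 / t) / (1 - z / t)) * G z + deriv G z * Q z"
      using bclif_has_field_derivative[OF \<nu>0, of z] DERIV_unique by metis
    have E: "bclif \<nu> z = Q z * G z" using G(2) by (auto simp: Q_def)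
    have nz: "Q z \<noteq> 0" "G z \<noteq> 0" using z E by auto
    have "(\<Sum>t\<in>CF. (- 1 / t) / (1 - z / t)) = (\<Sum>t\<in>CF. 1 / (z - t))"
    proof (intro sum.cong refl)
      fix t assume "t \<in> CF"
      then have "t \<noteq> 0" "t - z \<noteq> 0" using zt[of t] CF by auto
      then have "(- 1 / t) / (1 - z / t) = - (1 / (t - z))" by (simp add: field_simps)
      also have "\<dots> = 1 / (z - t)" by (metis minus_diff_eq minus_divide_right)
      finally show "(- 1 / t) / (1 - z / t) = 1 / (z - t)" .
    qed
    also have "\<dots> = (\<Sum>t\<in>F. 1 / (z - of_real t))" by (simp add: CF_def sum.reindex[OF injF])
    finally have "- bclif (\<nu> + 1) z = bclif \<nu> z * (\<Sum>t\<in>F. 1 / (z - of_real t)) + deriv G z / G z * bclif \<nu> z"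
      using eq E nz by (simp add: mult_ac)
    then have "bclif (\<nu> + 1) z = (p z - (\<Sum>t\<in>F. 1 / (z - of_real t))) * bclif \<nu> z"
      by (subst minus_minus[symmetric]) (simp add: p_def algebra_simps)
    then show ?thesis using z by simp
  qed
  have E0: "bclif \<nu> (0::real) > 0" using bclif_nonpos_pos[OF \<nu>0] by simp
  have c0: "bclif a (0::complex) = of_real (bclif a 0)" for a by (simp add: bclif_0)
  have p0: "p 0 = of_real h"
  proof -
    have "bclif \<nu> (0::complex) \<noteq> 0" using E0 by (simp add: c0)
    from pE[OF this] show ?thesis by (simp add: h_def c0 sum_negf)
  qed
  have Imp: "Im z * Im (z * p z) \<ge> 0" if z: "z \<in> ball 0 R" for z
  proof (cases "Im z = 0")
    case False
    have zR: "z \<notin> \<real>" using False by (simp add: complex_is_Real_iff)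
    have Ez: "bclif \<nu> z \<noteq> 0" by (rule bclif_nonreal_nonzero[OF \<nu> zR])
    define S where "S = (\<Sum>t\<in>F. t / (cmod (z - of_real t))\<^sup>2)"
    have "Im (z / (z - of_real t)) = - Im z * (t / (cmod (z - of_real t))\<^sup>2)" for t
      by (simp add: Im_divide cmod_power2 algebra_simps)
    then have "Im (\<Sum>t\<in>F. z / (z - of_real t)) = - Im z * S"
      by (simp add: S_def sum_distrib_left sum_negf)
    moreover have "z * p z = z * bclif (\<nu> + 1) z / bclif \<nu> z + (\<Sum>t\<in>F. z / (z - of_real t))"
      by (simp add: pE[OF Ez] distrib_left sum_distrib_left)
    moreover have "Im (z * bclif (\<nu> + 1) z / bclif \<nu> z) = Im (z * bclif (\<nu> + 1) z * cnj (bclif \<nu> z)) / (cmod (bclif \<nu> z))\<^sup>2"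
      by (subst complex_div_cnj) (simp add: Im_divide_of_real del: times_complex.simps of_real_power flip: of_real_power)
    ultimately have "Im z * Im (z * p z) = Im z * (Im (z * bclif (\<nu> + 1) z * cnj (bclif \<nu> z)) / (cmod (bclif \<nu> z))\<^sup>2) - (Im z)\<^sup>2 * S"
      by (simp add: algebra_simps power2_eq_square)
    also have "\<dots> = (Im z)\<^sup>2 * (Im (z * bclif (\<nu> + 1) z * cnj (bclif \<nu> z)) / (Im z * (cmod (bclif \<nu> z))\<^sup>2) - S)"
      using False by (simp add: power2_eq_square right_diff_distrib del: times_complex.simps)
    also have "\<dots> \<ge> 0"
      using bclif_bessel_inequality[OF \<nu> False finF Fz(1)] by (simp add: S_def del: times_complex.simps)
    finally show ?thesis .
  qed simp
  have h: "h \<ge> 0" by (rule typically_real_bound(1)[of p R h 0]) (use hp Imp p0 R in auto)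
  have h1: "h \<le> 1"
  proof -
    have "0 \<le> (\<Sum>t\<in>F. 1 / t)" by (intro sum_nonneg) (use Fz(2) in \<open>auto intro: less_imp_le\<close>)
    then have "h \<le> bclif (\<nu> + 1) 0 / bclif \<nu> 0" by (simp add: h_def)
    also have "bclif \<nu> (0::real) = (\<nu> + 1) * bclif (\<nu> + 1) 0" using bclif_ode[OF \<nu>0, of "0::real"] by simp
    also have "bclif (\<nu> + 1) 0 / ((\<nu> + 1) * bclif (\<nu> + 1) 0) \<le> 1"
      using \<nu> by (cases "bclif (\<nu> + 1) (0::real) = 0") auto
    finally show ?thesis .
  qed
  have pb: "cmod (p z - of_real h) \<le> 12 * cmod z / R" if z: "2 * cmod z \<le> R" for z
  proof -
    have zR: "cmod z < R" using z R norm_ge_zero[of z] by linarith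
    define D where "D = 1 - (z / of_real R)\<^sup>2"
    have q: "cmod ((z / of_real R)\<^sup>2) = (cmod z / R)\<^sup>2" using R by (simp add: norm_divide norm_power power_divide)
    have q1: "cmod z / R \<le> 1 / 2" using z R by (simp add: field_simps)
    have q0: "0 \<le> cmod z / R" using R by simp
    have q2: "(cmod z / R)\<^sup>2 \<le> (1/2) * (cmod z / R)" unfolding power2_eq_square using q1 q0 by (intro mult_right_mono)
    have "1 - cmod ((z / of_real R)\<^sup>2) \<le> cmod D" unfolding D_def using norm_triangle_ineq2[of 1 "(z / of_real R)\<^sup>2"] by simp
    then have D: "cmod D \<ge> 3 / 4" using q q2 q1 by linarith
    have "cmod (D * p z - of_real h) \<le> 2 * (h + 1) * cmod z / (R - cmod z)" unfolding D_def by (rule typically_real_bound(2)[OF hp _ p0 zR]) (rule Imp)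
    also have "\<dots> \<le> 4 * cmod z / (R / 2)"
      using h1 h z R zR by (intro frac_le mult_right_mono) auto
    finally have b1: "cmod (D * p z - of_real h) \<le> 8 * (cmod z / R)" by simp
    have b2: "cmod (of_real h * (1 - D)) \<le> 1 * (cmod z / R)"
    proof -
      have "cmod (of_real h * (1 - D)) = h * (cmod z / R)\<^sup>2" using h q by (simp add: D_def norm_mult)
      also have "\<dots> \<le> 1 * (cmod z / R)" using h h1 q2 q0 by (intro mult_mono) auto
      finally show ?thesis .
    qed
    have "D * (p z - of_real h) = (D * p z - of_real h) + of_real h * (1 - D)" by (simp add: algebra_simps)
    then have "cmod D * cmod (p z - of_real h) \<le> 9 * (cmod z / R)"
      unfolding norm_mult[symmetric] using b1 b2 norm_triangle_ineq[of "D * p z - of_real h" "of_real h * (1 - D)"] by simp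
    moreover have "3 / 4 * cmod (p z - of_real h) \<le> cmod D * cmod (p z - of_real h)" using D by (intro mult_right_mono) auto
    ultimately show ?thesis by simp
  qed
  have "contractible (ball (0::complex) R)" by (simp add: convex_imp_contractible)
  then obtain g where g: "g holomorphic_on ball 0 R" "\<And>z. z \<in> ball 0 R \<Longrightarrow> G z = exp (g z)"
    using contractible_imp_holomorphic_log[of G "ball 0 R"] holomorphic_on_subset[OF G(1)] Gnz by (metis subset_UNIV)
  have dg: "(g has_field_derivative - p z) (at z)" if z: "z \<in> ball 0 R" for z
  proof -
    have dgz: "(g has_field_derivative deriv g z) (at z)" using holomorphic_derivI[OF g(1) open_ball z] .
    have "((\<lambda>z. exp (g z)) has_field_derivative exp (g z) * deriv g z) (at z)"
      by (rule DERIV_fun_exp[OF dgz])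
    moreover have "(G has_field_derivative deriv G z) (at z)" by (rule dG)
    then have "((\<lambda>z. exp (g z)) has_field_derivative deriv G z) (at z)"
      by (rule has_field_derivative_transform_within_open[OF _ open_ball z]) (simp add: g(2))
    ultimately have "deriv G z = exp (g z) * deriv g z" using DERIV_unique by blast
    then have "deriv g z = - p z" using g(2)[OF z] by (simp add: p_def)
    with dgz show ?thesis by simp
  qed
  have Gb: "\<exists>d. G z = of_real (bclif \<nu> 0) * exp (d - of_real h * z) \<and> cmod d \<le> 12 * \<rho>\<^sup>2 / R"
    if z: "cmod z \<le> \<rho>" and \<rho>: "2 * \<rho> \<le> R" for z \<rho>
  proof -
    have \<rho>0: "\<rho> \<ge> 0" using z norm_ge_zero[of z] by linarith
    have \<rho>R: "\<rho> < R" using \<rho> R by simp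
    define l where "l = (\<lambda>w. g w + of_real h * w)"
    have "norm (l z - l 0) \<le> (12 * \<rho> / R) * norm (z - 0)"
    proof (rule field_differentiable_bound[of "cball 0 \<rho>"])
      fix w :: complex assume w: "w \<in> cball 0 \<rho>"
      then have "w \<in> ball 0 R" using \<rho>R by auto
      then show "(l has_field_derivative - p w + of_real h) (at w within cball 0 \<rho>)"
        unfolding l_def by (auto intro!: derivative_eq_intros DERIV_subset[OF dg])
      have "cmod (- p w + of_real h) = cmod (p w - of_real h)" by (metis add.commute diff_conv_add_uminus norm_minus_commute)
      also have "\<dots> \<le> 12 * cmod w / R" using w \<rho> by (intro pb) auto
      also have "\<dots> \<le> 12 * \<rho> / R" using w R by (intro divide_right_mono) auto
      finally show "cmod (- p w + of_real h) \<le> 12 * \<rho> / R" .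
    qed (use z \<rho>0 in auto)
    also have "\<dots> \<le> (12 * \<rho> / R) * \<rho>" using z \<rho>0 R by (intro mult_left_mono) auto
    finally have d: "cmod (l z - l 0) \<le> 12 * \<rho>\<^sup>2 / R" by (simp add: power2_eq_square)
    have "G 0 = of_real (bclif \<nu> 0)" using G2[of 0] by (simp add: c0)
    then have "exp (g 0) = of_real (bclif \<nu> 0)" using g(2)[of 0] R by simp
    moreover have "z \<in> ball 0 R" using z \<rho>R by auto
    then have "G z = exp (g 0 + (l z - l 0 - of_real h * z))" by (simp add: g(2) l_def)
    ultimately show ?thesis using d by (intro exI[of _ "l z - l 0"]) (simp add: exp_add)
  qed
  show thesis by (rule that[of G p, OF G(1) G2 G3 hp h pE pb Gb])
qed

section \<open>The product over the zeros\<close>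

lemma bclif_0_pos: "\<nu> \<ge> 0 \<Longrightarrow> bclif \<nu> (0::real) > 0"
  using bclif_nonpos_pos[of \<nu> 0] by simp

text \<open>
  The sum of the reciprocals of all zeros equals \<open>- E'(0)/E(0)\<close> exactly when the product formula has no
  exponential factor; the defect is what the zeros below \<open>R\<close> leave over of that number.
\<close>
definition rayleigh_defect :: "real \<Rightarrow> real \<Rightarrow> real" where
  "rayleigh_defect \<nu> R = bclif (\<nu> + 1) 0 / bclif \<nu> 0 - (\<Sum>t\<in>{t \<in> bclif_zeros \<nu>. t < R}. 1 / t)"

lemma bclif_zerosD: "\<nu> > 0 \<Longrightarrow> t \<in> bclif_zeros \<nu> \<Longrightarrow> t > 0"
  using bclif_zero_pos[of \<nu> t] by (simp add: bclif_zeros_def)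

lemma rayleigh_defect_nonneg:
  assumes "\<nu> > 0" "R > 0" shows "rayleigh_defect \<nu> R \<ge> 0"
  by (rule bclif_quotient[OF assms]) (auto simp: rayleigh_defect_def)

lemma rayleigh_defect_antimono:
  assumes \<nu>: "\<nu> > 0" and "R \<le> S" shows "rayleigh_defect \<nu> S \<le> rayleigh_defect \<nu> R"
proof -
  have "(\<Sum>t\<in>{t \<in> bclif_zeros \<nu>. t < R}. 1 / t) \<le> (\<Sum>t\<in>{t \<in> bclif_zeros \<nu>. t < S}. 1 / t)"
    using assms bclif_zerosD[OF \<nu>] by (intro sum_mono2 finite_bclif_zeros_less) (auto intro: less_imp_le)
  then show ?thesis by (simp add: rayleigh_defect_def)
qed

text \<open>
  If the defect stayed above \<open>e\<close>, then \<open>E(- x)\<close> would grow at least like \<open>exp(e x)\<close>, because the factors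
  \<open>1 + x/t\<close> exceed one. The coefficients of \<open>E\<close> allow only \<open>exp(e x / 2)\<close>.
\<close>
lemma rayleigh_defect_tendsto_0:
  assumes \<nu>: "\<nu> > 0"
  shows "(rayleigh_defect \<nu> \<longlongrightarrow> 0) at_top"
proof (rule order_tendstoI)
  fix a :: real assume "a < 0"
  show "\<forall>\<^sub>F R in at_top. a < rayleigh_defect \<nu> R"
    using eventually_gt_at_top[of 0]
  proof eventually_elim
    case (elim R)
    then show ?case using rayleigh_defect_nonneg[OF \<nu> elim] \<open>a < 0\<close> by simp
  qed
next
  fix e :: real assume e: "0 < e"
  have \<nu>0: "\<nu> \<ge> 0" using \<nu> by simp
  have "\<exists>R>0. rayleigh_defect \<nu> R < e"
  proof (rule ccontr)
    assume "\<not> (\<exists>R>0. rayleigh_defect \<nu> R < e)"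
    then have ge: "rayleigh_defect \<nu> R \<ge> e" if "R > 0" for R using that by (meson not_less)
    \<comment> \<open>Chosen so that \<open>e x / 2 = 2 / e + 2\<close> exceeds the slack in the exponents; \<open>R\<close> then makes the error of the quotient at most one.\<close>
    define x where "x = (2 / e) * (2 / e + 2)"
    have x: "x > 0" using e by (simp add: x_def add_pos_pos)
    define R where "R = 12 * x\<^sup>2 + 2 * x"
    have R: "R > 0" "2 * x \<le> R" "12 * x\<^sup>2 / R \<le> 1" using x by (auto simp: R_def add_pos_pos)
    define F where "F = {t \<in> bclif_zeros \<nu>. t < R}"
    obtain G where G: "\<And>z. bclif \<nu> z = (\<Prod>t\<in>F. 1 - z / of_real t) * G z"
      and Gb: "\<And>z \<rho>. cmod z \<le> \<rho> \<Longrightarrow> 2 * \<rho> \<le> R \<Longrightarrow>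
           \<exists>d. G z = of_real (bclif \<nu> 0) * exp (d - of_real (rayleigh_defect \<nu> R) * z) \<and> cmod d \<le> 12 * \<rho>\<^sup>2 / R"
      by (rule bclif_quotient[OF \<nu> R(1)]) (auto simp: F_def rayleigh_defect_def)
    obtain d where d: "G (of_real (- x)) = of_real (bclif \<nu> 0) * exp (d - of_real (rayleigh_defect \<nu> R) * of_real (- x))"
      "cmod d \<le> 12 * x\<^sup>2 / R"
      using Gb[of "of_real (-x)" x] R x by auto
    have "cmod (bclif \<nu> (of_real (-x))) = bclif \<nu> (- x)"
      using bclif_of_real[OF \<nu>0, of "-x"] bclif_nonpos_pos[OF \<nu>0, of "-x"] x by simp
    moreover have "cmod (\<Prod>t\<in>F. 1 - of_real (- x) / of_real t) \<ge> 1"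
      unfolding prod_norm[symmetric]
    proof (rule prod_ge_1)
      fix t assume "t \<in> F"
      then have "t > 0" using bclif_zerosD[OF \<nu>] by (simp add: F_def)
      moreover have "cmod (1 - of_real (- x) / of_real t) = \<bar>1 + x / t\<bar>"
        by (metis (no_types, opaque_lifting) diff_minus_eq_add minus_divide_left norm_of_real of_real_1 of_real_add of_real_diff of_real_divide of_real_minus)
      ultimately show "1 \<le> cmod (1 - of_real (- x) / of_real t)" using x by simp
    qed
    moreover have "cmod (G (of_real (-x))) = bclif \<nu> 0 * exp (Re d + rayleigh_defect \<nu> R * x)"
      unfolding d(1) norm_mult norm_exp_eq_Re using bclif_0_pos[OF \<nu>0] by simp
    ultimately have "bclif \<nu> (- x) \<ge> bclif \<nu> 0 * exp (Re d + rayleigh_defect \<nu> R * x)"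
      using G[of "of_real (-x)"] mult_right_mono[OF _ norm_ge_zero, of 1 "cmod (\<Prod>t\<in>F. 1 - of_real (- x) / of_real t)" "G (of_real (-x))"]
      by (metis mult_1 norm_mult)
    moreover have "bclif \<nu> (- x) \<le> bclif \<nu> 0 * exp (1 / (e / 2)) * exp (e / 2 * x)"
      using bclif_uminus_le[OF \<nu>0, of x "e / 2"] x e by (simp add: bclif_0)
    ultimately have "bclif \<nu> 0 * exp (Re d + rayleigh_defect \<nu> R * x) \<le> bclif \<nu> 0 * exp (2 / e + e / 2 * x)"
      by (simp add: exp_add)
    then have f1: "Re d + rayleigh_defect \<nu> R * x \<le> 2 / e + e / 2 * x" using bclif_0_pos[OF \<nu>0] by simp
    have f2: "Re d \<ge> - 1" using d(2) R(3) abs_Re_le_cmod[of d] by linarith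
    have f3: "rayleigh_defect \<nu> R * x \<ge> e * x" using ge[OF R(1)] x by (intro mult_right_mono) auto
    have f4: "e * x = 2 * (2 / e + 2)" "e / 2 * x = 2 / e + 2" using e by (auto simp: x_def field_simps)
    have lin: False if "r + c \<le> u + b" "r \<ge> - 1" "c \<ge> a" "a = 2 * (u + 2)" "b = u + 2" for a b c r u :: real
      using that by argo
    show False by (rule lin[OF f1 f2 f3 f4])
  qed
  then obtain R where R: "rayleigh_defect \<nu> R < e" by blast
  show "\<forall>\<^sub>F R in at_top. rayleigh_defect \<nu> R < e"
    using eventually_ge_at_top[of R]
    by eventually_elim (use R rayleigh_defect_antimono[OF \<nu>] in \<open>meson le_less_trans\<close>)
qed

text \<open>
  One family of quotients, indexed by the radius. Its members tend to the constant \<open>E(0)\<close>, and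
  their logarithmic derivatives to zero.
\<close>
lemma bclif_quotients:
  assumes \<nu>: "\<nu> > 0"
  defines "F \<equiv> \<lambda>R. {t \<in> bclif_zeros \<nu>. t < R}"
  obtains G p :: "real \<Rightarrow> complex \<Rightarrow> complex" where
    "\<And>R z. R > 0 \<Longrightarrow> bclif \<nu> z = (\<Prod>t\<in>F R. 1 - z / of_real t) * G R z"
    "\<And>R t. R > 0 \<Longrightarrow> t \<in> F R \<Longrightarrow>
       of_real t * bclif (\<nu> + 1) (of_real t) = (\<Prod>s\<in>F R - {t}. 1 - of_real t / of_real s) * G R (of_real t)"
    "\<And>R. R > 0 \<Longrightarrow> p R holomorphic_on ball 0 R"
    "\<And>R z. R > 0 \<Longrightarrow> cmod z < R \<Longrightarrow> bclif \<nu> z \<noteq> 0 \<Longrightarrow>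
       p R z = bclif (\<nu> + 1) z / bclif \<nu> z + (\<Sum>t\<in>F R. 1 / (z - of_real t))"
    "\<And>R z. R > 0 \<Longrightarrow> 2 * cmod z \<le> R \<Longrightarrow> cmod (p R z) \<le> rayleigh_defect \<nu> R + 12 * cmod z / R"
    "\<And>z. ((\<lambda>R. G R z) \<longlongrightarrow> of_real (bclif \<nu> 0)) at_top"
proof -
  define Q where "Q = (\<lambda>R G p. (\<forall>z. bclif \<nu> z = (\<Prod>t\<in>F R. 1 - z / of_real t) * G z) \<and>
    (\<forall>t\<in>F R. of_real t * bclif (\<nu> + 1) (of_real t) = (\<Prod>s\<in>F R - {t}. 1 - of_real t / of_real s) * G (of_real t)) \<and>
    p holomorphic_on ball 0 R \<and>
    (\<forall>z. cmod z < R \<longrightarrow> bclif \<nu> z \<noteq> 0 \<longrightarrow> p z = bclif (\<nu> + 1) z / bclif \<nu> z + (\<Sum>t\<in>F R. 1 / (z - of_real t))) \<and>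
    (\<forall>z. 2 * cmod z \<le> R \<longrightarrow> cmod (p z - of_real (rayleigh_defect \<nu> R)) \<le> 12 * cmod z / R) \<and>
    (\<forall>z \<rho>. cmod z \<le> \<rho> \<longrightarrow> 2 * \<rho> \<le> R \<longrightarrow>
           (\<exists>d. G z = of_real (bclif \<nu> 0) * exp (d - of_real (rayleigh_defect \<nu> R) * z) \<and> cmod d \<le> 12 * \<rho>\<^sup>2 / R)))"
  have ex: "\<exists>G p. Q R G p" if "R > 0" for R
    unfolding Q_def F_def rayleigh_defect_def
    apply (rule bclif_quotient[OF \<nu> that])
    subgoal premises prems for G p
      by (intro exI[of _ G] exI[of _ p] conjI allI ballI impI; rule prems; assumption)
    done
  obtain G p where "\<And>R. R > 0 \<Longrightarrow> Q R (G R) (p R)" using ex by metis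
  note P = this[unfolded Q_def]
  have lim: "((\<lambda>R. G R z) \<longlongrightarrow> of_real (bclif \<nu> 0)) at_top" for z
  proof -
    define R0 where "R0 = 2 * cmod z + 1"
    have R0: "R > 0 \<and> 2 * cmod z \<le> R" if "R \<ge> R0" for R
      using that norm_ge_zero[of z] unfolding R0_def by linarith
    have "\<forall>R\<ge>R0. \<exists>d. G R z = of_real (bclif \<nu> 0) * exp (d - of_real (rayleigh_defect \<nu> R) * z) \<and> cmod d \<le> 12 * (cmod z)\<^sup>2 / R"
    proof (intro allI impI)
      fix R assume "R \<ge> R0"
      from R0[OF this] have "R > 0" "2 * cmod z \<le> R" by auto
      with conjunct2[OF conjunct2[OF conjunct2[OF conjunct2[OF conjunct2[OF P[OF this(1)]]]]]]
      show "\<exists>d. G R z = of_real (bclif \<nu> 0) * exp (d - of_real (rayleigh_defect \<nu> R) * z) \<and> cmod d \<le> 12 * (cmod z)\<^sup>2 / R"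
        by (metis order_refl)
    qed
    then obtain d where d: "\<And>R. R \<ge> R0 \<Longrightarrow> G R z = of_real (bclif \<nu> 0) * exp (d R - of_real (rayleigh_defect \<nu> R) * z)"
       "\<And>R. R \<ge> R0 \<Longrightarrow> cmod (d R) \<le> 12 * (cmod z)\<^sup>2 / R" by metis
    have "(d \<longlongrightarrow> 0) at_top"
    proof (rule Lim_null_comparison)
      show "\<forall>\<^sub>F R in at_top. cmod (d R) \<le> 12 * (cmod z)\<^sup>2 / R"
        using eventually_ge_at_top[of R0] by eventually_elim (rule d(2))
      show "((\<lambda>R. 12 * (cmod z)\<^sup>2 / R) \<longlongrightarrow> 0) at_top"
        by (rule real_tendsto_divide_at_top[OF tendsto_const filterlim_ident])
    qed
    then have "((\<lambda>R. of_real (bclif \<nu> 0) * exp (d R - of_real (rayleigh_defect \<nu> R) * z)) \<longlongrightarrow>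
         of_real (bclif \<nu> 0) * exp (0 - of_real 0 * z)) at_top"
      by (intro tendsto_intros rayleigh_defect_tendsto_0[OF \<nu>])
    then have "((\<lambda>R. of_real (bclif \<nu> 0) * exp (d R - of_real (rayleigh_defect \<nu> R) * z)) \<longlongrightarrow> of_real (bclif \<nu> 0)) at_top" by simp
    then show ?thesis
    proof (rule Lim_transform_eventually)
      show "\<forall>\<^sub>F R in at_top. of_real (bclif \<nu> 0) * exp (d R - of_real (rayleigh_defect \<nu> R) * z) = G R z"
        using eventually_ge_at_top[of R0] by eventually_elim (simp add: d(1))
    qed
  qed
  have pb: "cmod (p R z) \<le> rayleigh_defect \<nu> R + 12 * cmod z / R" if "R > 0" "2 * cmod z \<le> R" for R z
  proof -
    have "cmod (p R z - of_real (rayleigh_defect \<nu> R)) \<le> 12 * cmod z / R"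
      using conjunct1[OF conjunct2[OF conjunct2[OF conjunct2[OF conjunct2[OF P[OF that(1)]]]]]] that(2) by simp
    moreover have "cmod (p R z) \<le> cmod (p R z - of_real (rayleigh_defect \<nu> R)) + cmod (of_real (rayleigh_defect \<nu> R))"
      using norm_triangle_ineq[of "p R z - of_real (rayleigh_defect \<nu> R)" "of_real (rayleigh_defect \<nu> R)"] by simp
    ultimately show ?thesis using rayleigh_defect_nonneg[OF \<nu> that(1)] by simp
  qed
  show thesis
  proof (rule that[of G p])
    fix R :: real and z assume "R > 0"
    from conjunct1[OF P[OF this]] show "bclif \<nu> z = (\<Prod>t\<in>F R. 1 - z / of_real t) * G R z" by (rule spec)
  next
    fix R t :: real assume "R > 0" "t \<in> F R"
    from bspec[OF conjunct1[OF conjunct2[OF P[OF this(1)]]] this(2)]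
    show "of_real t * bclif (\<nu> + 1) (of_real t) = (\<Prod>s\<in>F R - {t}. 1 - of_real t / of_real s) * G R (of_real t)" .
  next
    fix R :: real assume "R > 0"
    from conjunct1[OF conjunct2[OF conjunct2[OF P[OF this]]]] show "p R holomorphic_on ball 0 R" .
  next
    fix R :: real and z assume R: "R > 0" "cmod z < R" "bclif \<nu> z \<noteq> 0"
    from conjunct1[OF conjunct2[OF conjunct2[OF conjunct2[OF P[OF R(1)]]]]] R
    show "p R z = bclif (\<nu> + 1) z / bclif \<nu> z + (\<Sum>t\<in>F R. 1 / (z - of_real t))" by metis
  qed (rule pb lim; assumption?)+
qed

theorem bclif_hadamard:
  fixes z :: complex
  assumes \<nu>: "\<nu> > 0"
  shows "((\<lambda>R. \<Prod>t\<in>{t \<in> bclif_zeros \<nu>. t < R}. 1 - z / of_real t) \<longlongrightarrow> bclif \<nu> z / of_real (bclif \<nu> 0)) at_top"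
proof -
  obtain G where G: "\<And>R. R > 0 \<Longrightarrow> bclif \<nu> z = (\<Prod>t\<in>{t \<in> bclif_zeros \<nu>. t < R}. 1 - z / of_real t) * G R z"
    and lim: "((\<lambda>R. G R z) \<longlongrightarrow> of_real (bclif \<nu> 0)) at_top"
    by (rule bclif_quotients[OF \<nu>]) blast
  have nz: "complex_of_real (bclif \<nu> 0) \<noteq> 0" using bclif_0_pos[of \<nu>] \<nu> by simp
  have "((\<lambda>R. bclif \<nu> z / G R z) \<longlongrightarrow> bclif \<nu> z / of_real (bclif \<nu> 0)) at_top"
    by (intro tendsto_intros lim nz)
  then show ?thesis
  proof (rule Lim_transform_eventually)
    show "\<forall>\<^sub>F R in at_top. bclif \<nu> z / G R z = (\<Prod>t\<in>{t \<in> bclif_zeros \<nu>. t < R}. 1 - z / of_real t)"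
      using eventually_gt_at_top[of 0] tendsto_imp_eventually_ne[OF lim nz]
      by eventually_elim (use G in \<open>simp add: field_simps\<close>)
  qed
qed

text \<open>
  The quotient tends to \<open>E(0)\<close> also at the zeros, where it carries the value of the derivative.
\<close>
theorem bclif_hadamard_deriv:
  fixes t :: real
  assumes \<nu>: "\<nu> > 0" and t: "t \<in> bclif_zeros \<nu>"
  shows "((\<lambda>R. \<Prod>s\<in>{s \<in> bclif_zeros \<nu>. s < R} - {t}. 1 - t / s) \<longlongrightarrow> t * bclif (\<nu> + 1) t / bclif \<nu> 0) at_top"
proof -
  let ?P = "\<lambda>R. \<Prod>s\<in>{s \<in> bclif_zeros \<nu>. s < R} - {t}. 1 - t / s"
  obtain G :: "real \<Rightarrow> complex \<Rightarrow> complex" where G: "\<And>R. R > 0 \<Longrightarrow> t \<in> {t \<in> bclif_zeros \<nu>. t < R} \<Longrightarrow> of_real t * bclif (\<nu> + 1) (of_real t) =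
      (\<Prod>s\<in>{t \<in> bclif_zeros \<nu>. t < R} - {t}. 1 - of_real t / of_real s) * G R (of_real t)"
    and lim: "((\<lambda>R. G R (of_real t)) \<longlongrightarrow> complex_of_real (bclif \<nu> 0)) at_top"
    by (rule bclif_quotients[OF \<nu>]) blast
  have nz: "complex_of_real (bclif \<nu> 0) \<noteq> 0" using bclif_0_pos[of \<nu>] \<nu> by simp
  have "((\<lambda>R. of_real t * bclif (\<nu> + 1) (of_real t) / G R (of_real t)) \<longlongrightarrow> of_real t * bclif (\<nu> + 1) (of_real t) / complex_of_real (bclif \<nu> 0)) at_top"
    by (intro tendsto_intros lim nz)
  then have "((\<lambda>R. complex_of_real (?P R)) \<longlongrightarrow> of_real t * bclif (\<nu> + 1) (of_real t) / complex_of_real (bclif \<nu> 0)) at_top"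
  proof (rule Lim_transform_eventually)
    show "\<forall>\<^sub>F R in at_top. of_real t * bclif (\<nu> + 1) (of_real t) / G R (of_real t) = complex_of_real (?P R)"
      using eventually_gt_at_top[of 0] tendsto_imp_eventually_ne[OF lim nz] eventually_gt_at_top[of t]
    proof eventually_elim
      case (elim R)
      then show ?case using G[of R] t by (simp add: of_real_prod)
    qed
  qed
  also have "of_real t * bclif (\<nu> + 1) (of_real t) / complex_of_real (bclif \<nu> 0) = of_real (t * bclif (\<nu> + 1) t / bclif \<nu> 0)"
    using bclif_of_real[of "\<nu> + 1" t] \<nu> by simp
  finally show ?thesis by (simp only: tendsto_of_real_iff)
qed

text \<open>
  Parseval's identity for \<open>E(s x)\<close>. The function \<open>z p(z)\<close>, for the negative logarithmic derivative \<open>p\<close> of the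
  quotient, tends to zero uniformly near \<open>s\<close>. By Cauchy's estimate so does its derivative, which is the
  normalised kernel minus the sum over the zeros below \<open>R\<close>.
\<close>
theorem bclif_kernel_diag_sum:
  fixes s :: real
  assumes \<nu>: "\<nu> > 0" and s: "bclif \<nu> s \<noteq> 0"
  shows "((\<lambda>R. \<Sum>t\<in>{t \<in> bclif_zeros \<nu>. t < R}. t / (s - t)\<^sup>2) \<longlongrightarrow> bclif_kernel \<nu> s s / (bclif \<nu> s)\<^sup>2) at_top"
proof -
  have \<nu>0: "\<nu> \<ge> 0" using \<nu> by simp
  define F where "F = (\<lambda>R. {t \<in> bclif_zeros \<nu>. t < R})"
  obtain p where hol: "\<And>R. R > 0 \<Longrightarrow> p R holomorphic_on ball 0 R"
    and pE: "\<And>R z. R > 0 \<Longrightarrow> cmod z < R \<Longrightarrow> bclif \<nu> z \<noteq> 0 \<Longrightarrow>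
       p R z = bclif (\<nu> + 1) z / bclif \<nu> z + (\<Sum>t\<in>F R. 1 / (z - of_real t))"
    and pb: "\<And>R z. R > 0 \<Longrightarrow> 2 * cmod z \<le> R \<Longrightarrow> cmod (p R z) \<le> rayleigh_defect \<nu> R + 12 * cmod z / R"
    unfolding F_def by (rule bclif_quotients[OF \<nu>]) blast
  define \<rho> where "\<rho> = \<bar>s\<bar> + 1"
  define S where "S = (\<lambda>R. \<Sum>t\<in>F R. t / (s - t)\<^sup>2)"
  define L where "L = bclif_kernel \<nu> s s / (bclif \<nu> s)\<^sup>2"
  have Ez: "bclif \<nu> (of_real s) = complex_of_real (bclif \<nu> s)" "bclif \<nu> (of_real s) \<noteq> (0::complex)"
    using s bclif_of_real[OF \<nu>0, of s] by auto
  have F: "bclif \<nu> t = 0" "s - t \<noteq> 0" if "t \<in> F R" for t R using that s by (auto simp: F_def bclif_zeros_def)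
  have main: "\<bar>L - S R\<bar> \<le> \<rho> * (rayleigh_defect \<nu> R + 12 * \<rho> / R)" if R: "R \<ge> 2 * \<rho>" for R
  proof -
    have R0: "R > 0" "\<rho> < R" "\<rho> > 0" using R by (auto simp: \<rho>_def)
    define H where "H = (\<lambda>z. z * p R z)"
    have sub: "cball (of_real s) 1 \<subseteq> ball (0::complex) R"
    proof
      fix z :: complex assume "z \<in> cball (of_real s) 1"
      then have "cmod z \<le> \<rho>" using norm_triangle_ineq2[of z "of_real s"] by (simp add: \<rho>_def dist_norm norm_minus_commute)
      then show "z \<in> ball 0 R" using R0 by simp
    qed
    have hH: "H holomorphic_on cball (of_real s) 1"
      unfolding H_def using holomorphic_on_subset[OF hol[OF R0(1)] sub] by (intro holomorphic_intros)
    have "norm ((deriv ^^ 1) H (of_real s)) \<le> fact 1 * (\<rho> * (rayleigh_defect \<nu> R + 12 * \<rho> / R)) / 1 ^ 1"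
    proof (rule Cauchy_inequality)
      show "H holomorphic_on ball (of_real s) 1" using holomorphic_on_subset[OF hH] by auto
      show "continuous_on (cball (of_real s) 1) H" using hH by (rule holomorphic_on_imp_continuous_on)
      fix z :: complex assume "norm (of_real s - z) = 1"
      then have z: "cmod z \<le> \<rho>" using norm_triangle_ineq2[of z "of_real s"] by (simp add: \<rho>_def norm_minus_commute)
      have "cmod (p R z) \<le> rayleigh_defect \<nu> R + 12 * cmod z / R" using z R R0 by (intro pb) auto
      also have "\<dots> \<le> rayleigh_defect \<nu> R + 12 * \<rho> / R" using z R0 by (simp add: divide_right_mono)
      finally show "norm (H z) \<le> \<rho> * (rayleigh_defect \<nu> R + 12 * \<rho> / R)"
        unfolding H_def norm_mult using z R0 by (intro mult_mono) auto
    qed simp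
    then have bd: "norm (deriv H (of_real s)) \<le> \<rho> * (rayleigh_defect \<nu> R + 12 * \<rho> / R)" by simp
    define U where "U = ball (0::complex) R \<inter> {z. bclif \<nu> z \<noteq> 0}"
    have "continuous_on UNIV (bclif \<nu> :: complex \<Rightarrow> complex)"
      using continuous_on_id \<nu>0 by (intro continuous_intros)
    then have "open {z::complex. bclif \<nu> z \<noteq> 0}" by (intro open_Collect_neq continuous_on_const)
    then have U: "open U" by (simp add: U_def open_Int)
    have sU: "of_real s \<in> U" using Ez R0 by (simp add: U_def \<rho>_def)
    define z where "z = complex_of_real s"
    have zt: "z - of_real t \<noteq> 0" if "t \<in> F R" for t using F(2)[OF that] by (simp add: z_def flip: of_real_diff)
    have Ezz: "bclif \<nu> z \<noteq> 0" using Ez by (simp add: z_def)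
    have "((\<lambda>z. z * bclif (\<nu> + 1) z / bclif \<nu> z + (\<Sum>t\<in>F R. z / (z - of_real t))) has_field_derivative
        (((bclif (\<nu> + 1) z + - bclif (\<nu> + 1 + 1) z * z) * bclif \<nu> z - z * bclif (\<nu> + 1) z * - bclif (\<nu> + 1) z) / (bclif \<nu> z * bclif \<nu> z)
        + (\<Sum>t\<in>F R. - of_real t / (z - of_real t)\<^sup>2))) (at z)"
    proof (intro DERIV_add DERIV_sum DERIV_divide Ezz)
      show "((\<lambda>z. z * bclif (\<nu> + 1) z) has_field_derivative bclif (\<nu> + 1) z + - bclif (\<nu> + 1 + 1) z * z) (at z)"
        using \<nu> by (auto intro!: derivative_eq_intros)
      show "(bclif \<nu> has_field_derivative - bclif (\<nu> + 1) z) (at z)" by (rule bclif_has_field_derivative[OF \<nu>0])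
      fix t assume "t \<in> F R"
      from zt[OF this] show "((\<lambda>z. z / (z - of_real t)) has_field_derivative - of_real t / (z - of_real t)\<^sup>2) (at z)"
        by (auto intro!: derivative_eq_intros simp: power2_eq_square)
    qed
    then have "(H has_field_derivative
        (((bclif (\<nu> + 1) z + - bclif (\<nu> + 1 + 1) z * z) * bclif \<nu> z - z * bclif (\<nu> + 1) z * - bclif (\<nu> + 1) z) / (bclif \<nu> z * bclif \<nu> z)
        + (\<Sum>t\<in>F R. - of_real t / (z - of_real t)\<^sup>2))) (at z)"
      by (rule has_field_derivative_transform_within_open[OF _ U])
         (use sU R0 pE[of R] in \<open>auto simp: z_def U_def H_def distrib_left sum_distrib_left\<close>)
    then have "deriv H z = ((bclif (\<nu> + 1) z + - bclif (\<nu> + 1 + 1) z * z) * bclif \<nu> z - z * bclif (\<nu> + 1) z * - bclif (\<nu> + 1) z) / (bclif \<nu> z * bclif \<nu> z)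
        + (\<Sum>t\<in>F R. - of_real t / (z - of_real t)\<^sup>2)"
      by (rule DERIV_imp_deriv)
    also have "(\<Sum>t\<in>F R. - of_real t / (z - of_real t)\<^sup>2) = - of_real (S R)"
      by (simp add: S_def z_def sum_negf)
    also have "((bclif (\<nu> + 1) z + - bclif (\<nu> + 1 + 1) z * z) * bclif \<nu> z - z * bclif (\<nu> + 1) z * - bclif (\<nu> + 1) z) / (bclif \<nu> z * bclif \<nu> z) = of_real L"
    proof -
      define e0 e1 e2 where "e0 = bclif \<nu> z" and "e1 = bclif (\<nu> + 1) z" and "e2 = bclif (\<nu> + 1 + 1) z"
      have ode: "z * e2 = of_real (\<nu> + 1) * e1 - e0"
        using bclif_ode[OF \<nu>0, of z] by (simp add: e0_def e1_def e2_def algebra_simps)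
      have "(e1 + - e2 * z) * e0 - z * e1 * - e1 = (e1 - z * e2) * e0 + z * e1 * e1" by (simp add: algebra_simps)
      also have "\<dots> = z * e1\<^sup>2 + e0\<^sup>2 - of_real \<nu> * e0 * e1" unfolding ode by (simp add: algebra_simps power2_eq_square)
      also have "\<dots> = bclif_kernel \<nu> z z" by (simp add: bclif_kernel_def e0_def e1_def)
      also have "\<dots> = of_real (bclif_kernel \<nu> s s)" unfolding z_def by (rule bclif_kernel_of_real[OF \<nu>0])
      finally show ?thesis
        unfolding e0_def e1_def e2_def by (simp add: L_def z_def Ez(1) power2_eq_square)
    qed
    finally have "deriv H z = of_real (L - S R)" by simp
    then show ?thesis using bd by (simp add: z_def del: of_real_diff)
  qed
  have "((\<lambda>R. L - S R) \<longlongrightarrow> 0) at_top"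
  proof (rule Lim_null_comparison)
    show "\<forall>\<^sub>F R in at_top. norm (L - S R) \<le> \<rho> * (rayleigh_defect \<nu> R + 12 * \<rho> / R)"
      using eventually_ge_at_top[of "2 * \<rho>"] by eventually_elim (use main in simp)
    have "((\<lambda>R. 12 * \<rho> / R) \<longlongrightarrow> 0) at_top"
      by (rule real_tendsto_divide_at_top[OF tendsto_const filterlim_ident])
    then have "((\<lambda>R. \<rho> * (rayleigh_defect \<nu> R + 12 * \<rho> / R)) \<longlongrightarrow> \<rho> * (0 + 0)) at_top"
      by (intro tendsto_intros rayleigh_defect_tendsto_0[OF \<nu>])
    then show "((\<lambda>R. \<rho> * (rayleigh_defect \<nu> R + 12 * \<rho> / R)) \<longlongrightarrow> 0) at_top" by simp
  qed
  from tendsto_diff[OF tendsto_const[of L] this] show ?thesis by (simp add: S_def L_def F_def)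
qed

text \<open>
  With finitely many zeros the product formula bounds \<open>E(- x)\<close> by a polynomial of that degree, while the next
  Taylor term alone grows faster.
\<close>
lemma infinite_bclif_zeros:
  assumes \<nu>: "\<nu> > 0"
  shows "infinite (bclif_zeros \<nu>)"
proof
  assume fin: "finite (bclif_zeros \<nu>)"
  have \<nu>0: "\<nu> \<ge> 0" using \<nu> by simp
  define Z where "Z = bclif_zeros \<nu>"
  define n where "n = card Z"
  define C where "C = (\<Prod>t\<in>Z. 1 + 1 / t)"
  define c where "c = \<bar>bclif_coeff \<nu> (Suc n)\<bar>"
  have Zpos: "t > 0" if "t \<in> Z" for t using bclif_zerosD[OF \<nu>] that by (simp add: Z_def)
  define T where "T = Max (insert 0 Z) + 1"
  have T: "t < T" if "t \<in> Z" for t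
  proof -
    have "t \<le> Max (insert 0 Z)" using fin that by (intro Max_ge) (auto simp: Z_def)
    then show ?thesis by (simp add: T_def)
  qed
  have cpos: "c > 0" using rGamma_Suc_bound(1)[OF \<nu>0, of "Suc n"] by (simp add: c_def bclif_coeff_def)
  have le: "c * x \<le> bclif \<nu> 0 * C" if x: "x \<ge> 1" for x :: real
  proof -
    have "((\<lambda>R. \<Prod>t\<in>{t \<in> bclif_zeros \<nu>. t < R}. 1 - of_real (-x) / of_real t) \<longlongrightarrow> bclif \<nu> (of_real (-x)) / complex_of_real (bclif \<nu> 0)) at_top"
      by (rule bclif_hadamard[OF \<nu>])
    moreover have "((\<lambda>R. \<Prod>t\<in>{t \<in> bclif_zeros \<nu>. t < R}. 1 - of_real (-x) / of_real t) \<longlongrightarrow> (\<Prod>t\<in>Z. 1 - of_real (-x) / complex_of_real t)) at_top"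
    proof (rule tendsto_eventually)
      show "\<forall>\<^sub>F R in at_top. (\<Prod>t\<in>{t \<in> bclif_zeros \<nu>. t < R}. 1 - of_real (-x) / of_real t) = (\<Prod>t\<in>Z. 1 - of_real (-x) / complex_of_real t)"
        using eventually_ge_at_top[of T]
      proof eventually_elim
        case (elim R)
        have "{t \<in> bclif_zeros \<nu>. t < R} = Z" using T elim by (force simp: Z_def)
        then show ?case by simp
      qed
    qed
    ultimately have "bclif \<nu> (of_real (-x)) / complex_of_real (bclif \<nu> 0) = (\<Prod>t\<in>Z. 1 - of_real (-x) / complex_of_real t)"
      using tendsto_unique[OF trivial_limit_at_top_linorder] by blast
    then have "complex_of_real (bclif \<nu> (-x) / bclif \<nu> 0) = of_real (\<Prod>t\<in>Z. 1 + x / t)"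
      using bclif_of_real[OF \<nu>0, of "-x"] by (simp add: of_real_prod)
    then have "bclif \<nu> (-x) = bclif \<nu> 0 * (\<Prod>t\<in>Z. 1 + x / t)"
      unfolding of_real_eq_iff using bclif_0_pos[OF \<nu>0] by (simp add: field_simps)
    also have "\<dots> \<le> bclif \<nu> 0 * (\<Prod>t\<in>Z. (1 + 1 / t) * x)"
    proof (intro mult_left_mono prod_mono conjI)
      fix t assume "t \<in> Z"
      from Zpos[OF this] show "0 \<le> 1 + x / t" "1 + x / t \<le> (1 + 1 / t) * x" using x by (auto simp: field_simps)
    qed (use bclif_0_pos[OF \<nu>0] in simp)
    also have "\<dots> = bclif \<nu> 0 * C * x ^ n" by (simp add: prod.distrib C_def n_def mult_ac)
    finally have up: "bclif \<nu> (-x) \<le> bclif \<nu> 0 * C * x ^ n" .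
    have nn: "0 \<le> bclif_coeff \<nu> m * (- x) ^ m" for m by (rule bclif_term_nonneg[OF \<nu>0]) (use x in simp)
    have "bclif_coeff \<nu> (Suc n) * (- x) ^ Suc n \<le> bclif \<nu> (-x)"
      unfolding bclif_def
      using sum_le_suminf[of "\<lambda>m. bclif_coeff \<nu> m * (- x) ^ m" "{Suc n}"] nn summable_bclif[OF \<nu>0, of "- x"] by auto
    moreover have "bclif_coeff \<nu> (Suc n) * (- x) ^ Suc n = c * x ^ Suc n"
      using nn[of "Suc n"] x unfolding c_def by (metis abs_mult abs_of_nonneg abs_minus_cancel power_abs order.trans zero_le_one)
    ultimately have "(c * x) * x ^ n \<le> (bclif \<nu> 0 * C) * x ^ n" using up by (simp add: mult_ac)
    then show ?thesis by (rule mult_right_le_imp_le) (use x in simp)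
  qed
  define x where "x = max 1 (bclif \<nu> 0 * C / c + 1)"
  have "c * (bclif \<nu> 0 * C / c + 1) \<le> c * x" using cpos by (intro mult_left_mono) (auto simp: x_def)
  also have "\<dots> \<le> bclif \<nu> 0 * C" by (rule le) (simp add: x_def)
  finally have "c * (bclif \<nu> 0 * C / c + 1) \<le> bclif \<nu> 0 * C" .
  moreover have "c * (bclif \<nu> 0 * C / c + 1) = bclif \<nu> 0 * C + c" using cpos by (simp add: distrib_left)
  ultimately show False using cpos by simp
qed

section \<open>Quadratically spaced sequences\<close>

text \<open>
  Lagrange interpolation reproduces \<open>Q\<close>; compare the coefficients of highest possible degree. All the
  partial fraction identities below are instances.
\<close>
lemma divided_difference_eq_coeff:
  fixes S :: "'a::field set" and Q :: "'a poly"
  assumes S: "finite S" "S \<noteq> {}" and deg: "degree Q < card S"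
  shows "(\<Sum>x\<in>S. poly Q x / (\<Prod>y\<in>S - {x}. x - y)) = coeff Q (card S - 1)"
proof -
  define l where "l = (\<lambda>x. \<Prod>y\<in>S - {x}. [:- y, 1:])"
  define L where "L = (\<Sum>x\<in>S. smult (poly Q x / (\<Prod>y\<in>S - {x}. x - y)) (l x))"
  have deg_l: "degree (l x) = card S - 1" and lead_l: "coeff (l x) (card S - 1) = 1" if "x \<in> S" for x
  proof -
    have "degree (l x) = (\<Sum>y\<in>S - {x}. degree [:- y, 1:])"
      unfolding l_def by (rule degree_prod_eq_sum_degree) auto
    then show d: "degree (l x) = card S - 1" using that S by simp
    have "lead_coeff (l x) = 1" unfolding l_def by (simp add: lead_coeff_prod)
    then show "coeff (l x) (card S - 1) = 1" using d by simp
  qed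
  have "card S > 0" using S by (simp add: card_gt_0_iff)
  have degL: "degree L < card S"
    unfolding L_def using S \<open>card S > 0\<close>
    by (intro degree_sum_less) (auto simp: deg_l intro: le_less_trans[OF degree_smult_le])
  have "poly L x = poly Q x" if x: "x \<in> S" for x
  proof -
    have "poly L x = (\<Sum>z\<in>S. if z = x then poly Q x else 0)"
      unfolding L_def poly_sum
    proof (intro sum.cong refl)
      fix z assume z: "z \<in> S"
      show "poly (smult (poly Q z / (\<Prod>y\<in>S - {z}. z - y)) (l z)) x = (if z = x then poly Q x else 0)"
      proof (cases "z = x")
        case True
        have "(\<Prod>y\<in>S - {x}. x - y) \<noteq> 0" using S by auto
        then show ?thesis using True by (simp add: l_def poly_prod)
      next
        case False
        then have "(\<Prod>y\<in>S - {z}. x - y) = 0" using S x by (auto simp: prod_zero_iff)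
        then show ?thesis using False by (simp add: l_def poly_prod)
      qed
    qed
    then show ?thesis using S x by simp
  qed
  then have "S \<subseteq> {x. poly (L - Q) x = 0}" by auto
  moreover have "degree (L - Q) < card S" using degL deg by (simp add: degree_diff_less)
  ultimately have "L - Q = 0"
    using card_mono[of "{x. poly (L - Q) x = 0}" S] poly_roots_finite[of "L - Q"] card_poly_roots_bound[of "L - Q"]
    by (metis leD order.trans)
  then have "coeff Q (card S - 1) = coeff L (card S - 1)" by simp
  also have "\<dots> = (\<Sum>x\<in>S. poly Q x / (\<Prod>y\<in>S - {x}. x - y))"
    unfolding L_def coeff_sum by (intro sum.cong refl) (simp add: lead_l del: One_nat_def)
  finally show ?thesis by simp
qed

lemma degree_prod_linear: "degree (\<Prod>j\<in>J. [:- f j, 1:] :: 'a::field poly) = card J"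
  by (cases "finite J") (auto simp: degree_prod_eq_sum_degree)

lemma lead_prod_linear: "coeff (\<Prod>j\<in>J. [:- f j, 1:] :: 'a::field poly) (card J) = 1"
proof -
  have "lead_coeff (\<Prod>j\<in>J. [:- f j, 1:] :: 'a poly) = 1" by (simp add: lead_coeff_prod)
  then show ?thesis by (simp add: degree_prod_linear)
qed

lemma tannery_sequentially:
  fixes f :: "nat \<Rightarrow> nat \<Rightarrow> real"
  assumes "\<And>k. (\<lambda>N. f N k) \<longlonglongrightarrow> g k" "\<And>N k. \<bar>f N k\<bar> \<le> M k" "summable M"
  shows "summable g" "(\<lambda>N. \<Sum>k. f N k) \<longlonglongrightarrow> (\<Sum>k. g k)"
proof -
  have ev: "eventually (\<lambda>(k, N). norm (f N k) \<le> M k) (at_top \<times>\<^sub>F sequentially)"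
    by (rule always_eventually) (use assms(2) in auto)
  have *: "eventually (\<lambda>N. summable (\<lambda>k. norm (f N k))) sequentially \<and> summable (\<lambda>k. norm (g k)) \<and>
      ((\<lambda>N. \<Sum>k. f N k) \<longlongrightarrow> suminf g) sequentially"
    by (rule tannerys_theorem[OF assms(1) ev assms(3)]) simp
  then show "summable g" "(\<lambda>N. \<Sum>k. f N k) \<longlonglongrightarrow> (\<Sum>k. g k)" by (auto intro: summable_norm_cancel)
qed

lemma bounded_sums_imp_summable:
  fixes f :: "nat \<Rightarrow> real"
  assumes "\<And>n. f n \<ge> 0" "\<And>N. (\<Sum>n<N. f n) \<le> B"
  shows "summable f" "suminf f \<le> B"
proof -
  show "summable f" by (rule summableI_nonneg_bounded[OF assms])
  then show "suminf f \<le> B" by (intro suminf_le_const assms)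
qed

lemma summable_Suc_powr: "a < - 1 \<Longrightarrow> summable (\<lambda>i. real (Suc i) powr a)"
  using summable_real_powr_iff[of a] by (subst summable_Suc_iff[of "\<lambda>i. real i powr a"]) simp

text \<open>
  The exponents \<open>3/4\<close> and \<open>1/4\<close> split the factor \<open>k + j + 2\<close>, which exceeds both \<open>k + 1\<close> and
  \<open>\<bar>k - j\<bar>\<close>: the second makes the sum over \<open>j\<close> converge, and the first leaves a square summable
  function of \<open>k\<close>.
\<close>
lemma sum_inverse_distance_le:
  fixes k N :: nat
  shows "(\<Sum>j\<in>{..<N} - {k}. 1 / (\<bar>real k - real j\<bar> * (real k + real j + 2)))
     \<le> 2 * (\<Sum>i. real (Suc i) powr (- 5 / 4)) * real (Suc k) powr (- 3 / 4)"
proof -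
  define c where "c = (\<lambda>i. real (Suc i) powr (- 5 / 4))"
  have sm: "summable c"
    unfolding c_def by (rule summable_Suc_powr) simp
  have c0: "c i \<ge> 0" for i by (simp add: c_def)
  have part: "sum c A \<le> suminf c" if "finite A" for A by (rule sum_le_suminf[OF sm that]) (simp add: c0)
  have "1 / (\<bar>real k - real j\<bar> * (real k + real j + 2)) \<le> real (Suc k) powr (- 3 / 4) * \<bar>real k - real j\<bar> powr (- 5 / 4)"
    if "j \<noteq> k" for j
  proof -
    define d where "d = \<bar>real k - real j\<bar>"
    have d: "d > 0" using that by (simp add: d_def)
    have "real (Suc k) powr (3 / 4) * d powr (1 / 4) \<le> (real k + real j + 2) powr (3 / 4) * (real k + real j + 2) powr (1 / 4)"
      by (intro mult_mono powr_mono2) (auto simp: d_def)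
    also have "\<dots> = real k + real j + 2" by (simp flip: powr_add)
    finally have "d * (real (Suc k) powr (3 / 4) * d powr (1 / 4)) \<le> d * (real k + real j + 2)"
      using d by (intro mult_left_mono) auto
    then have "1 / (d * (real k + real j + 2)) \<le> 1 / (d * (real (Suc k) powr (3 / 4) * d powr (1 / 4)))"
      using d by (intro divide_left_mono) auto
    also have "d * (real (Suc k) powr (3 / 4) * d powr (1 / 4)) = real (Suc k) powr (3 / 4) * d powr (5 / 4)"
    proof -
      have "d powr (5 / 4) = d powr 1 * d powr (1 / 4)" by (subst powr_add[symmetric]) simp
      also have "\<dots> = d * d powr (1 / 4)" using d by simp
      finally show ?thesis by (simp add: mult_ac)
    qed
    also have "1 / (real (Suc k) powr (3 / 4) * d powr (5 / 4)) = real (Suc k) powr (- 3 / 4) * d powr (- 5 / 4)"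
      using d by (simp add: powr_minus_divide)
    finally show ?thesis by (simp add: d_def)
  qed
  then have "(\<Sum>j\<in>{..<N} - {k}. 1 / (\<bar>real k - real j\<bar> * (real k + real j + 2)))
     \<le> (\<Sum>j\<in>{..<N} - {k}. real (Suc k) powr (- 3 / 4) * \<bar>real k - real j\<bar> powr (- 5 / 4))"
    by (intro sum_mono) auto
  also have "\<dots> = real (Suc k) powr (- 3 / 4) * (\<Sum>j\<in>{..<N} - {k}. \<bar>real k - real j\<bar> powr (- 5 / 4))"
    by (simp add: sum_distrib_left)
  also have "(\<Sum>j\<in>{..<N} - {k}. \<bar>real k - real j\<bar> powr (- 5 / 4)) \<le> 2 * suminf c"
  proof -
    have "{..<N} - {k} \<subseteq> (\<lambda>i. k - Suc i) ` {..<k} \<union> (\<lambda>i. Suc (k + i)) ` {..<N}"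
    proof
      fix j assume j: "j \<in> {..<N} - {k}"
      show "j \<in> (\<lambda>i. k - Suc i) ` {..<k} \<union> (\<lambda>i. Suc (k + i)) ` {..<N}"
      proof (cases "j < k")
        case True
        then have "j = k - Suc (k - Suc j)" "k - Suc j < k" by auto
        then show ?thesis by blast
      next
        case False
        then have "j = Suc (k + (j - Suc k))" "j - Suc k < N" using j by auto
        then show ?thesis by blast
      qed
    qed
    then have "(\<Sum>j\<in>{..<N} - {k}. \<bar>real k - real j\<bar> powr (- 5 / 4))
        \<le> (\<Sum>j\<in>(\<lambda>i. k - Suc i) ` {..<k} \<union> (\<lambda>i. Suc (k + i)) ` {..<N}. \<bar>real k - real j\<bar> powr (- 5 / 4))"
      by (intro sum_mono2) auto
    also have "\<dots> \<le> (\<Sum>j\<in>(\<lambda>i. k - Suc i) ` {..<k}. \<bar>real k - real j\<bar> powr (- 5 / 4))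
        + (\<Sum>j\<in>(\<lambda>i. Suc (k + i)) ` {..<N}. \<bar>real k - real j\<bar> powr (- 5 / 4))"
      by (subst sum.union_inter[symmetric]) (auto intro: sum_nonneg)
    also have "(\<Sum>j\<in>(\<lambda>i. k - Suc i) ` {..<k}. \<bar>real k - real j\<bar> powr (- 5 / 4)) = sum c {..<k}"
      by (subst sum.reindex) (auto simp: inj_on_def c_def add.commute intro!: sum.cong)
    also have "(\<Sum>j\<in>(\<lambda>i. Suc (k + i)) ` {..<N}. \<bar>real k - real j\<bar> powr (- 5 / 4)) = sum c {..<N}"
      by (subst sum.reindex) (auto simp: inj_on_def c_def add.commute intro!: sum.cong)
    finally show ?thesis using part[of "{..<k}"] part[of "{..<N}"] by simp
  qed
  finally show ?thesis by (simp add: c_def mult_ac mult_left_mono)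
qed

text \<open>
  The bound on the gaps is the one satisfied by \<open>(c (k + 1))\<^sup>2\<close>, a difference of squares.
\<close>
locale quadratic_spacing =
  fixes \<tau> :: "nat \<Rightarrow> real" and \<delta> :: real
  assumes \<delta>_pos: "\<delta> > 0"
    and gap: "\<And>j k. \<bar>\<tau> k - \<tau> j\<bar> \<ge> \<delta> * (\<bar>real k - real j\<bar> * (real k + real j + 2))"
    and growth: "\<And>k. \<tau> k \<ge> \<delta> * (real k + 1)\<^sup>2"
begin

definition spread :: "nat \<Rightarrow> real" where
  "spread k = 2 * (\<Sum>i. real (Suc i) powr (- 5 / 4)) / \<delta> * real (Suc k) powr (- 3 / 4)"

lemma \<tau>_pos: "\<tau> k > 0"
proof -
  have "0 < \<delta> * (real k + 1)\<^sup>2" using \<delta>_pos by (simp add: add_pos_nonneg)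
  then show ?thesis using growth[of k] by linarith
qed

lemma \<tau>_inj: "k \<noteq> j \<Longrightarrow> \<tau> k \<noteq> \<tau> j"
proof -
  assume "k \<noteq> j"
  then have "0 < \<delta> * (\<bar>real k - real j\<bar> * (real k + real j + 2))" using \<delta>_pos by (intro mult_pos_pos) auto
  then show ?thesis using gap[of k j] by auto
qed

lemma zeta_pos: "(\<Sum>i. real (Suc i) powr (- 5 / 4)) \<ge> 0"
  by (intro suminf_nonneg summable_Suc_powr) auto

lemma spread_nonneg: "spread k \<ge> 0"
  using \<delta>_pos zeta_pos by (simp add: spread_def)

lemma spread_le_0: "spread k \<le> spread 0"
proof -
  have "real (Suc k) powr (- 3 / 4) \<le> 1" using powr_mono2'[of "-3/4" 1 "real (Suc k)"] by simp
  then show ?thesis unfolding spread_def using \<delta>_pos zeta_pos by (intro mult_left_mono) auto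
qed

lemma summable_spread_sq: "summable (\<lambda>k. (spread k)\<^sup>2)"
proof -
  have "(spread k)\<^sup>2 = (2 * (\<Sum>i. real (Suc i) powr (- 5 / 4)) / \<delta>)\<^sup>2 * real (Suc k) powr (- 3 / 2)" for k
    by (simp add: spread_def power_mult_distrib power2_eq_square del: of_nat_Suc flip: powr_add)
  moreover have "summable (\<lambda>i. real (Suc i) powr (- 3 / 2))" by (rule summable_Suc_powr) simp
  ultimately show ?thesis by (simp add: summable_mult)
qed

lemma summable_inverse_\<tau>_sq: "summable (\<lambda>n. (1 / \<tau> n)\<^sup>2)"
proof (rule summable_comparison_test')
  show "summable (\<lambda>n. (1 / \<delta>)\<^sup>2 * real (Suc n) powr (- 4))" by (intro summable_mult summable_Suc_powr) simp
  fix n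
  have "1 / \<tau> n \<le> 1 / (\<delta> * (real n + 1)\<^sup>2)"
    using growth[of n] \<delta>_pos \<tau>_pos[of n] by (intro divide_left_mono mult_pos_pos) (auto simp: add_pos_nonneg)
  then have "(1 / \<tau> n)\<^sup>2 \<le> (1 / (\<delta> * (real n + 1)\<^sup>2))\<^sup>2" using \<tau>_pos[of n] by (intro power_mono) auto
  also have "\<dots> = (1 / \<delta>)\<^sup>2 * real (Suc n) powr (- 4)"
    by (simp add: power_divide power_mult_distrib powr_minus_divide add.commute)
  finally show "norm ((1 / \<tau> n)\<^sup>2) \<le> (1 / \<delta>)\<^sup>2 * real (Suc n) powr (- 4)" by simp
qed

lemma sum_inverse_gap_le: "(\<Sum>j\<in>{..<N} - {k}. 1 / \<bar>\<tau> k - \<tau> j\<bar>) \<le> spread k"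
proof -
  have "(\<Sum>j\<in>{..<N} - {k}. 1 / \<bar>\<tau> k - \<tau> j\<bar>) \<le> (\<Sum>j\<in>{..<N} - {k}. 1 / (\<bar>real k - real j\<bar> * (real k + real j + 2)) / \<delta>)"
  proof (intro sum_mono)
    fix j assume "j \<in> {..<N} - {k}"
    then have "0 < \<delta> * (\<bar>real k - real j\<bar> * (real k + real j + 2))" using \<delta>_pos by (intro mult_pos_pos) auto
    then have "1 / \<bar>\<tau> k - \<tau> j\<bar> \<le> 1 / (\<delta> * (\<bar>real k - real j\<bar> * (real k + real j + 2)))"
      using gap[of k j] by (intro divide_left_mono) (auto intro!: mult_pos_pos)
    then show "1 / \<bar>\<tau> k - \<tau> j\<bar> \<le> 1 / (\<bar>real k - real j\<bar> * (real k + real j + 2)) / \<delta>" by (simp add: mult.commute)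
  qed
  also have "\<dots> = (\<Sum>j\<in>{..<N} - {k}. 1 / (\<bar>real k - real j\<bar> * (real k + real j + 2))) / \<delta>"
    by (simp add: sum_divide_distrib)
  also have "\<dots> \<le> (2 * (\<Sum>i. real (Suc i) powr (- 5 / 4)) * real (Suc k) powr (- 3 / 4)) / \<delta>"
    using \<delta>_pos by (intro divide_right_mono sum_inverse_distance_le) auto
  finally show ?thesis by (simp add: spread_def)
qed

text \<open>
  Up to the factor \<open>s\<close>, the residue at \<open>\<tau>\<^sub>k\<close> of the product of the quotients
  \<open>(z + s - \<tau>\<^sub>j) / (z - \<tau>\<^sub>j)\<close> with \<open>j < N\<close>.
\<close>
definition sprod :: "real \<Rightarrow> nat \<Rightarrow> nat \<Rightarrow> real" where
  "sprod s N k = (\<Prod>j\<in>{..<N} - {k}. 1 + s / (\<tau> k - \<tau> j))"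

lemma sprod_minus_1_le: "\<bar>sprod s N k - 1\<bar> \<le> \<bar>s\<bar> * exp (\<bar>s\<bar> * spread 0) * spread k"
proof -
  have "\<bar>sprod s N k - 1\<bar> \<le> (\<Prod>j\<in>{..<N} - {k}. 1 + norm (s / (\<tau> k - \<tau> j))) - 1"
    unfolding sprod_def using norm_prod_minus1_le_prod_minus1[of "\<lambda>j. s / (\<tau> k - \<tau> j)" "{..<N} - {k}"] by simp
  also have "\<dots> \<le> exp (\<Sum>j\<in>{..<N} - {k}. norm (s / (\<tau> k - \<tau> j))) - 1"
    unfolding exp_sum[OF finite_Diff[OF finite_lessThan]] by (intro diff_right_mono prod_mono) (auto simp: exp_ge_add_one_self)
  also have "(\<Sum>j\<in>{..<N} - {k}. norm (s / (\<tau> k - \<tau> j))) = \<bar>s\<bar> * (\<Sum>j\<in>{..<N} - {k}. 1 / \<bar>\<tau> k - \<tau> j\<bar>)"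
    by (simp add: sum_distrib_left)
  also have "exp \<dots> \<le> exp (\<bar>s\<bar> * spread k)"
    using sum_inverse_gap_le by (simp add: mult_left_mono)
  finally have *: "\<bar>sprod s N k - 1\<bar> \<le> exp (\<bar>s\<bar> * spread k) - 1" by simp
  define x where "x = \<bar>s\<bar> * spread k"
  have x0: "x \<ge> 0" using spread_nonneg by (simp add: x_def)
  have "1 - x \<le> exp (- x)" using exp_ge_add_one_self[of "-x"] by simp
  then have "(1 - x) * exp x \<le> exp (- x) * exp x" by (intro mult_right_mono) auto
  then have "exp x - 1 \<le> x * exp x" by (simp add: exp_minus algebra_simps)
  also have "\<dots> \<le> x * exp (\<bar>s\<bar> * spread 0)" using x0 spread_le_0[of k] by (intro mult_left_mono) (auto simp: x_def mult_left_mono)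
  finally show ?thesis using * by (simp add: x_def mult_ac)
qed

lemma sprod_bounded: obtains B where "B > 0" "\<And>N k. \<bar>sprod s N k\<bar> \<le> B"
proof
  define B where "B = \<bar>s\<bar> * exp (\<bar>s\<bar> * spread 0) * spread 0 + 1"
  show "B > 0" using spread_nonneg by (simp add: B_def add_nonneg_pos)
  fix N k
  have "\<bar>s\<bar> * exp (\<bar>s\<bar> * spread 0) * spread k \<le> \<bar>s\<bar> * exp (\<bar>s\<bar> * spread 0) * spread 0"
    by (intro mult_left_mono spread_le_0) auto
  then show "\<bar>sprod s N k\<bar> \<le> B" using sprod_minus_1_le[of s N k] unfolding B_def by linarith
qed

end

text \<open>
  The shifted sequence \<open>\<tau>\<^sub>m - \<sigma>\<close> avoids the original one, so that the Cauchy matrix \<open>w\<close> is defined.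
\<close>
locale nonresonant_shift = quadratic_spacing +
  fixes \<sigma> :: real
  assumes \<sigma>: "\<sigma> \<noteq> 0" and nonres: "\<And>k m. \<tau> k - \<tau> m + \<sigma> \<noteq> 0"
begin

definition w :: "nat \<Rightarrow> nat \<Rightarrow> real" where
  "w k m = 1 / (\<tau> k - \<tau> m + \<sigma>)"

text \<open>
  The shift can make a denominator smaller than the unshifted one by more than the factor two only for the
  finitely many pairs closer than \<open>2 \<bar>\<sigma>\<bar>\<close>, and nonresonance keeps those away from zero.
\<close>
lemma w_le: obtains C where "C > 0" "\<And>k m. k \<noteq> m \<Longrightarrow> \<bar>w k m\<bar> \<le> C / \<bar>\<tau> k - \<tau> m\<bar>"
proof -
  define P where "P = {(k, m). k \<noteq> m \<and> \<bar>\<tau> k - \<tau> m\<bar> < 2 * \<bar>\<sigma>\<bar>}"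
  obtain M :: nat where M: "2 * \<bar>\<sigma>\<bar> / \<delta> < real M" using reals_Archimedean2 by blast
  have "P \<subseteq> {..<M} \<times> {..<M}"
  proof
    fix x assume "x \<in> P"
    then obtain k m where x: "x = (k, m)" "k \<noteq> m" "\<bar>\<tau> k - \<tau> m\<bar> < 2 * \<bar>\<sigma>\<bar>" by (auto simp: P_def)
    have "1 \<le> \<bar>real k - real m\<bar>" using x(2) by (cases k m rule: linorder_cases) auto
    then have "1 * (real k + real m + 2) \<le> \<bar>real k - real m\<bar> * (real k + real m + 2)" by (intro mult_right_mono) auto
    then have "\<delta> * (real k + real m + 2) \<le> \<delta> * (\<bar>real k - real m\<bar> * (real k + real m + 2))"
      using \<delta>_pos by (intro mult_left_mono) auto
    also have "\<dots> < 2 * \<bar>\<sigma>\<bar>" using gap[of k m] x by linarith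
    finally have "real k + real m + 2 < 2 * \<bar>\<sigma>\<bar> / \<delta>" using \<delta>_pos by (simp add: field_simps)
    then show "x \<in> {..<M} \<times> {..<M}" using M x by auto
  qed
  then have fin: "finite P" by (rule finite_subset) auto
  define C where "C = 2 + (\<Sum>(k, m)\<in>P. \<bar>w k m\<bar> * \<bar>\<tau> k - \<tau> m\<bar>)"
  have S0: "0 \<le> (\<Sum>(k, m)\<in>P. \<bar>w k m\<bar> * \<bar>\<tau> k - \<tau> m\<bar>)" by (intro sum_nonneg) auto
  have "\<bar>w k m\<bar> * \<bar>\<tau> k - \<tau> m\<bar> \<le> C" if "k \<noteq> m" for k m
  proof (cases "(k, m) \<in> P")
    case True
    have "\<bar>w k m\<bar> * \<bar>\<tau> k - \<tau> m\<bar> \<le> (\<Sum>(k, m)\<in>P. \<bar>w k m\<bar> * \<bar>\<tau> k - \<tau> m\<bar>)"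
      using member_le_sum[OF True, of "\<lambda>(k, m). \<bar>w k m\<bar> * \<bar>\<tau> k - \<tau> m\<bar>"] fin by auto
    then show ?thesis by (simp add: C_def)
  next
    case False
    then have big: "\<bar>\<tau> k - \<tau> m\<bar> \<ge> 2 * \<bar>\<sigma>\<bar>" using that by (auto simp: P_def)
    then have "\<bar>\<tau> k - \<tau> m\<bar> \<le> 2 * \<bar>\<tau> k - \<tau> m + \<sigma>\<bar>"
      using abs_triangle_ineq4[of "\<tau> k - \<tau> m + \<sigma>" \<sigma>] by simp
    then have "\<bar>w k m\<bar> * \<bar>\<tau> k - \<tau> m\<bar> \<le> 2" using nonres[of k m] by (simp add: w_def field_simps)
    then show ?thesis using S0 by (simp add: C_def)
  qed
  then have "\<bar>w k m\<bar> \<le> C / \<bar>\<tau> k - \<tau> m\<bar>" if "k \<noteq> m" for k m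
    using \<tau>_inj[OF that] that by (subst pos_le_divide_eq) auto
  moreover have "C > 0" using S0 by (simp add: C_def)
  ultimately show thesis using that by blast
qed

text \<open>
  The last bound, on the weighted square sums, is the one needed for the norms of the functions \<open>\<psi>\<^sub>n\<close>;
  it uses \<open>\<tau>\<^sub>k \<le> \<tau>\<^sub>n + \<bar>\<tau>\<^sub>k - \<tau>\<^sub>n\<bar>\<close>.
\<close>
lemma w_sums_le:
  obtains C where "C > 0" "\<And>N k. (\<Sum>m\<in>{..<N} - {k}. \<bar>w k m\<bar>) \<le> C * spread k"
    "\<And>N m. (\<Sum>k\<in>{..<N} - {m}. \<bar>w k m\<bar>) \<le> C * spread m"
    "\<And>N n. (\<Sum>k\<in>{..<N} - {n}. \<tau> k / \<tau> n * (w k n)\<^sup>2) \<le> C * ((spread n)\<^sup>2 + (1 / \<tau> n)\<^sup>2)"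
proof -
  obtain C where C: "C > 0" "\<And>k m. k \<noteq> m \<Longrightarrow> \<bar>w k m\<bar> \<le> C / \<bar>\<tau> k - \<tau> m\<bar>" using w_le by blast
  have row: "(\<Sum>m\<in>{..<N} - {k}. \<bar>w k m\<bar>) \<le> C * spread k" for N k
  proof -
    have "(\<Sum>m\<in>{..<N} - {k}. \<bar>w k m\<bar>) \<le> (\<Sum>m\<in>{..<N} - {k}. C * (1 / \<bar>\<tau> k - \<tau> m\<bar>))"
      using C(2) by (intro sum_mono) auto
    also have "\<dots> \<le> C * spread k"
      unfolding sum_distrib_left[symmetric] using C(1) by (intro mult_left_mono sum_inverse_gap_le) auto
    finally show ?thesis .
  qed
  have col: "(\<Sum>k\<in>{..<N} - {m}. \<bar>w k m\<bar>) \<le> C * spread m" for N m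
  proof -
    have "(\<Sum>k\<in>{..<N} - {m}. \<bar>w k m\<bar>) \<le> (\<Sum>k\<in>{..<N} - {m}. C * (1 / \<bar>\<tau> m - \<tau> k\<bar>))"
      using C(2) by (intro sum_mono) (auto simp: abs_minus_commute)
    also have "\<dots> \<le> C * spread m"
      unfolding sum_distrib_left[symmetric] using C(1) by (intro mult_left_mono sum_inverse_gap_le) auto
    finally show ?thesis .
  qed
  have sq: "(\<Sum>k\<in>{..<N} - {n}. \<tau> k / \<tau> n * (w k n)\<^sup>2) \<le> (2 * C\<^sup>2) * ((spread n)\<^sup>2 + (1 / \<tau> n)\<^sup>2)" for N n
  proof -
    let ?g = "\<lambda>k. 1 / \<bar>\<tau> n - \<tau> k\<bar>"
    have tn: "\<tau> n > 0" by (rule \<tau>_pos)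
    have "\<tau> k / \<tau> n * (w k n)\<^sup>2 \<le> C\<^sup>2 * ((?g k)\<^sup>2 + 1 / \<tau> n * ?g k)" if k: "k \<noteq> n" for k
    proof -
      define d where "d = \<bar>\<tau> n - \<tau> k\<bar>"
      have d: "d > 0" using \<tau>_inj[of n k] k by (simp add: d_def)
      have "\<tau> k \<le> \<tau> n + d" by (simp add: d_def)
      then have "\<tau> k / \<tau> n \<le> (\<tau> n + d) / \<tau> n" using tn by (intro divide_right_mono) auto
      then have 1: "\<tau> k / \<tau> n \<le> 1 + d / \<tau> n" using tn by (simp add: add_divide_distrib)
      have "\<bar>w k n\<bar> \<le> C / d" using C(2)[OF k] by (simp add: d_def abs_minus_commute)
      then have "\<bar>w k n\<bar>\<^sup>2 \<le> (C / d)\<^sup>2" by (intro power_mono) auto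
      then have "\<tau> k / \<tau> n * (w k n)\<^sup>2 \<le> (1 + d / \<tau> n) * (C / d)\<^sup>2"
        using 1 \<tau>_pos[of k] tn d by (intro mult_mono) auto
      also have "\<dots> = C\<^sup>2 * ((1 / d)\<^sup>2 + 1 / \<tau> n * (1 / d))"
        using d tn by (simp add: field_simps power2_eq_square)
      finally show ?thesis by (simp add: d_def)
    qed
    then have "(\<Sum>k\<in>{..<N} - {n}. \<tau> k / \<tau> n * (w k n)\<^sup>2) \<le> (\<Sum>k\<in>{..<N} - {n}. C\<^sup>2 * ((?g k)\<^sup>2 + 1 / \<tau> n * ?g k))"
      by (intro sum_mono) auto
    also have "\<dots> = C\<^sup>2 * ((\<Sum>k\<in>{..<N} - {n}. (?g k)\<^sup>2) + 1 / \<tau> n * (\<Sum>k\<in>{..<N} - {n}. ?g k))"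
      by (simp add: sum_distrib_left sum.distrib distrib_left)
    also have "\<dots> \<le> C\<^sup>2 * ((spread n)\<^sup>2 + 1 / \<tau> n * spread n)"
    proof (intro mult_left_mono add_mono)
      have "(\<Sum>k\<in>{..<N} - {n}. (?g k)\<^sup>2) \<le> (\<Sum>k\<in>{..<N} - {n}. ?g k)\<^sup>2"
        unfolding power2_eq_square sum_distrib_left sum_distrib_right[symmetric]
        by (intro sum_mono mult_right_mono member_le_sum) auto
      also have "\<dots> \<le> (spread n)\<^sup>2" by (intro power_mono sum_inverse_gap_le sum_nonneg) auto
      finally show "(\<Sum>k\<in>{..<N} - {n}. (?g k)\<^sup>2) \<le> (spread n)\<^sup>2" .
    qed (use tn sum_inverse_gap_le in auto)
    also have "\<dots> \<le> C\<^sup>2 * (2 * ((spread n)\<^sup>2 + (1 / \<tau> n)\<^sup>2))"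
    proof (intro mult_left_mono)
      have lin: "a + y \<le> 2 * (a + b)" if "2 * y \<le> a + b" "0 \<le> a" "0 \<le> b" for a b y :: real
        using that by argo
      have "2 * (1 / \<tau> n * spread n) \<le> (spread n)\<^sup>2 + (1 / \<tau> n)\<^sup>2"
        using sum_squares_bound[of "1 / \<tau> n" "spread n"] by simp
      then show "(spread n)\<^sup>2 + 1 / \<tau> n * spread n \<le> 2 * ((spread n)\<^sup>2 + (1 / \<tau> n)\<^sup>2)"
        by (rule lin) auto
    qed simp
    also have "C\<^sup>2 * (2 * ((spread n)\<^sup>2 + (1 / \<tau> n)\<^sup>2)) = (2 * C\<^sup>2) * ((spread n)\<^sup>2 + (1 / \<tau> n)\<^sup>2)"
      by (rule mult.left_commute[THEN trans, OF mult.assoc[symmetric]])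
    finally show ?thesis .
  qed
  define D where "D = C + 2 * C\<^sup>2"
  have D: "D > 0" "C \<le> D" "2 * C\<^sup>2 \<le> D" using C(1) by (auto simp: D_def add_pos_nonneg)
  show thesis
  proof (rule that[OF D(1)])
    show "(\<Sum>m\<in>{..<N} - {k}. \<bar>w k m\<bar>) \<le> D * spread k" for N k
      by (rule order_trans[OF row mult_right_mono[OF D(2) spread_nonneg]])
    show "(\<Sum>k\<in>{..<N} - {m}. \<bar>w k m\<bar>) \<le> D * spread m" for N m
      by (rule order_trans[OF col mult_right_mono[OF D(2) spread_nonneg]])
    show "(\<Sum>k\<in>{..<N} - {n}. \<tau> k / \<tau> n * (w k n)\<^sup>2) \<le> D * ((spread n)\<^sup>2 + (1 / \<tau> n)\<^sup>2)" for N n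
      by (rule order_trans[OF sq mult_right_mono[OF D(3)]]) simp
  qed
qed

lemma sum_split_diag:
  fixes f :: "nat \<Rightarrow> real"
  assumes "\<And>m. f m \<ge> 0"
  shows "(\<Sum>m<N. f m) \<le> f k + (\<Sum>m\<in>{..<N} - {k}. f m)"
  using assms[of k] by (cases "k < N") (auto simp: sum.remove)

lemma w_row_bounded:
  obtains W where "W > 0" "\<And>k. summable (\<lambda>m. \<bar>w k m\<bar>)" "\<And>k. (\<Sum>m. \<bar>w k m\<bar>) \<le> W"
    "\<And>m. summable (\<lambda>k. \<bar>w k m\<bar>)"
proof -
  obtain C where C: "C > 0" "\<And>N k. (\<Sum>m\<in>{..<N} - {k}. \<bar>w k m\<bar>) \<le> C * spread k"
    "\<And>N m. (\<Sum>k\<in>{..<N} - {m}. \<bar>w k m\<bar>) \<le> C * spread m" by (rule w_sums_le) blast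
  define W where "W = 1 / \<bar>\<sigma>\<bar> + C * spread 0"
  have wkk: "\<bar>w k k\<bar> = 1 / \<bar>\<sigma>\<bar>" for k by (simp add: w_def)
  have Cs: "C * spread k \<le> C * spread 0" for k using C(1) spread_le_0 by (intro mult_left_mono) auto
  have r: "(\<Sum>m<N. \<bar>w k m\<bar>) \<le> W" for k N
    using sum_split_diag[of "\<lambda>m. \<bar>w k m\<bar>" N k] C(2)[where N=N and k=k] Cs[of k] wkk[of k] by (simp add: W_def)
  have c: "(\<Sum>k<N. \<bar>w k m\<bar>) \<le> W" for m N
    using sum_split_diag[of "\<lambda>k. \<bar>w k m\<bar>" N m] C(3)[where N=N and m=m] Cs[of m] wkk[of m] by (simp add: W_def)
  show thesis
  proof (rule that[of W])
    show "W > 0" using \<sigma> C(1) spread_nonneg[of 0] by (simp add: W_def add_pos_nonneg)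
    show "summable (\<lambda>m. \<bar>w k m\<bar>)" for k using r by (intro bounded_sums_imp_summable(1)[of _ W]) auto
    show "(\<Sum>m. \<bar>w k m\<bar>) \<le> W" for k using r by (intro bounded_sums_imp_summable(2)[of _ W]) auto
    show "summable (\<lambda>k. \<bar>w k m\<bar>)" for m using c by (intro bounded_sums_imp_summable(1)[of _ W]) auto
  qed
qed

end

section \<open>Infinite Cauchy systems\<close>

context nonresonant_shift
begin

lemma w_nonzero: "w k m \<noteq> 0"
  using nonres[of k m] by (simp add: w_def)

text \<open>
  The divided difference, at the shifted points, of the monic polynomial of degree \<open>N - 1\<close> that vanishes at
  every \<open>\<tau>\<^sub>j\<close> with \<open>j \<noteq> k\<close>.
\<close>
lemma cauchy_system_finite:
  assumes k: "k < N"
  shows "(\<Sum>m<N. \<sigma> * sprod (- \<sigma>) N m * w k m) = 1"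
proof -
  define s where "s = (\<lambda>m. \<tau> m - \<sigma>)"
  have inj: "inj_on s A" for A using \<tau>_inj by (auto simp: inj_on_def s_def)
  define Q where "Q = (\<Prod>j\<in>{..<N} - {k}. [:- \<tau> j, 1:])"
  have cardN: "card (s ` {..<N}) = N" using inj by (simp add: card_image)
  have deg: "degree Q = N - 1" using k by (simp add: Q_def degree_prod_linear)
  have "coeff Q (card ({..<N} - {k})) = 1" unfolding Q_def by (rule lead_prod_linear)
  then have lc: "coeff Q (N - 1) = 1" using k by simp
  have "(\<Sum>x\<in>s ` {..<N}. poly Q x / (\<Prod>y\<in>s ` {..<N} - {x}. x - y)) = coeff Q (card (s ` {..<N}) - 1)"
    using k by (intro divided_difference_eq_coeff) (auto simp: cardN deg)
  also have "\<dots> = 1" by (simp only: cardN lc)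
  also have "(\<Sum>x\<in>s ` {..<N}. poly Q x / (\<Prod>y\<in>s ` {..<N} - {x}. x - y))
     = (\<Sum>m<N. poly Q (s m) / (\<Prod>y\<in>s ` {..<N} - {s m}. s m - y))"
    by (simp add: sum.reindex[OF inj])
  also have "\<dots> = (\<Sum>m<N. \<sigma> * sprod (- \<sigma>) N m * w k m)"
  proof (intro sum.cong refl)
    fix m assume m: "m \<in> {..<N}"
    have "s ` {..<N} - {s m} = s ` ({..<N} - {m})" using inj[of UNIV] m by (auto simp: inj_on_def)
    then have den: "(\<Prod>y\<in>s ` {..<N} - {s m}. s m - y) = (\<Prod>j\<in>{..<N} - {m}. \<tau> m - \<tau> j)"
      by (simp only: prod.reindex[OF inj]) (simp add: s_def)
    define X where "X = (\<Prod>j\<in>{..<N} - {m}. s m - \<tau> j)"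
    have 1: "(\<Prod>j<N. s m - \<tau> j) = (s m - \<tau> k) * poly Q (s m)"
      using k by (simp add: Q_def poly_prod prod.remove[of "{..<N}" k])
    have 2: "(\<Prod>j<N. s m - \<tau> j) = - \<sigma> * X"
      using m unfolding X_def by (subst prod.remove[of "{..<N}" m]) (auto simp: s_def)
    have sk: "s m - \<tau> k = - (1 / w k m)" by (simp add: s_def w_def)
    have Qs: "poly Q (s m) = \<sigma> * X * w k m" using 1 2 w_nonzero[of k m] unfolding sk by (simp add: field_simps)
    have "X / (\<Prod>j\<in>{..<N} - {m}. \<tau> m - \<tau> j) = sprod (- \<sigma>) N m"
      unfolding X_def sprod_def prod_dividef[symmetric]
    proof (intro prod.cong refl)
      fix j assume "j \<in> {..<N} - {m}"
      then have "\<tau> m - \<tau> j \<noteq> 0" using \<tau>_inj[of m j] by auto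
      then show "(s m - \<tau> j) / (\<tau> m - \<tau> j) = 1 + - \<sigma> / (\<tau> m - \<tau> j)" by (simp add: s_def field_simps)
    qed
    then show "poly Q (s m) / (\<Prod>y\<in>s ` {..<N} - {s m}. s m - y) = \<sigma> * sprod (- \<sigma>) N m * w k m"
      unfolding den Qs by (metis (no_types, lifting) times_divide_eq_left times_divide_eq_right)
  qed
  finally show ?thesis .
qed

text \<open>
  The inverse of the truncated Cauchy matrix, up to normalisation. The polynomial vanishing at the shifted
  points other than the one of index \<open>p\<close> has degree \<open>N - 1\<close>, and so its divided difference over the \<open>N + 1\<close>
  nodes \<open>\<tau>\<^sub>0, \<dots>, \<tau>\<^bsub>N-1\<^esub>, \<tau>\<^sub>m - \<sigma>\<close> is zero.
\<close>
lemma cauchy_inverse_finite: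
  assumes p: "p < N" and m: "m < N"
  shows "(\<Sum>k<N. \<sigma> * sprod \<sigma> N k * w k p * w k m) = (if m = p then 1 / (\<sigma> * sprod (- \<sigma>) N p) else 0)"
proof -
  define s where "s = (\<lambda>m. \<tau> m - \<sigma>)"
  have inj: "inj_on \<tau> A" for A using \<tau>_inj by (auto simp: inj_on_def)
  have sm: "s m \<notin> \<tau> ` A" for A
  proof
    assume "s m \<in> \<tau> ` A"
    then obtain k where "s m = \<tau> k" by auto
    then show False using nonres[of k m] by (simp add: s_def)
  qed
  define Q where "Q = (\<Prod>j\<in>{..<N} - {p}. [:- s j, 1:])"
  define S where "S = insert (s m) (\<tau> ` {..<N})"
  have cardS: "card S = Suc N" using sm[of "{..<N}"] inj by (simp add: S_def card_image)
  have deg: "degree Q = N - 1" using p by (simp add: Q_def degree_prod_linear)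
  have "(\<Sum>x\<in>S. poly Q x / (\<Prod>y\<in>S - {x}. x - y)) = coeff Q (card S - 1)"
  proof (rule divided_difference_eq_coeff)
    show "degree Q < card S" unfolding deg cardS by simp
  qed (auto simp: S_def)
  also have "\<dots> = 0" using p by (intro coeff_eq_0) (simp add: deg cardS)
  also have "(\<Sum>x\<in>S. poly Q x / (\<Prod>y\<in>S - {x}. x - y)) =
     poly Q (s m) / (\<Prod>y\<in>S - {s m}. s m - y) + (\<Sum>k<N. poly Q (\<tau> k) / (\<Prod>y\<in>S - {\<tau> k}. \<tau> k - y))"
  proof -
    have "(\<Sum>x\<in>S. poly Q x / (\<Prod>y\<in>S - {x}. x - y)) = poly Q (s m) / (\<Prod>y\<in>S - {s m}. s m - y)
       + (\<Sum>x\<in>\<tau> ` {..<N}. poly Q x / (\<Prod>y\<in>S - {x}. x - y))"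
      using sm[of "{..<N}"] unfolding S_def by (intro sum.insert) auto
    then show ?thesis by (simp add: sum.reindex[OF inj])
  qed
  also have "(\<Sum>k<N. poly Q (\<tau> k) / (\<Prod>y\<in>S - {\<tau> k}. \<tau> k - y)) = (\<Sum>k<N. \<sigma> * sprod \<sigma> N k * w k p * w k m)"
  proof (intro sum.cong refl)
    fix k assume k: "k \<in> {..<N}"
    have "S - {\<tau> k} = insert (s m) (\<tau> ` ({..<N} - {k}))"
      using sm[of "{..<N}"] inj[of UNIV] k by (auto simp: S_def inj_on_def)
    then have den: "(\<Prod>y\<in>S - {\<tau> k}. \<tau> k - y) = (\<tau> k - s m) * (\<Prod>j\<in>{..<N} - {k}. \<tau> k - \<tau> j)"
      using sm[of "{..<N} - {k}"] by (simp add: prod.reindex[OF inj])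
    have skm: "\<tau> k - s m = 1 / w k m" "\<tau> k - s p = 1 / w k p" by (auto simp: s_def w_def)
    define X where "X = (\<Prod>j\<in>{..<N} - {k}. \<tau> k - s j)"
    have 1: "(\<Prod>j<N. \<tau> k - s j) = (\<tau> k - s p) * poly Q (\<tau> k)"
      using p by (simp add: Q_def poly_prod prod.remove[of "{..<N}" p])
    have 2: "(\<Prod>j<N. \<tau> k - s j) = \<sigma> * X"
      using k unfolding X_def by (subst prod.remove[of "{..<N}" k]) (auto simp: s_def)
    have Qs: "poly Q (\<tau> k) = \<sigma> * X * w k p" using 1 2 w_nonzero[of k p] unfolding skm by (simp add: field_simps)
    have "X / (\<Prod>j\<in>{..<N} - {k}. \<tau> k - \<tau> j) = sprod \<sigma> N k"
      unfolding X_def sprod_def prod_dividef[symmetric]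
    proof (intro prod.cong refl)
      fix j assume "j \<in> {..<N} - {k}"
      then have "\<tau> k - \<tau> j \<noteq> 0" using \<tau>_inj[of k j] by auto
      then show "(\<tau> k - s j) / (\<tau> k - \<tau> j) = 1 + \<sigma> / (\<tau> k - \<tau> j)" by (simp add: s_def field_simps)
    qed
    then have "\<sigma> * sprod \<sigma> N k * w k p * w k m = \<sigma> * (X / (\<Prod>j\<in>{..<N} - {k}. \<tau> k - \<tau> j)) * w k p * w k m"
      by simp
    then show "poly Q (\<tau> k) / (\<Prod>y\<in>S - {\<tau> k}. \<tau> k - y) = \<sigma> * sprod \<sigma> N k * w k p * w k m"
      unfolding den Qs skm by (simp add: mult_ac)
  qed
  finally have eq: "(\<Sum>k<N. \<sigma> * sprod \<sigma> N k * w k p * w k m) = - (poly Q (s m) / (\<Prod>y\<in>S - {s m}. s m - y))"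
    by simp
  show ?thesis
  proof (cases "m = p")
    case False
    then have "poly Q (s m) = 0" using m by (auto simp: Q_def poly_prod prod_zero_iff)
    then show ?thesis using eq False by simp
  next
    case True
    have "S - {s m} = \<tau> ` {..<N}" using sm[of "{..<N}"] by (auto simp: S_def)
    then have "(\<Prod>y\<in>S - {s m}. s m - y) = (\<Prod>j<N. s p - \<tau> j)"
      using True by (simp add: prod.reindex[OF inj])
    also have "\<dots> = - \<sigma> * (\<Prod>j\<in>{..<N} - {p}. s p - \<tau> j)"
      using p by (subst prod.remove[of "{..<N}" p]) (auto simp: s_def)
    finally have den: "(\<Prod>y\<in>S - {s m}. s m - y) = - \<sigma> * (\<Prod>j\<in>{..<N} - {p}. s p - \<tau> j)" .
    have Qs: "poly Q (s m) = (\<Prod>j\<in>{..<N} - {p}. \<tau> p - \<tau> j)"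
      using True by (simp add: Q_def poly_prod s_def)
    have A: "sprod (- \<sigma>) N p = (\<Prod>j\<in>{..<N} - {p}. s p - \<tau> j) / (\<Prod>j\<in>{..<N} - {p}. \<tau> p - \<tau> j)"
      unfolding sprod_def prod_dividef[symmetric]
    proof (intro prod.cong refl)
      fix j assume "j \<in> {..<N} - {p}"
      then have "\<tau> p - \<tau> j \<noteq> 0" using \<tau>_inj[of p j] by auto
      then show "1 + - \<sigma> / (\<tau> p - \<tau> j) = (s p - \<tau> j) / (\<tau> p - \<tau> j)" by (simp add: s_def field_simps)
    qed
    show ?thesis using eq True unfolding den Qs A by simp
  qed
qed

lemma sprod_nonzero: "sprod (- \<sigma>) N p \<noteq> 0"
proof -
  have "1 + - \<sigma> / (\<tau> p - \<tau> j) \<noteq> 0" if "j \<noteq> p" for j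
    using nonres[of j p] \<tau>_inj[of p j] that by (auto simp: field_simps)
  then show ?thesis by (auto simp: sprod_def prod_zero_iff)
qed

lemma cauchy_system_limit:
  assumes a: "\<And>m. (\<lambda>N. sprod (- \<sigma>) N m) \<longlonglongrightarrow> a m"
  shows "(\<lambda>m. \<sigma> * a m * w k m) sums 1"
proof -
  obtain B where B: "B > 0" "\<And>N m. \<bar>sprod (- \<sigma>) N m\<bar> \<le> B" using sprod_bounded by blast
  obtain W :: real where W: "\<And>k. summable (\<lambda>m. \<bar>w k m\<bar>)" by (rule w_row_bounded) blast
  define f where "f = (\<lambda>N m. if m < N then \<sigma> * sprod (- \<sigma>) N m * w k m else 0)"
  have lim: "(\<lambda>N. f N m) \<longlonglongrightarrow> \<sigma> * a m * w k m" for m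
  proof (rule Lim_transform_eventually)
    show "(\<lambda>N. \<sigma> * sprod (- \<sigma>) N m * w k m) \<longlonglongrightarrow> \<sigma> * a m * w k m" by (intro tendsto_intros a)
    show "\<forall>\<^sub>F N in sequentially. \<sigma> * sprod (- \<sigma>) N m * w k m = f N m"
      using eventually_gt_at_top[of m] by eventually_elim (simp add: f_def)
  qed
  have bd: "\<bar>f N m\<bar> \<le> \<bar>\<sigma>\<bar> * B * \<bar>w k m\<bar>" for N m
    using B(1) by (auto simp: f_def abs_mult intro!: mult_right_mono mult_left_mono B(2))
  note T = tannery_sequentially[OF lim bd summable_mult[OF W]]
  have "(\<Sum>m. f N m) = 1" if "N > k" for N
  proof -
    have "(\<Sum>m. f N m) = (\<Sum>m<N. f N m)" by (intro suminf_finite) (auto simp: f_def)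
    also have "\<dots> = 1" using cauchy_system_finite[OF that] by (simp add: f_def)
    finally show ?thesis .
  qed
  then have "(\<lambda>N. \<Sum>m. f N m) \<longlonglongrightarrow> 1"
    by (intro tendsto_eventually eventually_mono[OF eventually_gt_at_top[of k]])
  then have "(\<Sum>m. \<sigma> * a m * w k m) = 1" using T(2) LIMSEQ_unique by blast
  then show ?thesis using T(1) by (simp add: sums_iff)
qed

text \<open>
  Multiply the equations with index below \<open>N\<close> by the row of the truncated inverse matrix that belongs to \<open>p\<close>, and
  add them. Among the unknowns with index below \<open>N\<close> only \<open>h p\<close> survives, with a coefficient bounded away from zero.
  The remaining unknowns contribute tails of the rows of \<open>w\<close>, which vanish in the limit.
\<close>
lemma cauchy_system_unique:
  fixes h :: "nat \<Rightarrow> complex"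
  assumes h: "\<And>m. cmod (h m) \<le> B" and z: "\<And>k. (\<lambda>m. h m * of_real (w k m)) sums 0"
  shows "h p = 0"
proof -
  have B0: "B \<ge> 0" using h[of 0] norm_ge_zero order_trans by blast
  obtain A1 where A1: "A1 > 0" "\<And>N m. \<bar>sprod (- \<sigma>) N m\<bar> \<le> A1" using sprod_bounded by blast
  obtain A2 where A2: "A2 > 0" "\<And>N m. \<bar>sprod \<sigma> N m\<bar> \<le> A2" using sprod_bounded by blast
  obtain W where W: "W > 0" "\<And>k. summable (\<lambda>m. \<bar>w k m\<bar>)" "\<And>k. (\<Sum>m. \<bar>w k m\<bar>) \<le> W"
    "\<And>m. summable (\<lambda>k. \<bar>w k m\<bar>)" by (rule w_row_bounded) blast
  \<comment> \<open>The tails of the rows; dominated convergence shows that their weighted sum vanishes.\<close>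
  define T where "T = (\<lambda>N k. \<Sum>i. \<bar>w k (i + N)\<bar>)"
  have Tsm: "summable (\<lambda>i. \<bar>w k (i + N)\<bar>)" for k N using W(2) by (rule summable_ignore_initial_segment)
  have T0: "0 \<le> T N k" for N k unfolding T_def by (intro suminf_nonneg Tsm) auto
  have TW: "T N k \<le> W" for N k
  proof -
    have "0 \<le> (\<Sum>m<N. \<bar>w k m\<bar>)" by (intro sum_nonneg) auto
    moreover have "(\<Sum>m. \<bar>w k m\<bar>) = T N k + (\<Sum>m<N. \<bar>w k m\<bar>)"
      unfolding T_def by (rule suminf_split_initial_segment[OF W(2)])
    ultimately show ?thesis using W(3)[of k] by linarith
  qed
  have Tlim: "(\<lambda>N. T N k) \<longlonglongrightarrow> 0" for k
    unfolding T_def using W(2)[of k] by (rule suminf_exist_split2)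
  define f where "f = (\<lambda>N k. if k < N then \<bar>\<sigma>\<bar> * A2 * \<bar>w k p\<bar> * (B * T N k) else 0)"
  have flim: "(\<lambda>N. f N k) \<longlonglongrightarrow> 0" for k
  proof (rule Lim_null_comparison)
    have "(\<lambda>N. \<bar>\<sigma>\<bar> * A2 * \<bar>w k p\<bar> * (B * T N k)) \<longlonglongrightarrow> \<bar>\<sigma>\<bar> * A2 * \<bar>w k p\<bar> * (B * 0)"
      by (intro tendsto_intros Tlim)
    then show "(\<lambda>N. \<bar>\<sigma>\<bar> * A2 * \<bar>w k p\<bar> * (B * T N k)) \<longlonglongrightarrow> 0" by simp
    show "\<forall>\<^sub>F N in sequentially. norm (f N k) \<le> \<bar>\<sigma>\<bar> * A2 * \<bar>w k p\<bar> * (B * T N k)"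
      using A2(1) B0 T0 by (intro always_eventually) (auto simp: f_def abs_mult)
  qed
  have fb: "\<bar>f N k\<bar> \<le> \<bar>\<sigma>\<bar> * A2 * (B * W) * \<bar>w k p\<bar>" for N k
  proof -
    have "\<bar>f N k\<bar> \<le> \<bar>\<sigma>\<bar> * A2 * \<bar>w k p\<bar> * (B * T N k)" using A2(1) B0 T0 by (auto simp: f_def abs_mult)
    also have "\<dots> \<le> \<bar>\<sigma>\<bar> * A2 * \<bar>w k p\<bar> * (B * W)" using A2(1) B0 TW by (intro mult_left_mono) auto
    finally show ?thesis by (simp add: mult_ac)
  qed
  have "(\<lambda>N. \<Sum>k. f N k) \<longlonglongrightarrow> (\<Sum>k. 0)"
    by (rule tannery_sequentially(2)[OF flim fb]) (intro summable_mult W(4))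
  then have lim: "(\<lambda>N. \<bar>\<sigma>\<bar> * A1 * (\<Sum>k. f N k)) \<longlonglongrightarrow> \<bar>\<sigma>\<bar> * A1 * 0" by (intro tendsto_intros) simp
  have bound: "cmod (h p) \<le> \<bar>\<sigma>\<bar> * A1 * (\<Sum>k. f N k)" if N: "p < N" for N
  proof -
    define c where "c = (\<lambda>k. \<sigma> * sprod \<sigma> N k * w k p)"
    have cb: "\<bar>c k\<bar> \<le> \<bar>\<sigma>\<bar> * A2 * \<bar>w k p\<bar>" for k
      unfolding c_def abs_mult by (intro mult_right_mono mult_left_mono A2(2)) auto
    define g where "g = (\<lambda>m. h m * of_real (\<Sum>k<N. c k * w k m))"
    have gs: "g sums 0"
    proof -
      have "(\<lambda>m. \<Sum>k<N. of_real (c k) * (h m * of_real (w k m))) sums (\<Sum>k<N. of_real (c k) * 0)"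
        by (intro sums_sum sums_mult z)
      then show ?thesis by (simp add: g_def sum_distrib_left mult_ac)
    qed
    have gp: "(\<Sum>m<N. g m) = h p * of_real (1 / (\<sigma> * sprod (- \<sigma>) N p))"
    proof -
      have "(\<Sum>m<N. g m) = (\<Sum>m<N. if m = p then h p * of_real (1 / (\<sigma> * sprod (- \<sigma>) N p)) else 0)"
      proof (intro sum.cong refl)
        fix m assume "m \<in> {..<N}"
        then have "(\<Sum>k<N. c k * w k m) = (if m = p then 1 / (\<sigma> * sprod (- \<sigma>) N p) else 0)"
          using cauchy_inverse_finite[OF N, of m] by (simp add: c_def)
        then show "g m = (if m = p then h p * of_real (1 / (\<sigma> * sprod (- \<sigma>) N p)) else 0)"
          by (simp only: g_def) auto
      qed
      then show ?thesis using N by simp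
    qed
    have "summable g" using gs by (simp add: sums_iff)
    from suminf_split_initial_segment[OF this, of N] gs gp
    have "h p * of_real (1 / (\<sigma> * sprod (- \<sigma>) N p)) = - (\<Sum>i. g (i + N))" by (simp add: sums_iff eq_neg_iff_add_eq_0 add.commute)
    then have "cmod (h p * of_real (1 / (\<sigma> * sprod (- \<sigma>) N p))) = cmod (\<Sum>i. g (i + N))"
      by (simp only: norm_minus_cancel)
    then have "cmod (h p) / (\<bar>\<sigma>\<bar> * \<bar>sprod (- \<sigma>) N p\<bar>) = cmod (\<Sum>i. g (i + N))"
      by (simp add: norm_mult norm_divide)
    also have "\<dots> \<le> (\<Sum>k<N. \<bar>\<sigma>\<bar> * A2 * \<bar>w k p\<bar> * (B * T N k))"
    proof -
      have sm: "summable (\<lambda>i. \<Sum>k<N. \<bar>\<sigma>\<bar> * A2 * \<bar>w k p\<bar> * (B * \<bar>w k (i + N)\<bar>))"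
        by (intro summable_sum summable_mult Tsm)
      have "cmod (g (i + N)) \<le> (\<Sum>k<N. \<bar>\<sigma>\<bar> * A2 * \<bar>w k p\<bar> * (B * \<bar>w k (i + N)\<bar>))" for i
      proof -
        have "cmod (g (i + N)) \<le> B * (\<Sum>k<N. \<bar>c k\<bar> * \<bar>w k (i + N)\<bar>)"
          unfolding g_def norm_mult norm_of_real using B0 h
          by (intro mult_mono) (auto simp: abs_mult[symmetric] intro!: sum_abs)
        also have "\<dots> \<le> B * (\<Sum>k<N. \<bar>\<sigma>\<bar> * A2 * \<bar>w k p\<bar> * \<bar>w k (i + N)\<bar>)"
          using B0 cb by (intro mult_left_mono sum_mono mult_right_mono) auto
        finally show ?thesis by (simp add: sum_distrib_left mult_ac)
      qed
      then have "cmod (\<Sum>i. g (i + N)) \<le> (\<Sum>i. \<Sum>k<N. \<bar>\<sigma>\<bar> * A2 * \<bar>w k p\<bar> * (B * \<bar>w k (i + N)\<bar>))"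
        by (rule norm_suminf_le[OF _ sm])
      also have "\<dots> = (\<Sum>k<N. \<Sum>i. \<bar>\<sigma>\<bar> * A2 * \<bar>w k p\<bar> * (B * \<bar>w k (i + N)\<bar>))"
        by (intro suminf_sum summable_mult Tsm)
      also have "\<dots> = (\<Sum>k<N. \<bar>\<sigma>\<bar> * A2 * \<bar>w k p\<bar> * (B * T N k))"
        unfolding T_def by (intro sum.cong refl) (simp add: suminf_mult Tsm summable_mult)
      finally show ?thesis .
    qed
    also have "\<dots> = (\<Sum>k. f N k)"
    proof -
      have "(\<Sum>k. f N k) = (\<Sum>k<N. f N k)" by (intro suminf_finite) (auto simp: f_def)
      then show ?thesis by (simp add: f_def)
    qed
    finally have "cmod (h p) / (\<bar>\<sigma>\<bar> * \<bar>sprod (- \<sigma>) N p\<bar>) \<le> (\<Sum>k. f N k)" .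
    then have *: "cmod (h p) \<le> (\<bar>\<sigma>\<bar> * \<bar>sprod (- \<sigma>) N p\<bar>) * (\<Sum>k. f N k)"
      using \<sigma> sprod_nonzero[of N p] by (simp add: pos_divide_le_eq mult.commute)
    have "0 \<le> cmod (h p) / (\<bar>\<sigma>\<bar> * \<bar>sprod (- \<sigma>) N p\<bar>)" by simp
    also have "\<dots> \<le> (\<Sum>k. f N k)" by fact
    finally have "0 \<le> (\<Sum>k. f N k)" .
    then have "(\<bar>\<sigma>\<bar> * \<bar>sprod (- \<sigma>) N p\<bar>) * (\<Sum>k. f N k) \<le> (\<bar>\<sigma>\<bar> * A1) * (\<Sum>k. f N k)"
      by (intro mult_right_mono mult_left_mono A1(2)) auto
    with * show ?thesis by simp
  qed
  have "cmod (h p) \<le> \<bar>\<sigma>\<bar> * A1 * 0"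
    by (rule tendsto_lowerbound[OF lim eventually_mono[OF eventually_gt_at_top[of p] bound]]) auto
  then show ?thesis by simp
qed

text \<open>
  Whether or not \<open>n < N\<close>, the defect in row \<open>n\<close> is, up to sign, a sum over indices other than \<open>n\<close>: the tail
  of the convergent series in the first case, a partial sum in the second. So it is dominated by a multiple of
  \<open>spread n\<close>, whose squares are summable.
\<close>
lemma cauchy_defect_tendsto_0:
  fixes b :: "nat \<Rightarrow> real"
  assumes b: "\<And>m. \<bar>b m\<bar> \<le> B" and s: "\<And>n. (\<lambda>m. b m * w n m) sums 1"
  defines "e \<equiv> \<lambda>N n. ((if n < N then 1 else 0) - (\<Sum>m<N. b m * w n m))\<^sup>2"
  shows "summable (e N)" "(\<lambda>N. \<Sum>n. e N n) \<longlonglongrightarrow> 0"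
proof -
  have B0: "B \<ge> 0" using b[of 0] by linarith
  obtain C where C: "C > 0" "\<And>N k. (\<Sum>m\<in>{..<N} - {k}. \<bar>w k m\<bar>) \<le> C * spread k" by (rule w_sums_le) blast
  define M where "M = (\<lambda>n. (B * C)\<^sup>2 * (spread n)\<^sup>2)"
  have bd: "\<bar>e N n\<bar> \<le> M n" for N n
  proof -
    have part: "\<bar>\<Sum>m\<in>J. b m * w n m\<bar> \<le> B * C * spread n" if "finite J" "n \<notin> J" for J :: "nat set"
    proof -
      obtain L where L: "J \<subseteq> {..<L}" using finite_nat_bounded[OF \<open>finite J\<close>] by blast
      have "\<bar>\<Sum>m\<in>J. b m * w n m\<bar> \<le> (\<Sum>m\<in>J. \<bar>b m * w n m\<bar>)" by (rule sum_abs)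
      also have "\<dots> \<le> (\<Sum>m\<in>{..<L} - {n}. \<bar>b m * w n m\<bar>)" using L that(2) by (intro sum_mono2) auto
      also have "\<dots> \<le> (\<Sum>m\<in>{..<L} - {n}. B * \<bar>w n m\<bar>)"
        unfolding abs_mult using b by (intro sum_mono mult_right_mono) auto
      also have "\<dots> \<le> B * (C * spread n)"
        unfolding sum_distrib_left[symmetric] using B0 C(2) by (intro mult_left_mono) auto
      finally show ?thesis by simp
    qed
    have "\<bar>(if n < N then 1 else 0) - (\<Sum>m<N. b m * w n m)\<bar> \<le> B * C * spread n"
    proof (cases "n < N")
      case False
      then show ?thesis using part[of "{..<N}"] by simp
    next
      case True
      have lim: "(\<lambda>L. \<Sum>m<L. b m * w n m) \<longlonglongrightarrow> 1" using s[of n] by (simp add: sums_def)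
      then have "(\<lambda>L. \<bar>(\<Sum>m<L. b m * w n m) - (\<Sum>m<N. b m * w n m)\<bar>) \<longlonglongrightarrow> \<bar>1 - (\<Sum>m<N. b m * w n m)\<bar>"
        by (intro tendsto_intros)
      moreover have "\<forall>\<^sub>F L in sequentially. \<bar>(\<Sum>m<L. b m * w n m) - (\<Sum>m<N. b m * w n m)\<bar> \<le> B * C * spread n"
        using eventually_ge_at_top[of N]
      proof eventually_elim
        case (elim L)
        have "(\<Sum>m<L. b m * w n m) - (\<Sum>m<N. b m * w n m) = (\<Sum>m\<in>{..<L} - {..<N}. b m * w n m)"
          using elim by (intro sum_diff[symmetric]) auto
        then show ?case using part[of "{..<L} - {..<N}"] True by simp
      qed
      ultimately have "\<bar>1 - (\<Sum>m<N. b m * w n m)\<bar> \<le> B * C * spread n" by (rule tendsto_upperbound) simp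
      then show ?thesis using True by simp
    qed
    then have "\<bar>(if n < N then 1 else 0) - (\<Sum>m<N. b m * w n m)\<bar>\<^sup>2 \<le> (B * C * spread n)\<^sup>2"
      by (intro power_mono) auto
    then show ?thesis by (simp add: e_def M_def power_mult_distrib)
  qed
  have M: "summable M" unfolding M_def by (intro summable_mult summable_spread_sq)
  show "summable (e N)" by (rule summable_comparison_test'[OF M]) (use bd in auto)
  have "(\<lambda>N. e N n) \<longlonglongrightarrow> 0" for n
  proof -
    have "(\<lambda>N. (1 - (\<Sum>m<N. b m * w n m))\<^sup>2) \<longlonglongrightarrow> (1 - 1)\<^sup>2"
      using s[of n] by (intro tendsto_intros) (simp add: sums_def)
    then have "(\<lambda>N. (1 - (\<Sum>m<N. b m * w n m))\<^sup>2) \<longlonglongrightarrow> 0" by simp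
    then show ?thesis
      by (rule Lim_transform_eventually) (rule eventually_mono[OF eventually_gt_at_top[of n]], simp add: e_def)
  qed
  from tannery_sequentially(2)[OF this bd M] show "(\<lambda>N. \<Sum>n. e N n) \<longlonglongrightarrow> 0" by simp
qed

text \<open>
  The expression is the square norm of \<open>\<psi>\<^sub>n\<close> when \<open>\<tau>\<close> is the sequence of zeros. Both \<open>1 - a n\<close> and the
  sum over \<open>k\<close> are controlled by \<open>spread n\<close>.
\<close>
lemma cauchy_energy_summable:
  fixes a E :: "nat \<Rightarrow> real"
  assumes a: "\<And>m. (\<lambda>N. sprod (- \<sigma>) N m) \<longlonglongrightarrow> a m"
    and E: "\<And>n. (\<lambda>N. (1 - a n)\<^sup>2 + (\<sigma> * a n)\<^sup>2 * (\<Sum>k\<in>{..<N} - {n}. \<tau> k / \<tau> n * (w k n)\<^sup>2)) \<longlonglongrightarrow> E n"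
  shows "summable E"
proof -
  obtain B where B: "B > 0" "\<And>N m. \<bar>sprod (- \<sigma>) N m\<bar> \<le> B" using sprod_bounded by blast
  have aB: "\<bar>a n\<bar> \<le> B" for n
    by (rule tendsto_upperbound[OF tendsto_rabs[OF a]]) (use B in auto)
  obtain C where C: "C > 0" "\<And>N n. (\<Sum>k\<in>{..<N} - {n}. \<tau> k / \<tau> n * (w k n)\<^sup>2) \<le> C * ((spread n)\<^sup>2 + (1 / \<tau> n)\<^sup>2)"
    by (rule w_sums_le) blast
  define D where "D = \<bar>\<sigma>\<bar> * exp (\<bar>\<sigma>\<bar> * spread 0)"
  have aD: "\<bar>a n - 1\<bar> \<le> D * spread n" for n
    by (rule tendsto_upperbound[of "\<lambda>N. \<bar>sprod (- \<sigma>) N n - 1\<bar>"])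
       (use sprod_minus_1_le[of "- \<sigma>"] in \<open>auto simp: D_def intro!: tendsto_intros a\<close>)
  define M where "M = (\<lambda>n. D\<^sup>2 * (spread n)\<^sup>2 + (\<sigma> * B)\<^sup>2 * (C * ((spread n)\<^sup>2 + (1 / \<tau> n)\<^sup>2)))"
  have le: "(1 - a n)\<^sup>2 + (\<sigma> * a n)\<^sup>2 * (\<Sum>k\<in>{..<N} - {n}. \<tau> k / \<tau> n * (w k n)\<^sup>2) \<le> M n" for n N
    unfolding M_def
  proof (intro add_mono mult_mono C(2))
    have "\<bar>a n - 1\<bar>\<^sup>2 \<le> (D * spread n)\<^sup>2" by (intro power_mono aD) auto
    then show "(1 - a n)\<^sup>2 \<le> D\<^sup>2 * (spread n)\<^sup>2" by (simp add: power_mult_distrib power2_commute)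
    have "\<bar>\<sigma> * a n\<bar>\<^sup>2 \<le> \<bar>\<sigma> * B\<bar>\<^sup>2" unfolding abs_mult using aB[of n] B(1) by (intro power_mono mult_left_mono) auto
    then show "(\<sigma> * a n)\<^sup>2 \<le> (\<sigma> * B)\<^sup>2" by simp
    show "0 \<le> (\<Sum>k\<in>{..<N} - {n}. \<tau> k / \<tau> n * (w k n)\<^sup>2)"
      by (intro sum_nonneg mult_nonneg_nonneg divide_nonneg_nonneg) (use \<tau>_pos in \<open>auto intro: less_imp_le\<close>)
  qed simp
  have nn: "0 \<le> (1 - a n)\<^sup>2 + (\<sigma> * a n)\<^sup>2 * (\<Sum>k\<in>{..<N} - {n}. \<tau> k / \<tau> n * (w k n)\<^sup>2)" for n N
    by (intro add_nonneg_nonneg mult_nonneg_nonneg sum_nonneg divide_nonneg_nonneg) (use \<tau>_pos in \<open>auto intro: less_imp_le\<close>)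
  have "summable M" unfolding M_def by (intro summable_add summable_mult summable_spread_sq summable_inverse_\<tau>_sq)
  then show ?thesis
  proof (rule summable_comparison_test')
    fix n
    have "E n \<le> M n" by (rule tendsto_upperbound[OF E]) (use le in auto)
    moreover have "0 \<le> E n" by (rule tendsto_lowerbound[OF E]) (use nn in auto)
    ultimately show "norm (E n) \<le> M n" by simp
  qed
qed

end

section \<open>Series of orthonormal products\<close>

text \<open>
  Completeness of the space of square integrable functions, for functions supported in a set of finite measure.
  A subsequence with summable consecutive distances converges almost everywhere, and Fatou's lemma transfers the
  distance estimates to its limit.
\<close>
lemma L2_limit:
  fixes P :: "nat \<Rightarrow> 'a \<Rightarrow> complex" and T :: "nat \<Rightarrow> real"
  assumes P [measurable]: "\<And>N. P N \<in> borel_measurable M" and S [measurable]: "S \<in> sets M"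
    and fin: "emeasure M S < \<infinity>" and supp: "\<And>N x. x \<notin> S \<Longrightarrow> P N x = 0"
    and T: "T \<longlonglongrightarrow> 0"
    and cauchy: "\<And>K N. K \<le> N \<Longrightarrow> (\<integral>\<^sup>+x. ennreal ((cmod (P N x - P K x))\<^sup>2) \<partial>M) \<le> ennreal (T K)"
  obtains k where "k \<in> borel_measurable M" "\<And>x. x \<notin> S \<Longrightarrow> k x = 0"
    "\<And>K. (\<integral>\<^sup>+x. ennreal ((cmod (P K x - k x))\<^sup>2) \<partial>M) \<le> ennreal (T K)"
proof -
  have small: "\<exists>N0. \<forall>n\<ge>N0. T n < 1 / 4 ^ i" for i :: nat
  proof -
    have "\<forall>\<^sub>F n in sequentially. T n < 1 / 4 ^ i" by (rule order_tendstoD(2)[OF T]) simp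
    then show ?thesis by (simp add: eventually_sequentially)
  qed
  have "\<exists>r :: nat \<Rightarrow> nat. \<forall>i. T (r i) < 1 / 4 ^ i \<and> r i < r (Suc i)"
  proof (rule dependent_nat_choice)
    show "\<exists>n. T n < 1 / 4 ^ 0" using small[of 0] by blast
  next
    fix m i :: nat
    obtain N0 where "\<forall>n\<ge>N0. T n < 1 / 4 ^ Suc i" using small by blast
    then show "\<exists>n. T n < 1 / 4 ^ Suc i \<and> m < n" by (intro exI[of _ "max N0 (Suc m)"]) auto
  qed
  then obtain r :: "nat \<Rightarrow> nat" where r: "\<And>i. T (r i) < 1 / 4 ^ i" "\<And>i. r i < r (Suc i)" by blast
  have mono: "strict_mono r" using r(2) by (simp add: strict_mono_Suc_iff)
  define d where "d = (\<lambda>i x. cmod (P (r (Suc i)) x - P (r i) x))"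
  have d_meas [measurable]: "d i \<in> borel_measurable M" for i unfolding d_def by measurable
  \<comment> \<open>On a set of finite measure the arithmetic-geometric mean inequality controls the first moment.\<close>
  have d1: "(\<integral>\<^sup>+x. ennreal (d i x) \<partial>M) \<le> ennreal ((1 / 2) ^ i) * (1 + emeasure M S)" for i
  proof -
    have "(\<integral>\<^sup>+x. ennreal (d i x) \<partial>M) \<le> (\<integral>\<^sup>+x. ennreal (2 ^ i) * ennreal ((d i x)\<^sup>2) + ennreal ((1 / 2) ^ i) * indicator S x \<partial>M)"
    proof (intro nn_integral_mono)
      fix x
      show "ennreal (d i x) \<le> ennreal (2 ^ i) * ennreal ((d i x)\<^sup>2) + ennreal ((1 / 2) ^ i) * indicator S x"
      proof (cases "x \<in> S")
        case True
        have "d i x \<le> 2 ^ i * (d i x)\<^sup>2 + (1 / 2) ^ i"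
        proof -
          have "0 \<le> (1 / 2) ^ i * (2 ^ i * d i x - 1)\<^sup>2 + d i x" by (simp add: d_def)
          also have "\<dots> = ((1 / 2) ^ i * 2 ^ i) * (2 ^ i * (d i x)\<^sup>2) - 2 * ((1 / 2) ^ i * 2 ^ i) * d i x + (1 / 2) ^ i + d i x"
            by (simp add: power2_eq_square algebra_simps)
          also have "(1 / 2) ^ i * 2 ^ i = (1 :: real)" by (simp flip: power_mult_distrib)
          finally show ?thesis by simp
        qed
        then have "ennreal (d i x) \<le> ennreal (2 ^ i * (d i x)\<^sup>2 + (1 / 2) ^ i)" by (rule ennreal_leI)
        also have "\<dots> = ennreal (2 ^ i) * ennreal ((d i x)\<^sup>2) + ennreal ((1 / 2) ^ i)"
          by (subst ennreal_plus) (auto simp: ennreal_mult)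
        finally show ?thesis using True by simp
      next
        case False
        then show ?thesis by (simp add: d_def supp)
      qed
    qed
    also have "\<dots> = ennreal (2 ^ i) * (\<integral>\<^sup>+x. ennreal ((d i x)\<^sup>2) \<partial>M) + ennreal ((1 / 2) ^ i) * emeasure M S"
      by (subst nn_integral_add) (auto simp: nn_integral_cmult)
    also have "\<dots> \<le> ennreal (2 ^ i) * ennreal (1 / 4 ^ i) + ennreal ((1 / 2) ^ i) * emeasure M S"
    proof (intro add_mono mult_left_mono order_refl)
      have "(\<integral>\<^sup>+x. ennreal ((d i x)\<^sup>2) \<partial>M) \<le> ennreal (T (r i))"
        unfolding d_def using r(2)[of i] by (intro cauchy) simp
      also have "\<dots> \<le> ennreal (1 / 4 ^ i)" using r(1)[of i] by (intro ennreal_leI) simp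
      finally show "(\<integral>\<^sup>+x. ennreal ((d i x)\<^sup>2) \<partial>M) \<le> ennreal (1 / 4 ^ i)" .
    qed simp_all
    also have "ennreal (2 ^ i) * ennreal (1 / 4 ^ i) = ennreal ((1 / 2) ^ i)"
      by (simp add: ennreal_mult[symmetric] field_simps flip: power_mult_distrib)
    finally show ?thesis by (simp add: distrib_left)
  qed
  have "(\<integral>\<^sup>+x. (\<Sum>i. ennreal (d i x)) \<partial>M) = (\<Sum>i. \<integral>\<^sup>+x. ennreal (d i x) \<partial>M)"
    by (rule nn_integral_suminf) simp
  also have "\<dots> \<le> (\<Sum>i. ennreal ((1 / 2) ^ i) * (1 + emeasure M S))" by (intro suminf_le d1) auto
  also have "\<dots> = (\<Sum>i. ennreal ((1 / 2) ^ i)) * (1 + emeasure M S)" by simp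
  also have "(\<Sum>i. ennreal ((1 / 2) ^ i)) = ennreal (\<Sum>i. (1 / 2) ^ i)"
    by (intro suminf_ennreal2 summable_geometric) auto
  also have "ennreal (\<Sum>i. (1 / 2) ^ i) * (1 + emeasure M S) < \<infinity>"
    using fin by (simp add: ennreal_mult_less_top)
  finally have "(\<integral>\<^sup>+x. (\<Sum>i. ennreal (d i x)) \<partial>M) \<noteq> \<infinity>" by simp
  then have "AE x in M. (\<Sum>i. ennreal (d i x)) \<noteq> \<infinity>" by (intro nn_integral_PInf_AE) auto
  then have conv: "AE x in M. convergent (\<lambda>i. P (r i) x)"
  proof eventually_elim
    case (elim x)
    then have "summable (\<lambda>i. d i x)" by (intro summable_suminf_not_top) (auto simp: d_def)
    then have "summable (\<lambda>i. P (r (Suc i)) x - P (r i) x)" unfolding d_def by (rule summable_norm_cancel)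
    then have "convergent (\<lambda>n. \<Sum>i<n. P (r (Suc i)) x - P (r i) x)" by (simp add: summable_iff_convergent)
    then have "convergent (\<lambda>n. P (r n) x - P (r 0) x)" by (simp only: sum_lessThan_telescope[of "\<lambda>i. P (r i) x"])
    then show "convergent (\<lambda>i. P (r i) x)" by (simp add: convergent_diff_const_right_iff)
  qed
  define k where "k = (\<lambda>x. lim (\<lambda>i. P (r i) x))"
  have k [measurable]: "k \<in> borel_measurable M" unfolding k_def by measurable
  have k0: "k x = 0" if "x \<notin> S" for x using that by (simp add: k_def supp)
  have "(\<integral>\<^sup>+x. ennreal ((cmod (P K x - k x))\<^sup>2) \<partial>M) \<le> ennreal (T K)" for K
  proof -
    have "(\<integral>\<^sup>+x. ennreal ((cmod (P K x - k x))\<^sup>2) \<partial>M)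
        \<le> (\<integral>\<^sup>+x. liminf (\<lambda>i. ennreal ((cmod (P (r i) x - P K x))\<^sup>2)) \<partial>M)"
    proof (rule nn_integral_mono_AE)
      show "AE x in M. ennreal ((cmod (P K x - k x))\<^sup>2) \<le> liminf (\<lambda>i. ennreal ((cmod (P (r i) x - P K x))\<^sup>2))"
        using conv
      proof eventually_elim
        case (elim x)
        then have "(\<lambda>i. P (r i) x) \<longlonglongrightarrow> k x" by (simp add: k_def convergent_LIMSEQ_iff)
        then have "(\<lambda>i. ennreal ((cmod (P (r i) x - P K x))\<^sup>2)) \<longlonglongrightarrow> ennreal ((cmod (k x - P K x))\<^sup>2)"
          by (intro tendsto_intros)
        then have "liminf (\<lambda>i. ennreal ((cmod (P (r i) x - P K x))\<^sup>2)) = ennreal ((cmod (k x - P K x))\<^sup>2)"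
          by (intro lim_imp_Liminf) auto
        then show ?case by (simp add: norm_minus_commute)
      qed
    qed
    also have "\<dots> \<le> liminf (\<lambda>i. \<integral>\<^sup>+x. ennreal ((cmod (P (r i) x - P K x))\<^sup>2) \<partial>M)"
      by (rule nn_integral_liminf) measurable
    also have "\<dots> \<le> ennreal (T K)"
    proof -
      have "\<forall>\<^sub>F i in sequentially. (\<integral>\<^sup>+x. ennreal ((cmod (P (r i) x - P K x))\<^sup>2) \<partial>M) \<le> ennreal (T K)"
        using eventually_ge_at_top[of K]
        by eventually_elim (use seq_suble[OF mono] in \<open>auto intro!: cauchy intro: order_trans\<close>)
      then have "liminf (\<lambda>i. \<integral>\<^sup>+x. ennreal ((cmod (P (r i) x - P K x))\<^sup>2) \<partial>M) \<le> liminf (\<lambda>i::nat. ennreal (T K))"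
        by (rule Liminf_mono)
      then show ?thesis by (simp add: Liminf_const)
    qed
    finally show ?thesis .
  qed
  with k k0 show thesis by (intro that[of k])
qed

lemma nn_integral_orthonormal_sum:
  fixes g :: "nat \<Rightarrow> 'a \<Rightarrow> complex" and a :: "nat \<Rightarrow> complex"
  assumes I: "finite I"
    and int: "\<And>n m. n \<in> I \<Longrightarrow> m \<in> I \<Longrightarrow> integrable M (\<lambda>y. g n y * cnj (g m y))"
    and orth: "\<And>n m. n \<in> I \<Longrightarrow> m \<in> I \<Longrightarrow> (LINT y|M. g n y * cnj (g m y)) = (if n = m then 1 else 0)"
  shows "(\<integral>\<^sup>+y. ennreal ((cmod (\<Sum>n\<in>I. a n * g n y))\<^sup>2) \<partial>M) = ennreal (\<Sum>n\<in>I. (cmod (a n))\<^sup>2)"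
proof -
  have eq: "complex_of_real ((cmod (\<Sum>n\<in>I. a n * g n y))\<^sup>2) = (\<Sum>n\<in>I. \<Sum>m\<in>I. a n * cnj (a m) * (g n y * cnj (g m y)))" for y
    unfolding complex_norm_square cnj_sum sum_product by (simp add: mult_ac)
  have intC: "integrable M (\<lambda>y. complex_of_real ((cmod (\<Sum>n\<in>I. a n * g n y))\<^sup>2))"
    unfolding eq by (intro Bochner_Integration.integrable_sum integrable_mult_right int)
  then have intR: "integrable M (\<lambda>y. (cmod (\<Sum>n\<in>I. a n * g n y))\<^sup>2)"
    by (simp only: complex_of_real_integrable_eq)
  have "complex_of_real (LINT y|M. (cmod (\<Sum>n\<in>I. a n * g n y))\<^sup>2) = (LINT y|M. complex_of_real ((cmod (\<Sum>n\<in>I. a n * g n y))\<^sup>2))"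
    by (rule integral_complex_of_real[symmetric])
  also have "\<dots> = (\<Sum>n\<in>I. \<Sum>m\<in>I. a n * cnj (a m) * (LINT y|M. g n y * cnj (g m y)))"
    unfolding eq by (simp add: Bochner_Integration.integral_sum int)
  also have "\<dots> = (\<Sum>n\<in>I. \<Sum>m\<in>I. if m = n then of_real ((cmod (a n))\<^sup>2) else 0)"
    by (intro sum.cong refl) (auto simp: orth complex_norm_square simp del: of_real_power)
  also have "\<dots> = complex_of_real (\<Sum>n\<in>I. (cmod (a n))\<^sup>2)" using I by simp
  finally have "(LINT y|M. (cmod (\<Sum>n\<in>I. a n * g n y))\<^sup>2) = (\<Sum>n\<in>I. (cmod (a n))\<^sup>2)"
    by (simp only: of_real_eq_iff)
  then show ?thesis using nn_integral_eq_integral[OF intR] by simp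
qed

lemma Ltwo_iff_nn_integral:
  fixes f :: "'a::euclidean_space \<Rightarrow> complex"
  assumes "set_borel_measurable lborel S f"
  shows "f \<in> Ltwo S \<longleftrightarrow> (\<integral>\<^sup>+x. ennreal ((cmod (indicator S x *\<^sub>R f x))\<^sup>2) \<partial>lborel) < \<infinity>" (is "?L \<longleftrightarrow> ?R")
    and "f \<in> Ltwo S \<Longrightarrow> (\<integral>\<^sup>+x. ennreal ((cmod (indicator S x *\<^sub>R f x))\<^sup>2) \<partial>lborel) = ennreal ((Ltwo_norm S f)\<^sup>2)"
proof -
  have meas [measurable]: "(\<lambda>x. indicator S x *\<^sub>R f x) \<in> borel_measurable lborel"
    using assms by (simp add: set_borel_measurable_def)
  have eq: "indicator S x *\<^sub>R (cmod (f x))\<^sup>2 = (cmod (indicator S x *\<^sub>R f x))\<^sup>2" for x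
    by (simp add: indicator_def)
  have "set_integrable lborel S (\<lambda>x. (cmod (f x))\<^sup>2) \<longleftrightarrow> integrable lborel (\<lambda>x. (cmod (indicator S x *\<^sub>R f x))\<^sup>2)"
    unfolding set_integrable_def eq ..
  also have "\<dots> \<longleftrightarrow> ?R"
  proof -
    have "(\<lambda>x. (cmod (indicator S x *\<^sub>R f x))\<^sup>2) \<in> borel_measurable lborel" by measurable
    then show ?thesis by (simp add: integrable_iff_bounded del: norm_scaleR)
  qed
  finally show "?L \<longleftrightarrow> ?R" using assms by (simp add: Ltwo_def)
  assume "f \<in> Ltwo S"
  then have "set_integrable lborel S (\<lambda>x. (cmod (f x))\<^sup>2)" by (simp add: Ltwo_def)
  then have int: "integrable lborel (\<lambda>x. (cmod (indicator S x *\<^sub>R f x))\<^sup>2)"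
    unfolding set_integrable_def eq .
  have "0 \<le> (LINT x|lborel. (cmod (indicator S x *\<^sub>R f x))\<^sup>2)" by (rule Bochner_Integration.integral_nonneg) (rule zero_le_power2)
  then have "(Ltwo_norm S f)\<^sup>2 = (LINT x|lborel. (cmod (indicator S x *\<^sub>R f x))\<^sup>2)"
    unfolding Ltwo_norm_def set_lebesgue_integral_def eq by (rule real_sqrt_pow2)
  then show "(\<integral>\<^sup>+x. ennreal ((cmod (indicator S x *\<^sub>R f x))\<^sup>2) \<partial>lborel) = ennreal ((Ltwo_norm S f)\<^sup>2)"
    using nn_integral_eq_integral[OF int] by (simp only: zero_le_power2 AE_I2 simp_thms)
qed

text \<open>
  Integrating first over the second variable, orthonormality of \<open>g\<close> turns the square norm of a block
  \<open>\<Sum>n. f\<^sub>n(x) g\<^sub>n(y)\<close> into the sum of the square norms of the \<open>f\<^sub>n\<close>.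
\<close>
theorem Ltwo_sums_orthonormal_products:
  fixes f g :: "nat \<Rightarrow> real \<Rightarrow> complex"
  assumes S [measurable]: "S \<in> sets lborel" and fin: "emeasure lborel S < \<infinity>"
    and f: "\<And>n. n \<ge> 1 \<Longrightarrow> f n \<in> Ltwo S"
    and g: "\<And>n. n \<ge> 1 \<Longrightarrow> set_borel_measurable lborel S (g n)"
    and int: "\<And>n m. n \<ge> 1 \<Longrightarrow> m \<ge> 1 \<Longrightarrow> set_integrable lborel S (\<lambda>y. g n y * cnj (g m y))"
    and orth: "\<And>n m. n \<ge> 1 \<Longrightarrow> m \<ge> 1 \<Longrightarrow> (LINT y:S|lborel. g n y * cnj (g m y)) = (if n = m then 1 else 0)"
    and sm: "summable (\<lambda>n. (Ltwo_norm S (f (Suc n)))\<^sup>2)"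
  shows "\<exists>k. Ltwo_sums (S \<times> S) (\<lambda>n (x, y). f n x * g n y) k"
proof -
  define f' where "f' = (\<lambda>n x. indicator S x *\<^sub>R f n x)"
  define g' where "g' = (\<lambda>n y. indicator S y *\<^sub>R g n y)"
  have f'm [measurable]: "f' n \<in> borel_measurable borel" if "n \<ge> 1" for n
    using f[OF that] by (simp add: f'_def Ltwo_def set_borel_measurable_def)
  have g'm [measurable]: "g' n \<in> borel_measurable borel" if "n \<ge> 1" for n
    using g[OF that] by (simp add: g'_def set_borel_measurable_def)
  have gg: "indicator S y *\<^sub>R (g n y * cnj (g m y)) = g' n y * cnj (g' m y)" for n m y
    by (simp add: g'_def indicator_def)
  have energy: "(\<integral>\<^sup>+z. ennreal ((cmod (\<Sum>n\<in>I. f' n (fst z) * g' n (snd z)))\<^sup>2) \<partial>lborel)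
       = ennreal (\<Sum>n\<in>I. (Ltwo_norm S (f n))\<^sup>2)" if I: "finite I" "\<And>n. n \<in> I \<Longrightarrow> n \<ge> 1" for I
  proof -
    have meas: "(\<lambda>z. ennreal ((cmod (\<Sum>n\<in>I. f' n (fst z) * g' n (snd z)))\<^sup>2)) \<in> borel_measurable (lborel \<Otimes>\<^sub>M lborel)"
      using I(2) by measurable
    have "(\<integral>\<^sup>+z. ennreal ((cmod (\<Sum>n\<in>I. f' n (fst z) * g' n (snd z)))\<^sup>2) \<partial>lborel)
      = (\<integral>\<^sup>+x. \<integral>\<^sup>+y. ennreal ((cmod (\<Sum>n\<in>I. f' n x * g' n y))\<^sup>2) \<partial>lborel \<partial>lborel)"
      unfolding lborel_prod[symmetric] using lborel.nn_integral_fst[OF meas] by simp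
    also have "\<dots> = (\<integral>\<^sup>+x. ennreal (\<Sum>n\<in>I. (cmod (f' n x))\<^sup>2) \<partial>lborel)"
    proof (intro nn_integral_cong nn_integral_orthonormal_sum I(1))
      fix n m assume "n \<in> I" "m \<in> I"
      then have nm: "n \<ge> 1" "m \<ge> 1" using I(2) by auto
      show "integrable lborel (\<lambda>y. g' n y * cnj (g' m y))"
        using int[OF nm] unfolding set_integrable_def gg .
      show "(LINT y|lborel. g' n y * cnj (g' m y)) = (if n = m then 1 else 0)"
        using orth[OF nm] unfolding set_lebesgue_integral_def gg .
    qed
    also have "\<dots> = (\<Sum>n\<in>I. \<integral>\<^sup>+x. ennreal ((cmod (f' n x))\<^sup>2) \<partial>lborel)"
    proof -
      have "ennreal (\<Sum>n\<in>I. (cmod (f' n x))\<^sup>2) = (\<Sum>n\<in>I. ennreal ((cmod (f' n x))\<^sup>2))" for x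
        by (rule sum_ennreal[symmetric]) simp
      moreover have "(\<integral>\<^sup>+x. (\<Sum>n\<in>I. ennreal ((cmod (f' n x))\<^sup>2)) \<partial>lborel) = (\<Sum>n\<in>I. \<integral>\<^sup>+x. ennreal ((cmod (f' n x))\<^sup>2) \<partial>lborel)"
        using I(2) by (intro nn_integral_sum) measurable
      ultimately show ?thesis by simp
    qed
    also have "\<dots> = (\<Sum>n\<in>I. ennreal ((Ltwo_norm S (f n))\<^sup>2))"
    proof (intro sum.cong refl)
      fix n assume "n \<in> I"
      then have "f n \<in> Ltwo S" using I(2) f by auto
      then show "(\<integral>\<^sup>+x. ennreal ((cmod (f' n x))\<^sup>2) \<partial>lborel) = ennreal ((Ltwo_norm S (f n))\<^sup>2)"
        unfolding f'_def by (intro Ltwo_iff_nn_integral(2)) (simp_all add: Ltwo_def)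
    qed
    finally show ?thesis by (simp add: sum_ennreal)
  qed
  define P where "P = (\<lambda>N z. \<Sum>n=1..N. f' n (fst z) * g' n (snd z))"
  have Pm: "P N \<in> borel_measurable (lborel :: (real \<times> real) measure)" for N
    unfolding P_def by (simp add: borel_prod[symmetric]) measurable
  define T where "T = (\<lambda>K. \<Sum>i. (Ltwo_norm S (f (Suc (i + K))))\<^sup>2)"
  have T: "T \<longlonglongrightarrow> 0" unfolding T_def using suminf_exist_split2[OF sm] by simp
  have SS [measurable]: "S \<times> S \<in> sets lborel"
    using S by (simp add: borel_prod[symmetric])
  have finS: "emeasure lborel (S \<times> S) < \<infinity>"
    using fin S by (simp add: lborel_prod[symmetric] lborel.emeasure_pair_measure_Times ennreal_mult_less_top)
  have Psupp: "P N z = 0" if "z \<notin> S \<times> S" for N z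
    using that by (cases z) (auto simp: P_def f'_def g'_def indicator_def intro!: sum.neutral)
  have cauchy: "(\<integral>\<^sup>+z. ennreal ((cmod (P N z - P K z))\<^sup>2) \<partial>lborel) \<le> ennreal (T K)" if "K \<le> N" for K N
  proof -
    have "P N z - P K z = (\<Sum>n\<in>{Suc K..N}. f' n (fst z) * g' n (snd z))" for z
    proof -
      have "{1..N} = {1..K} \<union> {Suc K..N}" using that by auto
      then have "P N z = P K z + (\<Sum>n\<in>{Suc K..N}. f' n (fst z) * g' n (snd z))"
        unfolding P_def by (simp only:) (rule sum.union_disjoint, auto)
      then show ?thesis by simp
    qed
    then have "(\<integral>\<^sup>+z. ennreal ((cmod (P N z - P K z))\<^sup>2) \<partial>lborel) = ennreal (\<Sum>n\<in>{Suc K..N}. (Ltwo_norm S (f n))\<^sup>2)"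
      using energy[of "{Suc K..N}"] by simp
    also have "(\<Sum>n\<in>{Suc K..N}. (Ltwo_norm S (f n))\<^sup>2) = (\<Sum>i<N - K. (Ltwo_norm S (f (Suc (i + K))))\<^sup>2)"
      by (rule sum.reindex_bij_witness[of _ "\<lambda>i. Suc (i + K)" "\<lambda>n. n - Suc K"]) auto
    also have "\<dots> \<le> T K"
      unfolding T_def using sm by (intro sum_le_suminf summable_ignore_initial_segment[of "\<lambda>n. (Ltwo_norm S (f (Suc n)))\<^sup>2", unfolded add_Suc]) auto
    finally show ?thesis by (simp add: ennreal_leI)
  qed
  obtain k where k: "k \<in> borel_measurable (lborel :: (real \<times> real) measure)" "\<And>z. z \<notin> S \<times> S \<Longrightarrow> k z = 0"
    "\<And>K. (\<integral>\<^sup>+z. ennreal ((cmod (P K z - k z))\<^sup>2) \<partial>lborel) \<le> ennreal (T K)"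
    by (rule L2_limit[OF Pm SS finS Psupp T cauchy]) blast+
  have T0: "T K \<ge> 0" for K unfolding T_def using sm
    by (intro suminf_nonneg summable_ignore_initial_segment[of "\<lambda>n. (Ltwo_norm S (f (Suc n)))\<^sup>2", unfolded add_Suc]) auto
  define F where "F = (\<lambda>n (x, y). f n x * g n y)"
  have Fi: "indicator (S \<times> S) z *\<^sub>R F n z = f' n (fst z) * g' n (snd z)" for n z
    by (cases z) (auto simp: F_def f'_def g'_def indicator_times indicator_def)
  have FL: "F n \<in> Ltwo (S \<times> S)" if n: "n \<ge> 1" for n
  proof -
    have "set_borel_measurable lborel (S \<times> S) (F n)"
      unfolding set_borel_measurable_def Fi using n by (simp add: borel_prod[symmetric])
    from Ltwo_iff_nn_integral(1)[OF this] show ?thesis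
      unfolding Fi using energy[of "{n}"] n by simp
  qed
  have ki: "indicator (S \<times> S) z *\<^sub>R k z = k z" for z using k(2)[of z] by (simp add: indicator_def)
  have kL: "k \<in> Ltwo (S \<times> S)"
  proof -
    have "set_borel_measurable lborel (S \<times> S) k" unfolding set_borel_measurable_def ki by (rule k(1))
    from Ltwo_iff_nn_integral(1)[OF this] show ?thesis
      unfolding ki using k(3)[of 0] by (simp add: P_def le_less_trans)
  qed
  have nrm: "Ltwo_norm (S \<times> S) (\<lambda>z. (\<Sum>n=1..N. F n z) - k z) \<le> sqrt (T N)" for N
  proof -
    have i: "indicator (S \<times> S) z *\<^sub>R ((\<Sum>n=1..N. F n z) - k z) = P N z - k z" for z
      by (simp only: scaleR_diff_right scaleR_sum_right Fi ki P_def)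
    have mb: "set_borel_measurable lborel (S \<times> S) (\<lambda>z. (\<Sum>n=1..N. F n z) - k z)"
      unfolding set_borel_measurable_def i using Pm k(1) by (intro borel_measurable_diff)
    have "(\<lambda>z. (\<Sum>n=1..N. F n z) - k z) \<in> Ltwo (S \<times> S)"
      unfolding Ltwo_iff_nn_integral(1)[OF mb] i using k(3)[of N] by (simp add: le_less_trans)
    from Ltwo_iff_nn_integral(2)[OF mb this] k(3)[of N]
    have "ennreal ((Ltwo_norm (S \<times> S) (\<lambda>z. (\<Sum>n=1..N. F n z) - k z))\<^sup>2) \<le> ennreal (T N)" by (simp only: i)
    then have "(Ltwo_norm (S \<times> S) (\<lambda>z. (\<Sum>n=1..N. F n z) - k z))\<^sup>2 \<le> T N" using T0 by simp
    then show ?thesis by (rule real_le_rsqrt)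
  qed
  have "(\<lambda>N. Ltwo_norm (S \<times> S) (\<lambda>z. (\<Sum>n=1..N. F n z) - k z)) \<longlonglongrightarrow> 0"
  proof (rule Lim_null_comparison)
    show "(\<lambda>N. sqrt (T N)) \<longlonglongrightarrow> 0" using tendsto_real_sqrt[OF T] by simp
    have "0 \<le> Ltwo_norm (S \<times> S) h" for h :: "real \<times> real \<Rightarrow> complex"
      by (simp add: Ltwo_norm_def set_lebesgue_integral_def)
    then show "\<forall>\<^sub>F N in sequentially. norm (Ltwo_norm (S \<times> S) (\<lambda>z. (\<Sum>n=1..N. F n z) - k z)) \<le> sqrt (T N)"
      using nrm by (intro always_eventually) simp
  qed
  with FL kL have "Ltwo_sums (S \<times> S) F k" by (simp add: Ltwo_sums_def)
  then show ?thesis by (auto simp: F_def)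
qed

section \<open>Enumeration of the Bessel zeros\<close>

text \<open>
  Every point of the line is followed by a next element of \<open>S\<close>; iterate, starting from the minimum.
\<close>
lemma enumerate_locally_finite_reals:
  fixes S :: "real set"
  assumes inf: "infinite S" and fin: "\<And>R. finite {t \<in> S. t < R}"
  obtains \<tau> :: "nat \<Rightarrow> real" where "strict_mono \<tau>" "range \<tau> = S" "\<And>N. {t \<in> S. t < \<tau> N} = \<tau> ` {..<N}"
    "filterlim \<tau> at_top sequentially"
proof -
  have next_ex: "\<exists>y\<in>S. y > x \<and> {t \<in> S. t < y} = {t \<in> S. t \<le> x}" for x
  proof -
    have "finite {t \<in> S. t \<le> x}" using fin[of "x + 1"] by (rule rev_finite_subset) auto
    then have "infinite (S - {t \<in> S. t \<le> x})" using inf by simp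
    then obtain s where s: "s \<in> S" "s > x" by (metis (no_types, lifting) Diff_iff finite.emptyI mem_Collect_eq not_le ex_in_conv)
    define A where "A = {t \<in> S. x < t \<and> t \<le> s}"
    have A: "finite A" using fin[of "s + 1"] unfolding A_def by (rule rev_finite_subset) auto
    have "s \<in> A" using s by (simp add: A_def)
    then have "Min A \<in> A" using A by (intro Min_in) auto
    moreover have "{t \<in> S. t < Min A} = {t \<in> S. t \<le> x}"
    proof (intro Collect_cong conj_cong refl iffI)
      fix t assume t: "t \<in> S" "t < Min A"
      show "t \<le> x"
      proof (rule ccontr)
        assume "\<not> t \<le> x"
        moreover have "Min A \<le> s" using A \<open>s \<in> A\<close> by simp
        ultimately have "t \<in> A" using t by (simp add: A_def)
        then show False using t A by (meson Min_le not_le)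
      qed
    next
      fix t assume "t \<in> S" "t \<le> x"
      then show "t < Min A" using \<open>Min A \<in> A\<close> by (simp add: A_def)
    qed
    ultimately show ?thesis by (intro bexI[of _ "Min A"]) (auto simp: A_def)
  qed
  obtain s0 where s0: "s0 \<in> S" using inf by (metis finite.emptyI ex_in_conv)
  define A0 where "A0 = {t \<in> S. t \<le> s0}"
  have A0: "finite A0" using fin[of "s0 + 1"] unfolding A0_def by (rule rev_finite_subset) auto
  have A0': "s0 \<in> A0" using s0 by (simp add: A0_def)
  have m0: "Min A0 \<in> S" "\<And>t. t \<in> S \<Longrightarrow> Min A0 \<le> t"
  proof -
    show "Min A0 \<in> S" using Min_in[OF A0] A0' by (auto simp: A0_def)
    fix t assume "t \<in> S"
    then show "Min A0 \<le> t" using Min_le[OF A0, of t] Min_le[OF A0 A0'] by (cases "t \<le> s0") (auto simp: A0_def)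
  qed
  have "\<exists>\<tau>. \<forall>n. (\<tau> n \<in> S \<and> (n = 0 \<longrightarrow> \<tau> n = Min A0)) \<and> (\<tau> n < \<tau> (Suc n) \<and> {t \<in> S. t < \<tau> (Suc n)} = {t \<in> S. t \<le> \<tau> n})"
  proof (rule dependent_nat_choice)
    show "\<exists>x. x \<in> S \<and> (0 = (0::nat) \<longrightarrow> x = Min A0)" using m0 by auto
  next
    fix x and n :: nat
    show "\<exists>y. (y \<in> S \<and> (Suc n = 0 \<longrightarrow> y = Min A0)) \<and> x < y \<and> {t \<in> S. t < y} = {t \<in> S. t \<le> x}"
      using next_ex[of x] by auto
  qed
  then obtain \<tau> where \<tau>: "\<And>n. \<tau> n \<in> S" "\<tau> 0 = Min A0" "\<And>n. \<tau> n < \<tau> (Suc n)"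
    "\<And>n. {t \<in> S. t < \<tau> (Suc n)} = {t \<in> S. t \<le> \<tau> n}" by metis
  have mono: "strict_mono \<tau>" using \<tau>(3) by (simp add: strict_mono_Suc_iff)
  have im: "{t \<in> S. t < \<tau> N} = \<tau> ` {..<N}" for N
  proof (induction N)
    case 0
    then show ?case using m0(2) \<tau>(2) by force
  next
    case (Suc N)
    have "{t \<in> S. t < \<tau> (Suc N)} = insert (\<tau> N) {t \<in> S. t < \<tau> N}" using \<tau>(1)[of N] unfolding \<tau>(4) by auto
    then show ?case by (simp add: Suc lessThan_Suc)
  qed
  have unb: "\<exists>N. R \<le> \<tau> N" for R
  proof (rule ccontr)
    assume "\<not> (\<exists>N. R \<le> \<tau> N)"
    then have "range \<tau> \<subseteq> {t \<in> S. t < R}" using \<tau>(1) by (auto simp: not_le)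
    then have "finite (range \<tau>)" using fin finite_subset by blast
    then show False using strict_mono_imp_inj_on[OF mono, of UNIV] finite_imageD by blast
  qed
  have "range \<tau> = S"
  proof
    show "S \<subseteq> range \<tau>"
    proof
      fix s assume s: "s \<in> S"
      obtain N where "s + 1 \<le> \<tau> N" using unb by blast
      then have "s \<in> {t \<in> S. t < \<tau> N}" using s by simp
      then have "s \<in> \<tau> ` {..<N}" by (simp only: im)
      then show "s \<in> range \<tau>" by auto
    qed
  qed (use \<tau>(1) in auto)
  moreover have "filterlim \<tau> at_top sequentially"
    unfolding filterlim_at_top
  proof
    fix R
    obtain N where "R \<le> \<tau> N" using unb by blast
    then have "R \<le> \<tau> n" if "n \<ge> N" for n using strict_mono_leD[OF mono that] by simp
    then show "\<forall>\<^sub>F n in sequentially. R \<le> \<tau> n" by (auto simp: eventually_sequentially)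
  qed
  ultimately show thesis using that mono im by blast
qed

lemma bessel_J_eq_bclif:
  "bessel_J \<nu> z = (z / 2) powr of_real \<nu> * bclif \<nu> ((z / 2)\<^sup>2)"
proof -
  have "complex_of_real \<nu> + of_nat m + 1 = of_real (\<nu> + real m + 1)" for m by simp
  then have "rGamma (complex_of_real \<nu> + of_nat m + 1) = of_real (rGamma (\<nu> + real m + 1))" for m
    by (simp only: rGamma_complex_of_real)
  then show ?thesis by (simp add: bessel_J_def bclif_def bclif_coeff_def power_mult)
qed

lemma bessel_J_of_real:
  assumes "\<nu> \<ge> 0" "y \<ge> 0"
  shows "bessel_J \<nu> (of_real y) = of_real ((y / 2) powr \<nu> * bclif \<nu> ((y / 2)\<^sup>2))"
proof -
  have "(complex_of_real y / 2) powr of_real \<nu> = of_real ((y / 2) powr \<nu>)"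
    using assms powr_of_real[of "y / 2" \<nu>] by simp
  moreover have "bclif \<nu> ((complex_of_real y / 2)\<^sup>2) = of_real (bclif \<nu> ((y / 2)\<^sup>2))"
    using bclif_of_real[OF assms(1), of "(y / 2)\<^sup>2"] by simp
  ultimately show ?thesis by (simp add: bessel_J_eq_bclif)
qed

text \<open>
  The \<open>n\<close>-th zero of \<open>E\<close>, expressed through the positive zeros of the Bessel function, which are counted from one.
\<close>
definition bclif_zero :: "real \<Rightarrow> nat \<Rightarrow> real" where
  "bclif_zero \<nu> n = (bessel_zero \<nu> (Suc n) / 2)\<^sup>2"

text \<open>
  The squared halves of the positive zeros of \<open>J\<^sub>\<nu>\<close> are the zeros of \<open>E\<close>, so the definite description in
  the definition of the Bessel zeros refers to their increasing enumeration.
\<close>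
lemma bclif_zero_enum:
  assumes \<nu>: "\<nu> > 0"
  shows "strict_mono (bclif_zero \<nu>)" "range (bclif_zero \<nu>) = bclif_zeros \<nu>"
    "\<And>N. {t \<in> bclif_zeros \<nu>. t < bclif_zero \<nu> N} = bclif_zero \<nu> ` {..<N}"
    "filterlim (bclif_zero \<nu>) at_top sequentially"
    "\<And>n. bessel_zero \<nu> (Suc n) = 2 * sqrt (bclif_zero \<nu> n)"
proof -
  have \<nu>0: "\<nu> \<ge> 0" using \<nu> by simp
  obtain \<tau> where \<tau>: "strict_mono \<tau>" "range \<tau> = bclif_zeros \<nu>" "\<And>N. {t \<in> bclif_zeros \<nu>. t < \<tau> N} = \<tau> ` {..<N}"
    "filterlim \<tau> at_top sequentially"
    by (rule enumerate_locally_finite_reals[OF infinite_bclif_zeros[OF \<nu>] finite_bclif_zeros_less[OF \<nu>]]) blast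
  have pos: "\<tau> n > 0" for n using bclif_zerosD[OF \<nu>] \<tau>(2) by blast
  have J0: "bessel_J \<nu> (of_real y) = 0 \<longleftrightarrow> (y / 2)\<^sup>2 \<in> bclif_zeros \<nu>" if "y > 0" for y
    using that \<nu>0 by (simp add: bessel_J_of_real bclif_zeros_def)
  have zeros: "{y \<in> {0<..2 * sqrt (\<tau> n)}. bessel_J \<nu> (of_real y) = 0} = (\<lambda>i. 2 * sqrt (\<tau> i)) ` {..n}" (is "?A = ?B") for n
  proof
    show "?A \<subseteq> ?B"
    proof
      fix y assume y: "y \<in> ?A"
      then have "(y / 2)\<^sup>2 \<in> range \<tau>" using J0 \<tau>(2) by auto
      then obtain i where i: "(y / 2)\<^sup>2 = \<tau> i" by auto
      have yi: "y = 2 * sqrt (\<tau> i)" using y by (simp flip: i)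
      then have "\<tau> i \<le> \<tau> n" using y by simp
      then have "i \<le> n" using strict_mono_less_eq[OF \<tau>(1)] by blast
      then show "y \<in> ?B" using yi by auto
    qed
    show "?B \<subseteq> ?A"
    proof
      fix y assume "y \<in> ?B"
      then obtain i where i: "y = 2 * sqrt (\<tau> i)" "i \<le> n" by auto
      have "y > 0" "(y / 2)\<^sup>2 = \<tau> i" using pos[of i] by (auto simp: i(1))
      moreover have "\<tau> i \<in> bclif_zeros \<nu>" using \<tau>(2) by blast
      ultimately have "bessel_J \<nu> (of_real y) = 0" using J0 by simp
      moreover have "y \<le> 2 * sqrt (\<tau> n)" using strict_mono_less_eq[OF \<tau>(1)] i by simp
      ultimately show "y \<in> ?A" using \<open>y > 0\<close> by simp
    qed
  qed
  have "bessel_zero \<nu> (Suc n) = 2 * sqrt (\<tau> n)" for n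
    unfolding bessel_zero_def
  proof (rule the_equality)
    have inj: "inj_on (\<lambda>i. 2 * sqrt (\<tau> i)) A" for A
      using strict_mono_imp_inj_on[OF \<tau>(1)] by (auto simp: inj_on_def)
    have card: "card {y \<in> {0<..2 * sqrt (\<tau> i)}. bessel_J \<nu> (of_real y) = 0} = Suc i" for i
      unfolding zeros by (simp add: card_image[OF inj])
    show "2 * sqrt (\<tau> n) > 0 \<and> bessel_J \<nu> (of_real (2 * sqrt (\<tau> n))) = 0 \<and>
      card {y \<in> {0<..2 * sqrt (\<tau> n)}. bessel_J \<nu> (of_real y) = 0} = Suc n"
      using pos[of n] \<tau>(2) J0[of "2 * sqrt (\<tau> n)"] card[of n] by (auto simp: less_imp_le)
    fix x :: real
    assume x: "x > 0 \<and> bessel_J \<nu> (of_real x) = 0 \<and> card {y \<in> {0<..x}. bessel_J \<nu> (of_real y) = 0} = Suc n"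
    then have "(x / 2)\<^sup>2 \<in> range \<tau>" using J0 \<tau>(2) by auto
    then obtain i where i: "(x / 2)\<^sup>2 = \<tau> i" by auto
    have xi: "x = 2 * sqrt (\<tau> i)" using x by (simp flip: i)
    then have "i = n" using x card[of i] by simp
    then show "x = 2 * sqrt (\<tau> n)" using xi by simp
  qed
  moreover from this have "bclif_zero \<nu> = \<tau>" using pos by (auto simp: bclif_zero_def fun_eq_iff less_imp_le)
  ultimately show "strict_mono (bclif_zero \<nu>)" "range (bclif_zero \<nu>) = bclif_zeros \<nu>"
    "\<And>N. {t \<in> bclif_zeros \<nu>. t < bclif_zero \<nu> N} = bclif_zero \<nu> ` {..<N}"
    "filterlim (bclif_zero \<nu>) at_top sequentially"
    "\<And>n. bessel_zero \<nu> (Suc n) = 2 * sqrt (bclif_zero \<nu> n)" using \<tau> by simp_all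
qed

lemma bclif_zero_root:
  assumes "\<nu> > 0"
  shows "bclif \<nu> (bclif_zero \<nu> n) = 0" "bclif_zero \<nu> n > 0" "bclif (\<nu> + 1) (bclif_zero \<nu> n) \<noteq> 0"
proof -
  have "bclif_zero \<nu> n \<in> bclif_zeros \<nu>" using bclif_zero_enum(2)[OF assms] by blast
  then show "bclif \<nu> (bclif_zero \<nu> n) = 0" by (simp add: bclif_zeros_def)
  then show "bclif_zero \<nu> n > 0" "bclif (\<nu> + 1) (bclif_zero \<nu> n) \<noteq> 0"
    using bclif_zero_pos[of \<nu>] bclif_simple_zero[OF assms] assms by auto
qed

text \<open>
  A gap of at least \<open>\<surd>(2 t)\<close> between consecutive zeros means that their square roots advance by at least a fixed
  step \<open>d\<close>. Taking \<open>d\<close> at most \<open>1/3\<close> and at most the first square root makes this true from the start.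
\<close>
lemma bclif_zero_spacing:
  assumes \<nu>: "\<nu> > 0"
  obtains \<delta> where "quadratic_spacing (bclif_zero \<nu>) \<delta>"
proof -
  define r where "r = (\<lambda>n. sqrt (bclif_zero \<nu> n))"
  have rpos: "r n > 0" and r2: "(r n)\<^sup>2 = bclif_zero \<nu> n" for n
    using bclif_zero_root(2)[OF \<nu>, of n] by (auto simp: r_def)
  define d where "d = min (1 / 3) (r 0)"
  have d: "d > 0" "d \<le> 1 / 3" "d \<le> r 0" using rpos[of 0] by (auto simp: d_def)
  have step: "r n + d \<le> r (Suc n)" if n: "d \<le> r n" for n
  proof -
    have "bclif_zero \<nu> n < bclif_zero \<nu> (Suc n)" using bclif_zero_enum(1)[OF \<nu>] by (simp add: strict_mono_Suc_iff)
    from bclif_zero_gap[OF \<nu> this bclif_zero_root(1)[OF \<nu>] bclif_zero_root(1)[OF \<nu>]]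
    have gap: "(r n)\<^sup>2 + sqrt 2 * r n \<le> (r (Suc n))\<^sup>2" unfolding r2 by (simp add: real_sqrt_mult r_def)
    have "d * d \<le> (1 / 3) * r n" using d n by (intro mult_mono) auto
    moreover have "d * r n \<le> (1 / 3) * r n" using d rpos[of n] by (intro mult_right_mono) auto
    moreover have "1 * r n \<le> sqrt 2 * r n" using rpos[of n] by (intro mult_right_mono) auto
    moreover have "x + 2 * y \<le> z" if "x \<le> (1 / 3) * u" "y \<le> (1 / 3) * u" "1 * u \<le> z" for x y z u :: real
      using that by argo
    ultimately have "d * d + 2 * (d * r n) \<le> sqrt 2 * r n" by blast
    moreover have "(r n + d)\<^sup>2 = (r n)\<^sup>2 + (d * d + 2 * (d * r n))" by (simp add: power2_eq_square algebra_simps)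
    ultimately have "(r n + d)\<^sup>2 \<le> (r n)\<^sup>2 + sqrt 2 * r n" by simp
    then have "(r n + d)\<^sup>2 \<le> (r (Suc n))\<^sup>2" using gap by simp
    then show ?thesis by (rule power2_le_imp_le) (rule less_imp_le[OF rpos])
  qed
  have low: "d * (real n + 1) \<le> r n" for n
  proof (induction n)
    case (Suc n)
    have "d \<le> d * (real n + 1)" using d by simp
    then have "r n + d \<le> r (Suc n)" using Suc by (intro step) simp
    then show ?case using Suc by (simp add: algebra_simps)
  qed (use d in simp)
  have dr: "d \<le> r n" for n
  proof -
    have "d \<le> d * (real n + 1)" using d by simp
    then show ?thesis using low[of n] by simp
  qed
  have diff: "r j + d * real i \<le> r (j + i)" for i j
  proof (induction i)
    case (Suc i)
    then show ?case using step[OF dr, of "j + i"] by (simp add: algebra_simps)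
  qed simp
  have absd: "d * \<bar>real k - real j\<bar> \<le> \<bar>r k - r j\<bar>" for k j
  proof (cases "j \<le> k")
    case True
    then show ?thesis using diff[of j "k - j"] by simp
  next
    case False
    then show ?thesis using diff[of k "j - k"] by simp
  qed
  have "quadratic_spacing (bclif_zero \<nu>) (d\<^sup>2)"
  proof
    show "d\<^sup>2 > 0" using d by simp
    fix j k
    have "(d * \<bar>real k - real j\<bar>) * (d * (real k + real j + 2)) \<le> \<bar>r k - r j\<bar> * (r k + r j)"
      using low[of k] low[of j] d by (intro mult_mono absd) (auto simp: algebra_simps)
    also have "\<dots> = \<bar>(r k - r j) * (r k + r j)\<bar>" using rpos[of k] rpos[of j] by (simp add: abs_mult)
    also have "(r k - r j) * (r k + r j) = bclif_zero \<nu> k - bclif_zero \<nu> j" by (simp add: r2[symmetric] power2_eq_square algebra_simps)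
    finally show "d\<^sup>2 * (\<bar>real k - real j\<bar> * (real k + real j + 2)) \<le> \<bar>bclif_zero \<nu> k - bclif_zero \<nu> j\<bar>"
      by (simp add: power2_eq_square mult_ac)
  next
    fix k
    have "(d * (real k + 1))\<^sup>2 \<le> (r k)\<^sup>2" using low[of k] d by (intro power_mono) auto
    then show "d\<^sup>2 * (real k + 1)\<^sup>2 \<le> bclif_zero \<nu> k" by (simp add: r2 power_mult_distrib)
  qed
  then show thesis by (rule that)
qed

text \<open>
  Divide the product formula at \<open>t\<^sub>k + s\<close> by the one for the derivative at \<open>t\<^sub>k\<close>: the normalising factors
  \<open>1/t\<^sub>j\<close> cancel.
\<close>
lemma sprod_bclif_zero_tendsto:
  assumes \<nu>: "\<nu> > 0" and sp: "quadratic_spacing (bclif_zero \<nu>) \<delta>" and s: "s \<noteq> 0"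
  shows "(\<lambda>N. quadratic_spacing.sprod (bclif_zero \<nu>) s N k) \<longlonglongrightarrow>
     - bclif \<nu> (bclif_zero \<nu> k + s) / (s * bclif (\<nu> + 1) (bclif_zero \<nu> k))"
proof -
  interpret quadratic_spacing "bclif_zero \<nu>" \<delta> by (rule sp)
  define \<tau> where "\<tau> = bclif_zero \<nu>"
  have \<nu>0: "\<nu> \<ge> 0" using \<nu> by simp
  have inj: "inj_on \<tau> A" for A using bclif_zero_enum(1)[OF \<nu>] strict_mono_imp_inj_on by (auto simp: \<tau>_def inj_on_def)
  have im: "{t \<in> bclif_zeros \<nu>. t < \<tau> N} = \<tau> ` {..<N}" for N unfolding \<tau>_def by (rule bclif_zero_enum(3)[OF \<nu>])
  have lim\<tau>: "filterlim \<tau> at_top sequentially" unfolding \<tau>_def by (rule bclif_zero_enum(4)[OF \<nu>])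
  have E0: "bclif \<nu> (0::real) \<noteq> 0" using bclif_0_pos[OF \<nu>0] by simp
  have pos: "\<tau> j > 0" for j unfolding \<tau>_def by (rule bclif_zero_root(2)[OF \<nu>])
  have E1: "bclif (\<nu> + 1) (\<tau> k) \<noteq> 0" unfolding \<tau>_def by (rule bclif_zero_root(3)[OF \<nu>])
  have L1: "(\<lambda>N. \<Prod>j<N. 1 - (\<tau> k + s) / \<tau> j) \<longlonglongrightarrow> bclif \<nu> (\<tau> k + s) / bclif \<nu> 0"
  proof -
    have "(\<lambda>N. \<Prod>t\<in>{t \<in> bclif_zeros \<nu>. t < \<tau> N}. 1 - of_real (\<tau> k + s) / complex_of_real t)
       \<longlonglongrightarrow> bclif \<nu> (of_real (\<tau> k + s)) / of_real (bclif \<nu> 0)"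
      by (rule filterlim_compose[OF bclif_hadamard[OF \<nu>] lim\<tau>])
    also have "bclif \<nu> (of_real (\<tau> k + s)) / of_real (bclif \<nu> 0) = complex_of_real (bclif \<nu> (\<tau> k + s) / bclif \<nu> 0)"
      by (simp only: bclif_of_real[OF \<nu>0] of_real_divide)
    also have "(\<lambda>N. \<Prod>t\<in>{t \<in> bclif_zeros \<nu>. t < \<tau> N}. 1 - of_real (\<tau> k + s) / complex_of_real t)
      = (\<lambda>N. of_real (\<Prod>j<N. 1 - (\<tau> k + s) / \<tau> j))"
      unfolding im by (simp add: prod.reindex[OF inj])
    finally show ?thesis by (simp only: tendsto_of_real_iff)
  qed
  have L2: "(\<lambda>N. \<Prod>j\<in>{..<N} - {k}. 1 - \<tau> k / \<tau> j) \<longlonglongrightarrow> \<tau> k * bclif (\<nu> + 1) (\<tau> k) / bclif \<nu> 0"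
  proof -
    have "\<tau> k \<in> bclif_zeros \<nu>" using bclif_zero_enum(2)[OF \<nu>] by (auto simp: \<tau>_def)
    from filterlim_compose[OF bclif_hadamard_deriv[OF \<nu> this] lim\<tau>]
    have "(\<lambda>N. \<Prod>t\<in>\<tau> ` {..<N} - {\<tau> k}. 1 - \<tau> k / t) \<longlonglongrightarrow> \<tau> k * bclif (\<nu> + 1) (\<tau> k) / bclif \<nu> 0"
      unfolding im .
    moreover have "\<tau> ` {..<N} - {\<tau> k} = \<tau> ` ({..<N} - {k})" for N using inj[of UNIV] by (auto simp: inj_on_def)
    ultimately show ?thesis by (simp add: prod.reindex[OF inj])
  qed
  have "(\<lambda>N. (\<Prod>j<N. 1 - (\<tau> k + s) / \<tau> j) / (\<Prod>j\<in>{..<N} - {k}. 1 - \<tau> k / \<tau> j) * (- \<tau> k / s))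
    \<longlonglongrightarrow> (bclif \<nu> (\<tau> k + s) / bclif \<nu> 0) / (\<tau> k * bclif (\<nu> + 1) (\<tau> k) / bclif \<nu> 0) * (- \<tau> k / s)"
    using E0 E1 pos[of k] by (intro tendsto_intros L1 L2) auto
  also have "(bclif \<nu> (\<tau> k + s) / bclif \<nu> 0) / (\<tau> k * bclif (\<nu> + 1) (\<tau> k) / bclif \<nu> 0) * (- \<tau> k / s)
     = - bclif \<nu> (\<tau> k + s) / (s * bclif (\<nu> + 1) (\<tau> k))"
    using E0 E1 pos[of k] s by (simp add: field_simps)
  finally have "(\<lambda>N. (\<Prod>j<N. 1 - (\<tau> k + s) / \<tau> j) / (\<Prod>j\<in>{..<N} - {k}. 1 - \<tau> k / \<tau> j) * (- \<tau> k / s))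
    \<longlonglongrightarrow> - bclif \<nu> (\<tau> k + s) / (s * bclif (\<nu> + 1) (\<tau> k))" .
  then show ?thesis
    unfolding \<tau>_def[symmetric]
  proof (rule Lim_transform_eventually)
    show "\<forall>\<^sub>F N in sequentially. (\<Prod>j<N. 1 - (\<tau> k + s) / \<tau> j) / (\<Prod>j\<in>{..<N} - {k}. 1 - \<tau> k / \<tau> j) * (- \<tau> k / s)
        = quadratic_spacing.sprod \<tau> s N k"
      using eventually_gt_at_top[of k]
    proof eventually_elim
      case (elim N)
      have "(\<Prod>j<N. 1 - (\<tau> k + s) / \<tau> j) = (1 - (\<tau> k + s) / \<tau> k) * (\<Prod>j\<in>{..<N} - {k}. 1 - (\<tau> k + s) / \<tau> j)"
        using elim by (subst prod.remove[of "{..<N}" k]) auto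
      also have "1 - (\<tau> k + s) / \<tau> k = - s / \<tau> k" using pos[of k] by (simp add: field_simps)
      finally have "(\<Prod>j<N. 1 - (\<tau> k + s) / \<tau> j) / (\<Prod>j\<in>{..<N} - {k}. 1 - \<tau> k / \<tau> j) * (- \<tau> k / s)
         = (\<Prod>j\<in>{..<N} - {k}. 1 - (\<tau> k + s) / \<tau> j) / (\<Prod>j\<in>{..<N} - {k}. 1 - \<tau> k / \<tau> j)"
        using pos[of k] s by simp
      also have "\<dots> = (\<Prod>j\<in>{..<N} - {k}. (1 - (\<tau> k + s) / \<tau> j) / (1 - \<tau> k / \<tau> j))" by (simp add: prod_dividef)
      also have "\<dots> = (\<Prod>j\<in>{..<N} - {k}. 1 + s / (\<tau> k - \<tau> j))"
      proof (intro prod.cong refl)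
        fix j assume "j \<in> {..<N} - {k}"
        then have ne: "\<tau> k - \<tau> j \<noteq> 0" "\<tau> j - \<tau> k \<noteq> 0" using inj[of UNIV] by (auto simp: inj_on_def)
        have "(1 - (\<tau> k + s) / \<tau> j) / (1 - \<tau> k / \<tau> j) = (\<tau> j - (\<tau> k + s)) / (\<tau> j - \<tau> k)"
          using pos[of j] ne by (simp add: field_simps)
        also have "\<dots> = 1 + s / (\<tau> k - \<tau> j)" using ne by (simp add: divide_simps) (simp add: algebra_simps)
        finally show "(1 - (\<tau> k + s) / \<tau> j) / (1 - \<tau> k / \<tau> j) = 1 + s / (\<tau> k - \<tau> j)" .
      qed
      finally show ?case using sprod_def by (simp add: \<tau>_def)
    qed
  qed
qed

section \<open>Eigenfunctions and shifted eigenfunctions\<close>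

lemma continuous_on_unit_interval_Ltwo:
  fixes f :: "real \<Rightarrow> complex"
  assumes f: "continuous_on {0..1} f"
  shows "set_integrable lborel {0<..<1} f" "set_borel_measurable lborel {0<..<1} f"
    "f \<in> Ltwo {0<..<1}" "(f has_integral I) {0..1} \<Longrightarrow> (LINT x:{0<..<1}|lborel. f x) = I"
proof -
  have si: "set_integrable lborel {0<..<1} g" if "continuous_on {0..1} g" for g :: "real \<Rightarrow> 'b::{banach, second_countable_topology}"
    by (rule set_integrable_subset[OF borel_integrable_atLeastAtMost'[OF that]]) auto
  show "set_integrable lborel {0<..<1} f" by (rule si[OF f])
  then show m: "set_borel_measurable lborel {0<..<1} f"
    unfolding set_integrable_def set_borel_measurable_def by (rule borel_measurable_integrable)
  have "set_integrable lborel {0<..<1} (\<lambda>x. (cmod (f x))\<^sup>2)"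
    by (intro si continuous_intros f)
  with m show "f \<in> Ltwo {0<..<1}" by (simp add: Ltwo_def)
  assume "(f has_integral I) {0..1}"
  then have "(f has_integral I) {0<..<1}" by (simp add: has_integral_Icc_iff_Ioo)
  then show "(LINT x:{0<..<1}|lborel. f x) = I"
    using set_borel_integral_eq_integral(2)[OF si[OF f]] by (simp add: integral_unique)
qed

locale degenerate_parabolic =
  fixes \<alpha> :: real
  assumes \<alpha>: "0 < \<alpha>" "\<alpha> < 1"
begin

abbreviation \<nu> :: real where "\<nu> \<equiv> nu \<alpha>"
abbreviation \<beta> :: real where "\<beta> \<equiv> 2 - \<alpha>"
abbreviation \<tau> :: "nat \<Rightarrow> real" where "\<tau> \<equiv> bclif_zero (nu \<alpha>)"

lemma \<nu>: "\<nu> > 0" "\<nu> \<ge> 0" "\<nu> \<le> 1" and \<beta>\<nu>: "\<beta> * \<nu> = 1 - \<alpha>" and \<beta>: "\<beta> > 0" and kappa_eq: "kappa \<alpha> = \<beta> / 2"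
  using \<alpha> by (auto simp: nu_def kappa_def)

lemmas \<tau>_root = bclif_zero_root[OF \<nu>(1)]

text \<open>
  The solution of \<open>- A u = \<beta>\<^sup>2 z u\<close> that vanishes at the origin.
\<close>
definition U :: "real \<Rightarrow> real \<Rightarrow> real" where
  "U z x = x powr (1 - \<alpha>) * bclif \<nu> (z * x powr \<beta>)"

lemma continuous_on_U [continuous_intros]: "continuous_on {0..1} (U z)"
  unfolding U_def using \<nu> \<alpha> by (auto intro!: continuous_intros continuous_on_powr')

lemma U_inner: "((\<lambda>x. U z x * U w x) has_integral bclif_kernel \<nu> z w / \<beta>) {0..1}"
proof -
  have "((\<lambda>x. of_real (\<beta> * x powr (\<beta> * (\<nu> + 1) - 1)) *
      (bclif \<nu> (of_real z * of_real (x powr \<beta>)) * bclif \<nu> (of_real w * of_real (x powr \<beta>)))) has_integral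
      bclif_kernel \<nu> (complex_of_real z) (of_real w)) {0..1}"
    by (rule bclif_kernel_has_integral[OF \<beta> \<nu>(2)])
  also have "(\<lambda>x. of_real (\<beta> * x powr (\<beta> * (\<nu> + 1) - 1)) *
      (bclif \<nu> (of_real z * of_real (x powr \<beta>)) * bclif \<nu> (of_real w * of_real (x powr \<beta>))))
      = (\<lambda>x. complex_of_real (\<beta> * (U z x * U w x)))"
  proof
    fix x :: real
    have "\<beta> * (\<nu> + 1) - 1 = (1 - \<alpha>) + (1 - \<alpha>)" using \<beta>\<nu> by (simp add: distrib_left)
    then have "x powr (\<beta> * (\<nu> + 1) - 1) = x powr (1 - \<alpha>) * x powr (1 - \<alpha>)" by (simp only: powr_add)
    then show "of_real (\<beta> * x powr (\<beta> * (\<nu> + 1) - 1)) *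
      (bclif \<nu> (of_real z * of_real (x powr \<beta>)) * bclif \<nu> (of_real w * of_real (x powr \<beta>)))
      = complex_of_real (\<beta> * (U z x * U w x))"
      using bclif_of_real[OF \<nu>(2)] by (simp add: U_def mult_ac flip: of_real_mult)
  qed
  finally have "((\<lambda>x. Re (complex_of_real (\<beta> * (U z x * U w x)))) has_integral Re (bclif_kernel \<nu> (complex_of_real z) (of_real w))) {0..1}"
    by (rule has_integral_linear[OF _ bounded_linear_Re, unfolded o_def])
  then have "((\<lambda>x. \<beta> * (U z x * U w x)) has_integral bclif_kernel \<nu> z w) {0..1}"
    by (simp add: bclif_kernel_of_real[OF \<nu>(2)])
  then have "((\<lambda>x. inverse \<beta> * (\<beta> * (U z x * U w x))) has_integral inverse \<beta> * bclif_kernel \<nu> z w) {0..1}"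
    by (rule has_integral_mult_right)
  then show ?thesis using \<beta> by (simp add: divide_inverse mult_ac)
qed

text \<open>
  The factor that gives \<open>U (\<tau> n)\<close> unit norm, with the sign of the eigenfunctions.
\<close>
definition nrm :: "nat \<Rightarrow> real" where
  "nrm n = - sqrt \<beta> / (sqrt (\<tau> n) * bclif (\<nu> + 1) (\<tau> n))"

lemma eigval_Suc: "eigval \<alpha> (Suc n) = \<beta>\<^sup>2 * \<tau> n"
  using bclif_zero_enum(5)[OF \<nu>(1), of n] \<tau>_root(2)[of n] by (simp add: eigval_def kappa_eq power_mult_distrib power_divide)

lemma deriv_bessel_J_zero:
  "deriv (bessel_J \<nu>) (of_real (bessel_zero \<nu> (Suc n))) = of_real (- (sqrt (\<tau> n) powr \<nu> * sqrt (\<tau> n) * bclif (\<nu> + 1) (\<tau> n)))"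
proof -
  define j where "j = bessel_zero \<nu> (Suc n)"
  have j: "j = 2 * sqrt (\<tau> n)" unfolding j_def by (rule bclif_zero_enum(5)[OF \<nu>(1)])
  have t: "\<tau> n > 0" by (rule \<tau>_root(2))
  have j2: "(complex_of_real j / 2)\<^sup>2 = of_real (\<tau> n)" using t by (simp add: j flip: of_real_power)
  have "complex_of_real j / 2 = of_real (sqrt (\<tau> n))" by (simp add: j)
  then have "complex_of_real j / 2 \<notin> \<real>\<^sub>\<le>\<^sub>0" using t by simp
  then have D: "((\<lambda>z. (z / 2) powr of_real \<nu>) has_field_derivative D) (at (complex_of_real j))"
    if "D = (of_real \<nu> * (of_real j / 2) powr (of_real \<nu> - 1)) * (1 / 2)" for D
    unfolding that by (rule DERIV_chain2[OF has_field_derivative_powr]) (auto intro!: derivative_eq_intros)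
  define D where "D = (of_real \<nu> * (complex_of_real j / 2) powr (of_real \<nu> - 1)) * (1 / 2)"
  have dE: "((\<lambda>z. bclif \<nu> ((z / 2)\<^sup>2)) has_field_derivative - bclif (\<nu> + 1) ((complex_of_real j / 2)\<^sup>2) * (of_real j / 2)) (at (complex_of_real j))"
    by (rule bclif_DERIV[OF \<nu>(2)]) (auto intro!: derivative_eq_intros)
  have E0: "bclif \<nu> ((complex_of_real j / 2)\<^sup>2) = 0"
    unfolding j2 bclif_of_real[OF \<nu>(2)] by (simp add: \<tau>_root(1))
  have "(bessel_J \<nu> has_field_derivative D * bclif \<nu> ((complex_of_real j / 2)\<^sup>2)
      + (- bclif (\<nu> + 1) ((complex_of_real j / 2)\<^sup>2) * (of_real j / 2)) * ((of_real j / 2) powr of_real \<nu>)) (at (complex_of_real j))"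
    unfolding bessel_J_eq_bclif[abs_def] by (rule DERIV_mult[OF D[OF D_def] dE])
  then have "deriv (bessel_J \<nu>) (of_real j) = (- bclif (\<nu> + 1) ((complex_of_real j / 2)\<^sup>2) * (of_real j / 2)) * ((of_real j / 2) powr of_real \<nu>)"
    by (simp add: DERIV_imp_deriv E0)
  also have "complex_of_real j / 2 = of_real (sqrt (\<tau> n))" by (simp add: j)
  also have "bclif (\<nu> + 1) ((complex_of_real (sqrt (\<tau> n)))\<^sup>2) = of_real (bclif (\<nu> + 1) (\<tau> n))"
    using bclif_of_real[of "\<nu> + 1" "\<tau> n"] \<nu> t by (simp flip: of_real_power)
  also have "complex_of_real (sqrt (\<tau> n)) powr of_real \<nu> = of_real (sqrt (\<tau> n) powr \<nu>)"
    using t by (intro powr_of_real) auto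
  finally show ?thesis by (simp add: j_def)
qed

text \<open>
  Both families come from one formula: the eigenfunction has \<open>c = \<surd>\<tau>\<^sub>n\<close>, the shifted function the complex
  square root of the shifted point. Since \<open>x\<close> enters through a nonnegative real factor, the principal power splits.
\<close>
lemma phi_xi_aux:
  fixes c :: complex and s x :: real
  assumes x: "x \<ge> 0" and c: "c\<^sup>2 = of_real s"
  shows "of_real (sqrt (2 * kappa \<alpha>)) / deriv (bessel_J \<nu>) (of_real (bessel_zero \<nu> (Suc n))) *
     of_real (x powr ((1 - \<alpha>) / 2)) * bessel_J \<nu> (2 * c * of_real (x powr kappa \<alpha>))
   = c powr of_real \<nu> / of_real (sqrt (\<tau> n) powr \<nu>) * of_real (nrm n * U s x)"
proof -
  have "kappa \<alpha> * \<nu> = (1 - \<alpha>) / 2" using \<beta>\<nu> by (simp add: kappa_eq field_simps)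
  then have p: "(c * of_real (x powr kappa \<alpha>)) powr of_real \<nu> = of_real (x powr ((1 - \<alpha>) / 2)) * c powr of_real \<nu>"
    using powr_times_real_left[of "of_real (x powr kappa \<alpha>)" c "of_real \<nu>"] powr_of_real[of "x powr kappa \<alpha>" \<nu>] x
    by (simp only: mult.commute[of c] powr_powr) simp
  have "(c * of_real (x powr kappa \<alpha>))\<^sup>2 = of_real (s * (x powr kappa \<alpha>)\<^sup>2)"
    by (simp add: power_mult_distrib c)
  also have "(x powr kappa \<alpha>)\<^sup>2 = x powr \<beta>" by (simp add: power2_eq_square kappa_eq flip: powr_add)
  finally have sq: "(c * of_real (x powr kappa \<alpha>))\<^sup>2 = of_real (s * x powr \<beta>)" .
  have J: "bessel_J \<nu> (2 * c * of_real (x powr kappa \<alpha>))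
      = of_real (x powr ((1 - \<alpha>) / 2)) * c powr of_real \<nu> * of_real (bclif \<nu> (s * x powr \<beta>))"
    unfolding bessel_J_eq_bclif using p sq bclif_of_real[OF \<nu>(2), of "s * x powr \<beta>"] by simp
  have xx: "x powr ((1 - \<alpha>) / 2) * x powr ((1 - \<alpha>) / 2) = x powr (1 - \<alpha>)" by (simp flip: powr_add)
  have e1: "bclif (\<nu> + 1) (\<tau> n) \<noteq> 0" and t: "\<tau> n > 0" using \<tau>_root[of n] by auto
  have "of_real (sqrt (2 * kappa \<alpha>)) / deriv (bessel_J \<nu>) (of_real (bessel_zero \<nu> (Suc n))) = of_real (nrm n) / of_real (sqrt (\<tau> n) powr \<nu>)"
    unfolding deriv_bessel_J_zero using e1 t by (simp add: nrm_def kappa_eq field_simps)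
  then show ?thesis unfolding J U_def xx[symmetric] by (simp add: mult_ac)
qed

lemma phi_Suc: "x \<ge> 0 \<Longrightarrow> phi \<alpha> (Suc n) x = of_real (nrm n * U (\<tau> n) x)"
proof -
  assume x: "x \<ge> 0"
  define c where "c = complex_of_real (sqrt (\<tau> n))"
  have t: "\<tau> n > 0" by (rule \<tau>_root(2))
  have c2: "c\<^sup>2 = of_real (\<tau> n)" using t by (simp add: c_def flip: of_real_power)
  have arg: "complex_of_real (bessel_zero \<nu> (Suc n) * x powr kappa \<alpha>) = 2 * c * of_real (x powr kappa \<alpha>)"
    by (simp add: bclif_zero_enum(5)[OF \<nu>(1)] c_def)
  have cp: "c powr of_real \<nu> = of_real (sqrt (\<tau> n) powr \<nu>)"
    unfolding c_def using t by (intro powr_of_real) auto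
  show ?thesis unfolding phi_def arg phi_xi_aux[OF x c2] cp using t by simp
qed

text \<open>
  The constant by which the shifted function differs from a multiple of \<open>U\<close>; its reciprocal is the coefficient
  \<open>c\<^sub>n = (\<lambda>\<^sub>n / (\<lambda>\<^sub>n - \<lambda>))\<^bsup>\<nu>/2\<^esup>\<close>.
\<close>
definition shift_ratio :: "real \<Rightarrow> nat \<Rightarrow> complex" where
  "shift_ratio lam n = csqrt (of_real (\<tau> n - lam / \<beta>\<^sup>2)) powr of_real \<nu> / of_real (sqrt (\<tau> n) powr \<nu>)"

lemma xi_Suc: "x \<ge> 0 \<Longrightarrow> xi \<alpha> lam (Suc n) x = shift_ratio lam n * of_real (nrm n * U (\<tau> n - lam / \<beta>\<^sup>2) x)"
proof -
  assume x: "x \<ge> 0"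
  define s where "s = \<tau> n - lam / \<beta>\<^sup>2"
  define c where "c = csqrt (of_real s)"
  have c2: "c\<^sup>2 = of_real s" by (simp add: c_def)
  have "eigval \<alpha> (Suc n) - lam = \<beta>\<^sup>2 * s" using \<beta> by (simp add: eigval_Suc s_def right_diff_distrib)
  moreover have "csqrt (of_real (\<beta>\<^sup>2 * s)) = of_real \<beta> * csqrt (of_real s)"
  proof (cases "s \<ge> 0")
    case True
    then have "csqrt (of_real (\<beta>\<^sup>2 * s)) = of_real (sqrt (\<beta>\<^sup>2 * s))" by (subst csqrt_of_real_nonneg) (simp_all del: of_real_mult of_real_power)
    moreover have "csqrt (of_real s) = of_real (sqrt s)" using True by (subst csqrt_of_real_nonneg) simp_all
    ultimately show ?thesis using \<beta> by (simp only: real_sqrt_mult real_sqrt_abs of_real_mult abs_of_pos)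
  next
    case False
    then have "csqrt (of_real (\<beta>\<^sup>2 * s)) = \<i> * of_real (sqrt \<bar>\<beta>\<^sup>2 * s\<bar>)"
      by (subst csqrt_of_real_nonpos) (simp_all add: mult_nonneg_nonpos del: of_real_mult of_real_power)
    moreover have "csqrt (of_real s) = \<i> * of_real (sqrt \<bar>s\<bar>)" using False by (subst csqrt_of_real_nonpos) simp_all
    moreover have "sqrt \<bar>\<beta>\<^sup>2 * s\<bar> = \<beta> * sqrt \<bar>s\<bar>" using \<beta> by (simp add: abs_mult real_sqrt_mult)
    ultimately show ?thesis by simp
  qed
  ultimately have "csqrt (of_real (eigval \<alpha> (Suc n) - lam)) = of_real \<beta> * c" by (simp only: c_def)
  then have arg: "csqrt (of_real (eigval \<alpha> (Suc n) - lam)) / of_real (kappa \<alpha>) * of_real (x powr kappa \<alpha>) = 2 * c * of_real (x powr kappa \<alpha>)"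
    using \<beta> unfolding kappa_eq by (simp del: of_real_diff)
  show ?thesis unfolding xi_def arg phi_xi_aux[OF x c2] by (simp add: shift_ratio_def c_def s_def)
qed

lemma shift_ratio_nonzero: "lam \<noteq> eigval \<alpha> (Suc n) \<Longrightarrow> shift_ratio lam n \<noteq> 0"
proof -
  assume "lam \<noteq> eigval \<alpha> (Suc n)"
  then have "\<tau> n - lam / \<beta>\<^sup>2 \<noteq> 0" using \<beta> by (auto simp: eigval_Suc field_simps)
  then have "csqrt (of_real (\<tau> n - lam / \<beta>\<^sup>2)) \<noteq> 0" by (simp only: csqrt_eq_0 of_real_eq_0_iff not_False_eq_True)
  then show ?thesis using \<tau>_root(2)[of n] by (simp add: shift_ratio_def del: csqrt_eq_0)
qed

text \<open>
  The flux \<open>x\<^bsup>\<alpha>\<^esup> U'\<close>.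
\<close>
definition V :: "real \<Rightarrow> real \<Rightarrow> real" where
  "V z x = (1 - \<alpha>) * bclif \<nu> (z * x powr \<beta>) - \<beta> * z * x powr \<beta> * bclif (\<nu> + 1) (z * x powr \<beta>)"

lemma powr_beta: "x > 0 \<Longrightarrow> x powr \<beta> = x powr (1 - \<alpha>) * x" "x > 0 \<Longrightarrow> x powr (1 - \<alpha>) = x powr (- \<alpha>) * x"
  using powr_add[of x "1 - \<alpha>" 1] powr_add[of x "- \<alpha>" 1] by (auto simp: add.commute)

lemma U_deriv:
  assumes x: "x > 0"
  shows "(U z has_real_derivative x powr (- \<alpha>) * V z x) (at x)"
proof -
  have "(U z has_real_derivative x powr (1 - \<alpha>) * (- bclif (\<nu> + 1) (z * x powr \<beta>) * (z * (\<beta> * x powr (\<beta> - 1))))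
      + (1 - \<alpha>) * x powr (1 - \<alpha> - 1) * bclif \<nu> (z * x powr \<beta>)) (at x)"
    unfolding U_def using x \<nu> by (auto intro!: derivative_eq_intros)
  moreover have "x powr (\<beta> - 1) = x powr (1 - \<alpha>)" "x powr (1 - \<alpha> - 1) = x powr (- \<alpha>)" by simp_all
  ultimately show ?thesis using powr_beta[OF x] by (simp add: V_def algebra_simps)
qed

lemma V_deriv:
  assumes x: "x > 0"
  shows "(V z has_real_derivative - \<beta>\<^sup>2 * z * U z x) (at x)"
proof -
  define X where "X = x powr \<beta>"
  have dX: "((\<lambda>x. x powr \<beta>) has_real_derivative \<beta> * x powr (1 - \<alpha>)) (at x)"
    using x by (auto intro!: derivative_eq_intros)
  have dW: "((\<lambda>X. (1 - \<alpha>) * bclif \<nu> (z * X) - \<beta> * z * X * bclif (\<nu> + 1) (z * X)) has_real_derivative - \<beta> * z * bclif \<nu> (z * X)) (at X)"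
  proof -
    have "((\<lambda>X. (1 - \<alpha>) * bclif \<nu> (z * X) - \<beta> * z * X * bclif (\<nu> + 1) (z * X)) has_real_derivative
       - (1 - \<alpha>) * z * bclif (\<nu> + 1) (z * X) - \<beta> * z * bclif (\<nu> + 1) (z * X) + \<beta> * z * (z * X * bclif (\<nu> + 2) (z * X))) (at X)"
      using \<nu> by (auto intro!: derivative_eq_intros simp: algebra_simps)
    also have "z * X * bclif (\<nu> + 2) (z * X) = (\<nu> + 1) * bclif (\<nu> + 1) (z * X) - bclif \<nu> (z * X)"
      using bclif_ode[OF \<nu>(2), of "z * X"] by simp
    also have "- (1 - \<alpha>) * z * bclif (\<nu> + 1) (z * X) - \<beta> * z * bclif (\<nu> + 1) (z * X)
       + \<beta> * z * ((\<nu> + 1) * bclif (\<nu> + 1) (z * X) - bclif \<nu> (z * X))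
       = (\<beta> * \<nu> - (1 - \<alpha>)) * z * bclif (\<nu> + 1) (z * X) - \<beta> * z * bclif \<nu> (z * X)"
      by (simp add: algebra_simps)
    also have "\<beta> * \<nu> - (1 - \<alpha>) = 0" using \<beta>\<nu> by simp
    also have "0 * z * bclif (\<nu> + 1) (z * X) - \<beta> * z * bclif \<nu> (z * X) = - \<beta> * z * bclif \<nu> (z * X)"
      by (simp add: algebra_simps)
    finally show ?thesis .
  qed
  have "(V z has_real_derivative (- \<beta> * z * bclif \<nu> (z * X)) * (\<beta> * x powr (1 - \<alpha>))) (at x)"
    using DERIV_chain2[OF dW[unfolded X_def] dX] unfolding V_def[abs_def] X_def by simp
  then show ?thesis by (rule DERIV_cong) (simp add: U_def X_def power2_eq_square algebra_simps)
qed

lemma U_combination: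
  fixes a b :: complex and f :: "real \<Rightarrow> complex"
  assumes f: "\<And>x. x > 0 \<Longrightarrow> f x = a * of_real (U z x) + b * of_real (U w x)"
  shows "x > 0 \<Longrightarrow> (f has_vector_derivative of_real (x powr (- \<alpha>)) * (a * of_real (V z x) + b * of_real (V w x))) (at x)"
    and "x > 0 \<Longrightarrow> (weighted_deriv \<alpha> f has_vector_derivative - of_real (\<beta>\<^sup>2) * (a * of_real (z * U z x) + b * of_real (w * U w x))) (at x)"
    and "(f \<longlongrightarrow> 0) (at_right 0)"
proof -
  show d: "(f has_vector_derivative of_real (x powr (- \<alpha>)) * (a * of_real (V z x) + b * of_real (V w x))) (at x)" if x: "x > 0" for x
  proof -
    have "((\<lambda>x. a * of_real (U z x) + b * of_real (U w x)) has_vector_derivative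
       a * of_real (x powr (- \<alpha>) * V z x) + b * of_real (x powr (- \<alpha>) * V w x)) (at x)"
      by (intro has_vector_derivative_add has_vector_derivative_mult_right has_vector_derivative_of_real U_deriv x)
    then have "(f has_vector_derivative a * of_real (x powr (- \<alpha>) * V z x) + b * of_real (x powr (- \<alpha>) * V w x)) (at x)"
      by (rule has_vector_derivative_transform_within_open[of _ _ _ "{0<..}"]) (use x f in auto)
    then show ?thesis by (simp add: algebra_simps)
  qed
  have wd: "weighted_deriv \<alpha> f x = a * of_real (V z x) + b * of_real (V w x)" if x: "x > 0" for x
  proof -
    have "x powr \<alpha> * x powr (- \<alpha>) = 1" using x by (simp flip: powr_add)
    then have "complex_of_real (x powr \<alpha>) * of_real (x powr (- \<alpha>)) = 1" by (simp only: of_real_mult[symmetric] of_real_1)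
    then show ?thesis unfolding weighted_deriv_def vector_derivative_at[OF d[OF x]]
      by (simp only: mult.assoc[symmetric] mult_1_left)
  qed
  show "(weighted_deriv \<alpha> f has_vector_derivative - of_real (\<beta>\<^sup>2) * (a * of_real (z * U z x) + b * of_real (w * U w x))) (at x)" if x: "x > 0" for x
  proof -
    have "((\<lambda>x. a * of_real (V z x) + b * of_real (V w x)) has_vector_derivative
       a * of_real (- \<beta>\<^sup>2 * z * U z x) + b * of_real (- \<beta>\<^sup>2 * w * U w x)) (at x)"
      by (intro has_vector_derivative_add has_vector_derivative_mult_right has_vector_derivative_of_real V_deriv x)
    then have "(weighted_deriv \<alpha> f has_vector_derivative a * of_real (- \<beta>\<^sup>2 * z * U z x) + b * of_real (- \<beta>\<^sup>2 * w * U w x)) (at x)"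
      by (rule has_vector_derivative_transform_within_open[of _ _ _ "{0<..}"]) (use x wd in auto)
    then show ?thesis by (simp add: algebra_simps)
  qed
  have "continuous_on {0..1} (\<lambda>x. a * of_real (U z x) + b * of_real (U w x))" by (intro continuous_intros)
  then have "((\<lambda>x. a * of_real (U z x) + b * of_real (U w x)) \<longlongrightarrow> a * of_real (U z 0) + b * of_real (U w 0)) (at 0 within {0..1})"
    by (simp add: continuous_on_def)
  then have "((\<lambda>x. a * of_real (U z x) + b * of_real (U w x)) \<longlongrightarrow> 0) (at 0 within {0..1})" by (simp add: U_def)
  then have "((\<lambda>x. a * of_real (U z x) + b * of_real (U w x)) \<longlongrightarrow> 0) (at_right 0)" by (simp add: at_within_Icc_at_right)
  then show "(f \<longlongrightarrow> 0) (at_right 0)"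
    by (rule Lim_transform_eventually) (use f in \<open>auto simp: eventually_at_filter\<close>)
qed

lemma dphi_one_Suc: "dphi_one \<alpha> (Suc n) = of_real (\<beta> * sqrt \<beta> * sqrt (\<tau> n))"
proof -
  have "(phi \<alpha> (Suc n) has_vector_derivative of_real (1 powr (- \<alpha>)) * (of_real (nrm n) * of_real (V (\<tau> n) 1) + 0 * of_real (V 0 1))) (at 1)"
    by (rule U_combination(1)) (simp_all add: phi_Suc)
  then have "dphi_one \<alpha> (Suc n) = of_real (nrm n * V (\<tau> n) 1)"
    unfolding dphi_one_def by (subst vector_derivative_at_within_ivl) auto
  also have "nrm n * V (\<tau> n) 1 = \<beta> * sqrt \<beta> * sqrt (\<tau> n)"
  proof -
    define r e where "r = sqrt (\<tau> n)" and "e = bclif (\<nu> + 1) (\<tau> n)"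
    have re: "r \<noteq> 0" "e \<noteq> 0" "\<tau> n = r * r" using \<tau>_root[of n] by (auto simp: r_def e_def)
    have "nrm n * V (\<tau> n) 1 = - sqrt \<beta> / (r * e) * - (\<beta> * (r * r) * e)"
      unfolding nrm_def V_def by (simp add: \<tau>_root(1) flip: r_def e_def re(3))
    then show ?thesis using re(1,2) by (simp add: r_def[symmetric])
  qed
  finally show ?thesis .
qed

end

section \<open>The kernel coefficients\<close>

text \<open>
  Translates the sums over the positive integers in the definitions to series indexed from zero.
\<close>
lemma nonneg_summable_on_atLeast_1:
  fixes f :: "nat \<Rightarrow> real"
  assumes f: "\<And>n. n \<ge> 1 \<Longrightarrow> f n \<ge> 0"
  shows "f summable_on {1..} \<longleftrightarrow> summable (\<lambda>n. f (Suc n))"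
    and "summable (\<lambda>n. f (Suc n)) \<Longrightarrow> infsum f {1..} = (\<Sum>n. f (Suc n))"
proof -
  have im: "{1..} = range Suc" by (auto simp: image_iff) (metis Suc_le_D)
  have "f summable_on {1..} \<longleftrightarrow> (f \<circ> Suc) summable_on UNIV"
    unfolding im by (rule summable_on_reindex) simp
  also have "\<dots> \<longleftrightarrow> summable (f \<circ> Suc)"
    using f by (auto intro: summable_nonneg_imp_summable_on summable_on_imp_summable)
  finally show "f summable_on {1..} \<longleftrightarrow> summable (\<lambda>n. f (Suc n))" by (simp add: o_def)
  assume "summable (\<lambda>n. f (Suc n))"
  then have "((f \<circ> Suc) has_sum (\<Sum>n. f (Suc n))) UNIV"
    using f by (intro sums_nonneg_imp_has_sum) (auto simp: o_def summable_sums)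
  then have "infsum (f \<circ> Suc) UNIV = (\<Sum>n. f (Suc n))" by (rule infsumI)
  then show "infsum f {1..} = (\<Sum>n. f (Suc n))" unfolding im by (subst infsum_reindex) simp_all
qed

locale backstepping_kernel = degenerate_parabolic +
  fixes lam :: real
  assumes lam_pos: "lam > 0"
    and lam_not_eigval: "\<And>n. lam \<noteq> eigval \<alpha> (Suc n)"
    and lam_nonres: "\<And>k n. eigval \<alpha> (Suc n) - lam \<noteq> eigval \<alpha> (Suc k)"
begin

abbreviation \<sigma> :: real where "\<sigma> \<equiv> lam / (2 - \<alpha>)\<^sup>2"

text \<open>
  A choice among the admissible constants, so that the results on spaced sequences become available.
\<close>
definition spacing_const :: real where
  "spacing_const = (SOME d. quadratic_spacing \<tau> d)"

sublocale nonresonant_shift "bclif_zero (nu \<alpha>)" spacing_const "lam / (2 - \<alpha>)\<^sup>2"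
proof -
  have "\<exists>d. quadratic_spacing \<tau> d" using bclif_zero_spacing[OF \<nu>(1)] by metis
  then have "quadratic_spacing \<tau> spacing_const" unfolding spacing_const_def by (rule someI_ex)
  then interpret quadratic_spacing \<tau> spacing_const .
  show "nonresonant_shift \<tau> spacing_const \<sigma>"
  proof
    show "\<sigma> \<noteq> 0" using lam_pos \<beta> by simp
    fix k m
    have "\<beta>\<^sup>2 * (\<tau> k - \<tau> m + \<sigma>) = \<beta>\<^sup>2 * \<tau> k - \<beta>\<^sup>2 * \<tau> m + lam" using \<beta> by (simp add: algebra_simps)
    moreover have "\<beta>\<^sup>2 * \<tau> m - lam \<noteq> \<beta>\<^sup>2 * \<tau> k" using lam_nonres[of m k] by (simp add: eigval_Suc)
    ultimately show "\<tau> k - \<tau> m + \<sigma> \<noteq> 0" by auto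
  qed
qed

definition s :: "nat \<Rightarrow> real" where "s n = \<tau> n - \<sigma>"

text \<open>
  The function \<open>- bclif (\<nu> + 1)\<close> is \<open>E'\<close>, so this is \<open>- E(s\<^sub>n)/E'(\<tau>\<^sub>n)\<close>.
\<close>
definition b :: "nat \<Rightarrow> real" where "b n = bclif \<nu> (s n) / bclif (\<nu> + 1) (\<tau> n)"

lemma \<sigma>_pos: "\<sigma> > 0" using lam_pos \<beta> by simp

lemma bclif_s_nonzero: "bclif \<nu> (s n) \<noteq> 0"
proof
  assume "bclif \<nu> (s n) = 0"
  then have "s n \<in> range \<tau>" using bclif_zero_enum(2)[OF \<nu>(1)] by (simp add: bclif_zeros_def)
  then obtain k where "s n = \<tau> k" by auto
  then show False using nonres[of k n] by (simp add: s_def)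
qed

lemma b_nonzero: "b n \<noteq> 0"
  using bclif_s_nonzero \<tau>_root(3) by (simp add: b_def)

lemma sprod_limit: "(\<lambda>N. sprod (- \<sigma>) N m) \<longlonglongrightarrow> b m / \<sigma>"
  using sprod_bclif_zero_tendsto[OF \<nu>(1) quadratic_spacing_axioms, of "- \<sigma>" m] \<sigma>
  by (simp add: b_def s_def field_simps)

lemma b_sums: "(\<lambda>m. b m * w n m) sums 1"
  using cauchy_system_limit[OF sprod_limit, of n] \<sigma> by simp

lemma b_bounded: obtains B where "B > 0" "\<And>m. \<bar>b m\<bar> \<le> B"
proof -
  obtain B where B: "B > 0" "\<And>N m. \<bar>sprod (- \<sigma>) N m\<bar> \<le> B" using sprod_bounded by blast
  have "\<bar>b m\<bar> \<le> \<sigma> * B" for m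
  proof -
    have "\<bar>b m / \<sigma>\<bar> \<le> B" by (rule tendsto_upperbound[OF tendsto_rabs[OF sprod_limit]]) (use B in auto)
    moreover have "\<bar>x\<bar> \<le> y * B" if "\<bar>x / y\<bar> \<le> B" "y > 0" for x y :: real
      using that by (simp add: abs_divide pos_divide_le_eq mult.commute)
    ultimately show ?thesis using \<sigma>_pos by blast
  qed
  then show thesis by (rule that[OF mult_pos_pos[OF \<sigma>_pos B(1)]])
qed

lemma kernel_\<tau>\<tau>: "bclif_kernel \<nu> (\<tau> m) (\<tau> n) = (if m = n then \<tau> n * (bclif (\<nu> + 1) (\<tau> n))\<^sup>2 else 0)"
  using \<tau>_inj[of m n] by (auto simp: bclif_kernel_def \<tau>_root(1))

lemma s_neq_\<tau>: "s m \<noteq> \<tau> n"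
  using nonres[of n m] by (auto simp: s_def)

lemma kernel_s\<tau>: "bclif_kernel \<nu> (s m) (\<tau> n) = \<tau> n * bclif \<nu> (s m) * bclif (\<nu> + 1) (\<tau> n) * w n m"
proof -
  define X where "X = \<tau> n * bclif \<nu> (s m) * bclif (\<nu> + 1) (\<tau> n)"
  have "bclif_kernel \<nu> (s m) (\<tau> n) = - X / (s m - \<tau> n)"
    using s_neq_\<tau>[of m n] by (simp add: bclif_kernel_def \<tau>_root(1) X_def)
  also have "\<dots> = X * (1 / (\<tau> n - s m))" by (metis minus_diff_eq minus_divide_left minus_divide_right minus_minus times_divide_eq_right mult.right_neutral)
  also have "1 / (\<tau> n - s m) = w n m" by (simp add: w_def s_def)
  finally show ?thesis by (simp only: X_def)
qed

lemma nrm_\<tau>\<tau>: "nrm m * nrm n * (bclif_kernel \<nu> (\<tau> m) (\<tau> n) / \<beta>) = (if m = n then 1 else 0)"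
proof (cases "m = n")
  case True
  define r e where "r = sqrt (\<tau> n)" and "e = bclif (\<nu> + 1) (\<tau> n)"
  have re: "r \<noteq> 0" "e \<noteq> 0" "\<tau> n = r * r" using \<tau>_root[of n] by (auto simp: r_def e_def)
  have "nrm n = - sqrt \<beta> / (r * e)" by (simp add: nrm_def r_def e_def)
  then have "nrm n * nrm n * (\<tau> n * e\<^sup>2 / \<beta>) = (sqrt \<beta> * sqrt \<beta>) / \<beta>"
    using re \<beta> by (simp only: re(3)) (simp add: field_simps power2_eq_square)
  also have "\<dots> = 1" using \<beta> by simp
  finally show ?thesis by (simp only: True kernel_\<tau>\<tau> e_def refl if_True)
next
  case False
  then show ?thesis by (simp add: kernel_\<tau>\<tau>)
qed

lemma nrm_s\<tau>: "nrm m * nrm n * (bclif_kernel \<nu> (s m) (\<tau> n) / \<beta>) = sqrt (\<tau> n) / sqrt (\<tau> m) * (b m * w n m)"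
proof -
  define r e q f where "r = sqrt (\<tau> n)" and "e = bclif (\<nu> + 1) (\<tau> n)" and "q = sqrt (\<tau> m)" and "f = bclif (\<nu> + 1) (\<tau> m)"
  have re: "r \<noteq> 0" "e \<noteq> 0" "q \<noteq> 0" "f \<noteq> 0" "\<tau> n = r * r" using \<tau>_root[of n] \<tau>_root[of m] by (auto simp: r_def e_def q_def f_def)
  have "nrm m * nrm n * (bclif_kernel \<nu> (s m) (\<tau> n) / \<beta>)
     = (- sqrt \<beta> / (q * f)) * (- sqrt \<beta> / (r * e)) * ((r * r) * bclif \<nu> (s m) * e * w n m / \<beta>)"
    unfolding kernel_s\<tau> nrm_def r_def[symmetric] e_def[symmetric] q_def[symmetric] f_def[symmetric] re(5)[symmetric] ..
  also have "\<dots> = (sqrt \<beta> * sqrt \<beta> / \<beta>) * (r / q * (bclif \<nu> (s m) / f * w n m))"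
    using re(1-4) by (simp add: field_simps)
  also have "sqrt \<beta> * sqrt \<beta> / \<beta> = 1" using \<beta> by simp
  finally show ?thesis by (simp add: b_def r_def q_def f_def)
qed

text \<open>
  The coefficients relative to \<open>nrm n * U (s n)\<close> in place of the shifted function.
\<close>
definition gam :: "(nat \<Rightarrow> complex) \<Rightarrow> nat \<Rightarrow> complex" where
  "gam c n = c (Suc n) * shift_ratio lam n"

lemma psi_Suc: "x \<ge> 0 \<Longrightarrow> psi \<alpha> lam c (Suc n) x = of_real (nrm n) * of_real (U (\<tau> n) x) + (- gam c n * of_real (nrm n)) * of_real (U (s n) x)"
  by (simp add: psi_def phi_Suc xi_Suc gam_def s_def)

text \<open>
  Holds for every \<open>c\<close>: the shifted function is an eigenfunction for \<open>\<lambda>\<^sub>n - \<lambda>\<close>, so its terms cancel.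
\<close>
lemma psi_ode:
  assumes x: "x \<in> {0<..<1}"
  shows "psi \<alpha> lam c (Suc n) differentiable (at x)"
    and "weighted_deriv \<alpha> (psi \<alpha> lam c (Suc n)) differentiable (at x)"
    and "of_real (eigval \<alpha> (Suc n)) * psi \<alpha> lam c (Suc n) x
       + vector_derivative (weighted_deriv \<alpha> (psi \<alpha> lam c (Suc n))) (at x)
       - of_real lam * psi \<alpha> lam c (Suc n) x = - of_real lam * phi \<alpha> (Suc n) x"
    and "(psi \<alpha> lam c (Suc n) \<longlongrightarrow> 0) (at_right 0)"
proof -
  have x0: "x > 0" "x \<ge> 0" using x by auto
  note cb = U_combination[of "psi \<alpha> lam c (Suc n)", OF psi_Suc[OF less_imp_le]]
  show "psi \<alpha> lam c (Suc n) differentiable (at x)"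
    using cb(1)[OF _ x0(1)] by (auto intro: differentiableI_vector)
  have d: "(weighted_deriv \<alpha> (psi \<alpha> lam c (Suc n)) has_vector_derivative
     - of_real (\<beta>\<^sup>2) * (of_real (nrm n) * of_real (\<tau> n * U (\<tau> n) x) + (- gam c n * of_real (nrm n)) * of_real (s n * U (s n) x))) (at x)"
    using cb(2)[OF _ x0(1)] by simp
  then show "weighted_deriv \<alpha> (psi \<alpha> lam c (Suc n)) differentiable (at x)" by (rule differentiableI_vector)
  show "(psi \<alpha> lam c (Suc n) \<longlongrightarrow> 0) (at_right 0)" using cb(3) by simp
  have "\<beta>\<^sup>2 * s n = \<beta>\<^sup>2 * \<tau> n - lam" using \<beta> by (simp add: s_def right_diff_distrib)
  then have bs: "complex_of_real (\<beta>\<^sup>2) * of_real (s n) = of_real (\<beta>\<^sup>2) * of_real (\<tau> n) - of_real lam"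
    by (metis of_real_diff of_real_mult)
  define X Y g N B T S l where "X = complex_of_real (U (\<tau> n) x)" and "Y = complex_of_real (U (s n) x)" and "g = gam c n"
    and "N = complex_of_real (nrm n)" and "B = complex_of_real (\<beta>\<^sup>2)" and "T = complex_of_real (\<tau> n)" and "S = complex_of_real (s n)" and "l = complex_of_real lam"
  have BS: "B * S = B * T - l" using bs by (simp add: B_def S_def T_def l_def)
  have "B * T * (N * X + - g * N * Y) + - B * (N * (T * X) + - g * N * (S * Y)) - l * (N * X + - g * N * Y)
    = - l * (N * X) + g * N * Y * (B * S - (B * T - l))" by (simp add: algebra_simps)
  then have "B * T * (N * X + - g * N * Y) + - B * (N * (T * X) + - g * N * (S * Y)) - l * (N * X + - g * N * Y) = - l * (N * X)"
    by (simp add: BS)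
  then show "of_real (eigval \<alpha> (Suc n)) * psi \<alpha> lam c (Suc n) x
       + vector_derivative (weighted_deriv \<alpha> (psi \<alpha> lam c (Suc n))) (at x)
       - of_real lam * psi \<alpha> lam c (Suc n) x = - of_real lam * phi \<alpha> (Suc n) x"
    unfolding vector_derivative_at[OF d] psi_Suc[OF x0(2)] phi_Suc[OF x0(2)] eigval_Suc of_real_mult
      X_def[symmetric] Y_def[symmetric] g_def[symmetric] N_def[symmetric] B_def[symmetric] T_def[symmetric] S_def[symmetric] l_def[symmetric] .
qed

lemma basis_coeff_combination:
  fixes p q :: "nat \<Rightarrow> complex"
  assumes f: "\<And>x. x \<ge> 0 \<Longrightarrow> f x = (\<Sum>m<N. p m * of_real (nrm m * U (\<tau> m) x) + q m * of_real (nrm m * U (s m) x))"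
  shows "basis_coeff \<alpha> f (Suc n) = (\<Sum>m<N. p m * (if m = n then 1 else 0) + q m * of_real (sqrt (\<tau> n) / sqrt (\<tau> m) * (b m * w n m)))"
proof -
  define g where "g = (\<lambda>x. (\<Sum>m<N. p m * of_real (nrm m * U (\<tau> m) x) + q m * of_real (nrm m * U (s m) x)) * of_real (nrm n * U (\<tau> n) x))"
  have "basis_coeff \<alpha> f (Suc n) = (LINT x:{0<..<1}|lborel. g x)"
    unfolding basis_coeff_def by (intro set_lebesgue_integral_cong) (auto simp: f phi_Suc g_def)
  also have "\<dots> = (\<Sum>m<N. p m * of_real (nrm m * nrm n * (bclif_kernel \<nu> (\<tau> m) (\<tau> n) / \<beta>)) + q m * of_real (nrm m * nrm n * (bclif_kernel \<nu> (s m) (\<tau> n) / \<beta>)))"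
  proof (rule continuous_on_unit_interval_Ltwo(4))
    show "continuous_on {0..1} g" unfolding g_def by (intro continuous_intros)
    have I: "((\<lambda>x. complex_of_real (nrm m * nrm n * (U z x * U (\<tau> n) x))) has_integral of_real (nrm m * nrm n * (bclif_kernel \<nu> z (\<tau> n) / \<beta>))) {0..1}" for m z
      by (intro has_integral_of_real has_integral_mult_right U_inner)
    have "((\<lambda>x. \<Sum>m<N. p m * of_real (nrm m * nrm n * (U (\<tau> m) x * U (\<tau> n) x)) + q m * of_real (nrm m * nrm n * (U (s m) x * U (\<tau> n) x))) has_integral
       (\<Sum>m<N. p m * of_real (nrm m * nrm n * (bclif_kernel \<nu> (\<tau> m) (\<tau> n) / \<beta>)) + q m * of_real (nrm m * nrm n * (bclif_kernel \<nu> (s m) (\<tau> n) / \<beta>)))) {0..1}"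
      by (intro has_integral_sum has_integral_add has_integral_mult_right I) auto
    then show "(g has_integral (\<Sum>m<N. p m * of_real (nrm m * nrm n * (bclif_kernel \<nu> (\<tau> m) (\<tau> n) / \<beta>)) + q m * of_real (nrm m * nrm n * (bclif_kernel \<nu> (s m) (\<tau> n) / \<beta>)))) {0..1}"
      by (rule has_integral_eq[rotated]) (unfold g_def sum_distrib_right, intro sum.cong refl, simp add: algebra_simps)
  qed
  also have "\<dots> = (\<Sum>m<N. p m * (if m = n then 1 else 0) + q m * of_real (sqrt (\<tau> n) / sqrt (\<tau> m) * (b m * w n m)))"
    unfolding nrm_\<tau>\<tau> nrm_s\<tau> by (intro sum.cong refl) auto
  finally show ?thesis .
qed

text \<open>
  The residual of row \<open>n\<close> of the Cauchy system with the first \<open>N\<close> unknowns, the right-hand side being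
  truncated as well.
\<close>
definition defect :: "(nat \<Rightarrow> complex) \<Rightarrow> nat \<Rightarrow> nat \<Rightarrow> complex" where
  "defect c N n = (if n < N then 1 else 0) - (\<Sum>m<N. gam c m * of_real (b m * w n m))"

lemma basis_coeff_partial_sum:
  "basis_coeff \<alpha> (\<lambda>x. \<Sum>m=1..N. dphi_one \<alpha> m * psi \<alpha> lam c m x) (Suc n) = of_real (\<beta> * sqrt \<beta> * sqrt (\<tau> n)) * defect c N n"
proof -
  define D where "D = (\<lambda>m. complex_of_real (\<beta> * sqrt \<beta> * sqrt (\<tau> m)))"
  have "basis_coeff \<alpha> (\<lambda>x. \<Sum>m=1..N. dphi_one \<alpha> m * psi \<alpha> lam c m x) (Suc n)
     = (\<Sum>m<N. D m * (if m = n then 1 else 0) + (- D m * gam c m) * of_real (sqrt (\<tau> n) / sqrt (\<tau> m) * (b m * w n m)))"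
  proof (rule basis_coeff_combination)
    fix x :: real assume x: "x \<ge> 0"
    have "(\<Sum>m=1..N. dphi_one \<alpha> m * psi \<alpha> lam c m x) = (\<Sum>m<N. D m * psi \<alpha> lam c (Suc m) x)"
      by (simp add: sum.atLeast1_atMost_eq dphi_one_Suc D_def)
    also have "\<dots> = (\<Sum>m<N. D m * of_real (nrm m * U (\<tau> m) x) + (- D m * gam c m) * of_real (nrm m * U (s m) x))"
      by (intro sum.cong refl) (simp add: psi_Suc[OF x] algebra_simps)
    finally show "(\<Sum>m=1..N. dphi_one \<alpha> m * psi \<alpha> lam c m x) = \<dots>" .
  qed
  also have "\<dots> = (\<Sum>m<N. D n * ((if m = n then 1 else 0) - gam c m * of_real (b m * w n m)))"
  proof (intro sum.cong refl)
    fix m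
    have "sqrt (\<tau> m) \<noteq> 0" using \<tau>_root(2)[of m] by simp
    then have "\<beta> * sqrt \<beta> * sqrt (\<tau> m) * (sqrt (\<tau> n) / sqrt (\<tau> m) * (b m * w n m)) = \<beta> * sqrt \<beta> * sqrt (\<tau> n) * (b m * w n m)"
      by simp
    then have "D m * of_real (sqrt (\<tau> n) / sqrt (\<tau> m) * (b m * w n m)) = D n * of_real (b m * w n m)"
      unfolding D_def by (simp only: of_real_mult[symmetric])
    moreover have "d * i + (- d * g) * x = e * (i - g * y)" if "d * x = e * y" "d * i = e * i" for d g x y e i :: complex
    proof -
      have "d * i + (- d * g) * x = e * i - g * (d * x)" by (simp add: that(2))
      then show ?thesis by (simp add: that(1) algebra_simps)
    qed
    moreover have "D m * (if m = n then 1 else 0) = D n * (if m = n then 1 else 0)" by simp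
    ultimately show "D m * (if m = n then 1 else 0) + (- D m * gam c m) * of_real (sqrt (\<tau> n) / sqrt (\<tau> m) * (b m * w n m))
       = D n * ((if m = n then 1 else 0) - gam c m * of_real (b m * w n m))"
      by blast
  qed
  also have "\<dots> = D n * defect c N n"
    by (simp add: defect_def sum_distrib_left[symmetric] sum_subtractf)
  finally show ?thesis by (simp add: D_def)
qed

lemma dual_term:
  "(cmod (basis_coeff \<alpha> (\<lambda>x. \<Sum>m=1..N. dphi_one \<alpha> m * psi \<alpha> lam c m x) (Suc n) - 0))\<^sup>2 / eigval \<alpha> (Suc n) = \<beta> * (cmod (defect c N n))\<^sup>2"
proof -
  have "(\<beta> * sqrt \<beta> * sqrt (\<tau> n))\<^sup>2 = \<beta>\<^sup>2 * \<tau> n * \<beta>" using \<beta> \<tau>_root(2)[of n] by (simp add: power_mult_distrib)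
  then show ?thesis using \<beta> \<tau>_root(2)[of n]
    unfolding basis_coeff_partial_sum eigval_Suc diff_zero norm_mult norm_of_real power_mult_distrib power2_abs by simp
qed

lemma psi_continuous: "continuous_on {0..1} (psi \<alpha> lam c (Suc n))"
proof -
  have "continuous_on {0..1} (\<lambda>x. of_real (nrm n) * of_real (U (\<tau> n) x) + (- gam c n * of_real (nrm n)) * of_real (U (s n) x))"
    by (intro continuous_intros)
  then show ?thesis by (rule continuous_on_eq) (simp add: psi_Suc)
qed

lemma phi_continuous: "continuous_on {0..1} (phi \<alpha> (Suc n))"
proof -
  have "continuous_on {0..1} (\<lambda>x. complex_of_real (nrm n * U (\<tau> n) x))" by (intro continuous_intros)
  then show ?thesis by (rule continuous_on_eq) (simp add: phi_Suc)
qed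

text \<open>
  Dividing by the eigenvalue cancels the factor \<open>\<surd>\<tau>\<^sub>n\<close> in the coefficients. The dual norm is thus the
  \<open>\<ell>\<^sup>2\<close>-norm of the residuals.
\<close>
lemma dual_sums_iff:
  "dual_sums \<alpha> (\<lambda>m x. dphi_one \<alpha> m * psi \<alpha> lam c m x) (\<lambda>_. 0) \<longleftrightarrow>
     (\<forall>N. summable (\<lambda>n. (cmod (defect c N n))\<^sup>2)) \<and> (\<lambda>N. \<Sum>n. (cmod (defect c N n))\<^sup>2) \<longlonglongrightarrow> 0" (is "?L \<longleftrightarrow> ?R")
proof -
  define F where "F = (\<lambda>N n. (cmod (basis_coeff \<alpha> (\<lambda>x. \<Sum>m=1..N. dphi_one \<alpha> m * psi \<alpha> lam c m x) n - 0))\<^sup>2 / eigval \<alpha> n)"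
  have F: "F N (Suc n) = \<beta> * (cmod (defect c N n))\<^sup>2" for N n unfolding F_def by (rule dual_term)
  have Fnn: "F N n \<ge> 0" if "n \<ge> 1" for N n using that by (simp add: F_def eigval_def)
  have sm: "F N summable_on {1..} \<longleftrightarrow> summable (\<lambda>n. (cmod (defect c N n))\<^sup>2)" for N
    using nonneg_summable_on_atLeast_1(1)[of "F N", OF Fnn] \<beta> by (simp add: F summable_cmult_iff)
  have val: "infsum (F N) {1..} = \<beta> * (\<Sum>n. (cmod (defect c N n))\<^sup>2)" if "summable (\<lambda>n. (cmod (defect c N n))\<^sup>2)" for N
    using nonneg_summable_on_atLeast_1(2)[of "F N", OF Fnn] that by (simp add: F suminf_mult summable_mult)
  have L2: "(\<lambda>x. dphi_one \<alpha> m * psi \<alpha> lam c m x) \<in> Ltwo {0<..<1}" if "m \<ge> 1" for m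
  proof -
    obtain n where "m = Suc n" using \<open>m \<ge> 1\<close> by (cases m) auto
    then show ?thesis by (auto intro!: continuous_on_unit_interval_Ltwo(3) continuous_intros psi_continuous)
  qed
  have "?L \<longleftrightarrow> (\<forall>N. F N summable_on {1..}) \<and> (\<lambda>N. sqrt (infsum (F N) {1..})) \<longlonglongrightarrow> 0"
    using L2 by (simp add: dual_sums_def dual_space_def dual_norm_def F_def)
  also have "\<dots> \<longleftrightarrow> (\<forall>N. summable (\<lambda>n. (cmod (defect c N n))\<^sup>2)) \<and> (\<lambda>N. sqrt (\<beta> * (\<Sum>n. (cmod (defect c N n))\<^sup>2))) \<longlonglongrightarrow> 0"
    unfolding sm
  proof (rule conj_cong[OF refl])
    assume "\<forall>N. summable (\<lambda>n. (cmod (defect c N n))\<^sup>2)"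
    then have "infsum (F N) {1..} = \<beta> * (\<Sum>n. (cmod (defect c N n))\<^sup>2)" for N using val by blast
    then show "(\<lambda>N. sqrt (infsum (F N) {1..})) \<longlonglongrightarrow> 0 \<longleftrightarrow> (\<lambda>N. sqrt (\<beta> * (\<Sum>n. (cmod (defect c N n))\<^sup>2))) \<longlonglongrightarrow> 0"
      by (simp only:)
  qed
  also have "\<dots> \<longleftrightarrow> ?R"
  proof (intro conj_cong refl iffI)
    assume sN: "\<forall>N. summable (\<lambda>n. (cmod (defect c N n))\<^sup>2)"
    have nn: "0 \<le> (\<Sum>n. (cmod (defect c N n))\<^sup>2)" for N using sN by (intro suminf_nonneg) auto
    show "(\<lambda>N. \<Sum>n. (cmod (defect c N n))\<^sup>2) \<longlonglongrightarrow> 0" if "(\<lambda>N. sqrt (\<beta> * (\<Sum>n. (cmod (defect c N n))\<^sup>2))) \<longlonglongrightarrow> 0"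
    proof -
      have "(\<lambda>N. (sqrt (\<beta> * (\<Sum>n. (cmod (defect c N n))\<^sup>2)))\<^sup>2 / \<beta>) \<longlonglongrightarrow> 0\<^sup>2 / \<beta>"
        using that \<beta> by (intro tendsto_intros) auto
      then show ?thesis using nn \<beta> by simp
    qed
    show "(\<lambda>N. sqrt (\<beta> * (\<Sum>n. (cmod (defect c N n))\<^sup>2))) \<longlonglongrightarrow> 0" if "(\<lambda>N. \<Sum>n. (cmod (defect c N n))\<^sup>2) \<longlonglongrightarrow> 0"
      using tendsto_real_sqrt[OF tendsto_mult_left[OF that, of \<beta>]] by simp
  qed
  finally show ?thesis .
qed

lemma kernel_coeffs_iff:
  "kernel_coeffs \<alpha> lam c \<longleftrightarrow> summable (\<lambda>n. (cmod (c (Suc n) - 1))\<^sup>2) \<and>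
     (\<forall>N. summable (\<lambda>n. (cmod (defect c N n))\<^sup>2)) \<and> (\<lambda>N. \<Sum>n. (cmod (defect c N n))\<^sup>2) \<longlonglongrightarrow> 0"
proof -
  have "(\<forall>x\<in>{0<..<1}.
           psi \<alpha> lam c n differentiable (at x) \<and>
           weighted_deriv \<alpha> (psi \<alpha> lam c n) differentiable (at x) \<and>
           of_real (eigval \<alpha> n) * psi \<alpha> lam c n x
             + vector_derivative (weighted_deriv \<alpha> (psi \<alpha> lam c n)) (at x)
             - of_real lam * psi \<alpha> lam c n x
           = - of_real lam * phi \<alpha> n x) \<and>
        (psi \<alpha> lam c n \<longlongrightarrow> 0) (at_right 0)" if "n \<ge> 1" for n
  proof -
    obtain m where "n = Suc m" using \<open>n \<ge> 1\<close> by (cases n) auto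
    then show ?thesis using psi_ode(1-3) psi_ode(4)[of "1 / 2"] by simp
  qed
  moreover have "(\<lambda>n. (cmod (c n - 1))\<^sup>2) summable_on {1..} \<longleftrightarrow> summable (\<lambda>n. (cmod (c (Suc n) - 1))\<^sup>2)"
    by (rule nonneg_summable_on_atLeast_1) simp
  ultimately show ?thesis unfolding kernel_coeffs_def dual_sums_iff by blast
qed

text \<open>
  As soon as \<open>s\<^sub>n\<close> is positive, the reciprocal ratio \<open>(\<tau>\<^sub>n/s\<^sub>n)\<^bsup>\<nu>/2\<^esup>\<close> lies between \<open>1\<close> and
  \<open>\<tau>\<^sub>n/s\<^sub>n = 1 + \<sigma>/s\<^sub>n\<close>.
\<close>
lemma shift_ratio_inverse_ell2: "summable (\<lambda>n. (cmod (1 / shift_ratio lam n - 1))\<^sup>2)"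
proof (rule summable_comparison_test_ev)
  show "summable (\<lambda>n. (2 * \<sigma>)\<^sup>2 * (1 / \<tau> n)\<^sup>2)" by (intro summable_mult summable_inverse_\<tau>_sq)
  have "\<forall>\<^sub>F n in sequentially. \<tau> n \<ge> 2 * \<sigma>"
    using bclif_zero_enum(4)[OF \<nu>(1)] by (simp add: filterlim_at_top)
  then show "\<forall>\<^sub>F n in sequentially. norm ((cmod (1 / shift_ratio lam n - 1))\<^sup>2) \<le> (2 * \<sigma>)\<^sup>2 * (1 / \<tau> n)\<^sup>2"
  proof eventually_elim
    case (elim n)
    have t: "\<tau> n > 0" by (rule \<tau>_root(2))
    have "\<tau> n - q > 0 \<and> \<tau> n - q \<ge> \<tau> n / 2 \<and> \<tau> n - q \<le> \<tau> n" if "2 * q \<le> \<tau> n" "q > 0" for q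
      using that t by argo
    from this[OF elim \<sigma>_pos] have s: "s n > 0" "s n \<ge> \<tau> n / 2" "s n \<le> \<tau> n" unfolding s_def by blast+
    define x where "x = sqrt (\<tau> n) powr \<nu> / sqrt (s n) powr \<nu>"
    have "csqrt (of_real (\<tau> n - \<sigma>)) = of_real (sqrt (s n))"
      using s by (subst csqrt_of_real_nonneg) (auto simp: s_def)
    moreover have "complex_of_real (sqrt (s n)) powr of_real \<nu> = of_real (sqrt (s n) powr \<nu>)"
      using s by (intro powr_of_real) auto
    ultimately have "1 / shift_ratio lam n = of_real x" by (simp add: shift_ratio_def x_def)
    then have "cmod (1 / shift_ratio lam n - 1) = \<bar>x - 1\<bar>" by (metis norm_of_real of_real_1 of_real_diff)
    moreover have "1 \<le> x"
      unfolding x_def using s t \<nu> by (subst pos_le_divide_eq) (auto intro!: powr_mono2)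
    moreover have "x \<le> \<tau> n / s n"
    proof -
      define y where "y = sqrt (\<tau> n) / sqrt (s n)"
      have y: "1 \<le> y" using s t by (simp add: y_def)
      have "x = y powr \<nu>" using s t by (simp add: x_def y_def powr_divide)
      also have "\<dots> \<le> y powr 2" using y \<nu> by (intro powr_mono) auto
      also have "\<dots> = \<tau> n / s n" using s t y by (simp add: y_def power_divide)
      finally show ?thesis .
    qed
    moreover have "\<tau> n / s n = 1 + \<sigma> / s n"
    proof -
      have "\<tau> n = s n + \<sigma>" by (simp add: s_def)
      then have "\<tau> n / s n = (s n + \<sigma>) / s n" by (rule arg_cong)
      then show ?thesis using s(1) by (simp only: add_divide_distrib divide_self_if) simp
    qed
    ultimately have "cmod (1 / shift_ratio lam n - 1) \<le> \<sigma> / s n" by simp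
    also have "\<dots> \<le> \<sigma> / (\<tau> n / 2)" using s t \<sigma>_pos by (intro divide_left_mono) auto
    also have "\<dots> = 2 * \<sigma> * (1 / \<tau> n)" by simp
    finally have "(cmod (1 / shift_ratio lam n - 1))\<^sup>2 \<le> (2 * \<sigma> * (1 / \<tau> n))\<^sup>2" by (intro power_mono) auto
    then show ?case by (simp only: power_mult_distrib real_norm_def abs_power2)
  qed
qed

text \<open>
  The value at \<open>0\<close> is the one that extensional functions take outside their domain.
\<close>
definition cstar :: "nat \<Rightarrow> complex" where
  "cstar n = (if n = 0 then undefined else 1 / shift_ratio lam (n - 1))"

lemma gam_cstar: "gam cstar n = 1"
  using shift_ratio_nonzero[OF lam_not_eigval] by (simp add: gam_def cstar_def)

lemma kernel_coeffs_cstar: "kernel_coeffs \<alpha> lam cstar"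
  unfolding kernel_coeffs_iff
proof (intro conjI allI)
  show "summable (\<lambda>n. (cmod (cstar (Suc n) - 1))\<^sup>2)"
    using shift_ratio_inverse_ell2 by (simp add: cstar_def)
  obtain B where B: "B > 0" "\<And>m. \<bar>b m\<bar> \<le> B" using b_bounded by blast
  have eq: "(cmod (defect cstar N n))\<^sup>2 = ((if n < N then 1 else 0) - (\<Sum>m<N. b m * w n m))\<^sup>2" for N n
  proof -
    have "defect cstar N n = of_real ((if n < N then 1 else 0) - (\<Sum>m<N. b m * w n m))"
      by (simp add: defect_def gam_cstar)
    then show ?thesis by (simp only: norm_of_real power2_abs)
  qed
  show "summable (\<lambda>n. (cmod (defect cstar N n))\<^sup>2)" for N
    unfolding eq by (rule cauchy_defect_tendsto_0(1)[OF B(2) b_sums])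
  show "(\<lambda>N. \<Sum>n. (cmod (defect cstar N n))\<^sup>2) \<longlonglongrightarrow> 0"
    unfolding eq by (rule cauchy_defect_tendsto_0(2)[OF B(2) b_sums])
qed

text \<open>
  Convergence in the dual norm gives convergence of each coefficient, so that the differences
  \<open>(\<gamma>\<^sub>m - 1) b\<^sub>m\<close> solve the homogeneous Cauchy system; they are bounded because \<open>c\<close> and the ratios converge.
\<close>
lemma kernel_coeffs_unique:
  assumes c: "kernel_coeffs \<alpha> lam c"
  shows "gam c n = 1"
proof -
  have sm: "summable (\<lambda>n. (cmod (c (Suc n) - 1))\<^sup>2)" and sd: "\<And>N. summable (\<lambda>n. (cmod (defect c N n))\<^sup>2)"
    and lim: "(\<lambda>N. \<Sum>n. (cmod (defect c N n))\<^sup>2) \<longlonglongrightarrow> 0"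
    using c unfolding kernel_coeffs_iff by auto
  have ell2_lim: "f \<longlonglongrightarrow> 1" if "summable (\<lambda>n. (cmod (f n - 1))\<^sup>2)" for f :: "nat \<Rightarrow> complex"
  proof -
    have "(\<lambda>n. sqrt ((cmod (f n - 1))\<^sup>2)) \<longlonglongrightarrow> sqrt 0"
      by (intro tendsto_real_sqrt summable_LIMSEQ_zero that)
    then have "(\<lambda>n. f n - 1) \<longlonglongrightarrow> 0" by (simp add: tendsto_norm_zero_iff)
    from tendsto_add[OF this tendsto_const[of 1]] show ?thesis by simp
  qed
  have "(\<lambda>n. c (Suc n) / (1 / shift_ratio lam n)) \<longlonglongrightarrow> 1 / 1"
    by (intro tendsto_divide ell2_lim sm shift_ratio_inverse_ell2) simp
  then have "convergent (gam c)" by (auto simp: gam_def[abs_def] convergent_def)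
  then obtain G where G: "\<And>m. cmod (gam c m) \<le> G" using convergent_imp_Bseq BseqE by metis
  have G0: "0 \<le> G" using G[of 0] norm_ge_zero order_trans by blast
  obtain B where B: "B > 0" "\<And>m. \<bar>b m\<bar> \<le> B" using b_bounded by blast
  define h where "h = (\<lambda>m. (gam c m - 1) * of_real (b m))"
  have "h n = 0"
  proof (rule cauchy_system_unique)
    fix m
    have "cmod (gam c m - 1) \<le> G + 1" using norm_triangle_ineq4[of "gam c m" 1] G[of m] by simp
    then show "cmod (h m) \<le> (G + 1) * B" unfolding h_def norm_mult norm_of_real
      using B G0 by (intro mult_mono) auto
  next
    fix k
    have "(\<lambda>N. defect c N k) \<longlonglongrightarrow> 0"
    proof (rule Lim_null_comparison)
      show "\<forall>\<^sub>F N in sequentially. norm (defect c N k) \<le> sqrt (\<Sum>n. (cmod (defect c N n))\<^sup>2)"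
      proof (intro always_eventually allI real_le_rsqrt)
        fix N show "(cmod (defect c N k))\<^sup>2 \<le> (\<Sum>n. (cmod (defect c N n))\<^sup>2)"
          using sum_le_suminf[OF sd, of "{k}"] by simp
      qed
      show "(\<lambda>N. sqrt (\<Sum>n. (cmod (defect c N n))\<^sup>2)) \<longlonglongrightarrow> 0" using tendsto_real_sqrt[OF lim] by simp
    qed
    from tendsto_diff[OF tendsto_const[of 1] this]
    have "(\<lambda>N. 1 - defect c N k) \<longlonglongrightarrow> 1" by simp
    then have "(\<lambda>N. \<Sum>m<N. gam c m * of_real (b m * w k m)) \<longlonglongrightarrow> 1"
      by (rule Lim_transform_eventually) (rule eventually_mono[OF eventually_gt_at_top[of k]], simp add: defect_def)
    then have "(\<lambda>m. gam c m * of_real (b m * w k m)) sums 1" by (simp add: sums_def)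
    moreover have "(\<lambda>m. complex_of_real (b m * w k m)) sums of_real 1" using b_sums[of k] by (rule sums_of_real)
    ultimately have "(\<lambda>m. gam c m * of_real (b m * w k m) - complex_of_real (b m * w k m)) sums (1 - of_real 1)"
      by (rule sums_diff)
    then show "(\<lambda>m. h m * of_real (w k m)) sums 0" by (simp add: h_def algebra_simps)
  qed
  then show ?thesis using b_nonzero[of n] by (simp add: h_def)
qed

text \<open>
  The square norm is \<open>1 - 2 b\<^sub>n/\<sigma> + \<parallel>N\<^sub>n U(s\<^sub>n)\<parallel>\<^sup>2\<close>. Parseval's identity expands the last term over all zeros;
  the zero of index \<open>n\<close> contributes \<open>(b\<^sub>n/\<sigma>)\<^sup>2\<close>, which completes the square.
\<close>
lemma psi_energy:
  assumes g: "gam c n = 1"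
  shows "(\<lambda>N. (1 - b n / \<sigma>)\<^sup>2 + (\<sigma> * (b n / \<sigma>))\<^sup>2 * (\<Sum>k\<in>{..<N} - {n}. \<tau> k / \<tau> n * (w k n)\<^sup>2))
     \<longlonglongrightarrow> (Ltwo_norm {0<..<1} (psi \<alpha> lam c (Suc n)))\<^sup>2"
proof -
  define L where "L = 1 - 2 * (b n / \<sigma>) + (nrm n)\<^sup>2 * (bclif_kernel \<nu> (s n) (s n) / \<beta>)"
  have nn: "nrm n * nrm n * (bclif_kernel \<nu> (\<tau> n) (\<tau> n) / \<beta>) = 1" using nrm_\<tau>\<tau>[of n n] by (simp only: refl if_True)
  have "sqrt (\<tau> n) \<noteq> 0" using \<tau>_root(2)[of n] by simp
  then have ns: "nrm n * nrm n * (bclif_kernel \<nu> (s n) (\<tau> n) / \<beta>) = b n / \<sigma>"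
    unfolding nrm_s\<tau> by (simp add: w_def)
  define f where "f = (\<lambda>x. nrm n * nrm n * (U (\<tau> n) x * U (\<tau> n) x) - 2 * (nrm n * nrm n * (U (s n) x * U (\<tau> n) x)) + nrm n * nrm n * (U (s n) x * U (s n) x))"
  have "(f has_integral (nrm n * nrm n * (bclif_kernel \<nu> (\<tau> n) (\<tau> n) / \<beta>) - 2 * (nrm n * nrm n * (bclif_kernel \<nu> (s n) (\<tau> n) / \<beta>))
       + nrm n * nrm n * (bclif_kernel \<nu> (s n) (s n) / \<beta>))) {0..1}"
    unfolding f_def by (intro has_integral_add has_integral_diff has_integral_mult_right U_inner)
  then have fi: "(f has_integral L) {0..1}" unfolding nn ns by (simp add: L_def power2_eq_square)
  have cf: "continuous_on {0..1} (\<lambda>x. complex_of_real (f x))" unfolding f_def by (intro continuous_intros)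
  have "(LINT x:{0<..<1}|lborel. complex_of_real (f x)) = of_real L"
    by (rule continuous_on_unit_interval_Ltwo(4)[OF cf has_integral_of_real[OF fi]])
  then have "complex_of_real (LINT x:{0<..<1}|lborel. f x) = of_real L" by (simp only: set_integral_complex_of_real)
  then have fL: "(LINT x:{0<..<1}|lborel. f x) = L" by (simp only: of_real_eq_iff)
  have fx: "(cmod (psi \<alpha> lam c (Suc n) x))\<^sup>2 = f x" if "x \<in> {0<..<1}" for x
  proof -
    have "psi \<alpha> lam c (Suc n) x = of_real (nrm n * U (\<tau> n) x - nrm n * U (s n) x)"
      using that psi_Suc[of x c n] g by simp
    then have "(cmod (psi \<alpha> lam c (Suc n) x))\<^sup>2 = (nrm n * U (\<tau> n) x - nrm n * U (s n) x)\<^sup>2"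
      by (simp only: norm_of_real power2_abs)
    also have "\<dots> = f x" by (simp add: f_def power2_eq_square algebra_simps)
    finally show ?thesis .
  qed
  have "(LINT x:{0<..<1}|lborel. (cmod (psi \<alpha> lam c (Suc n) x))\<^sup>2) = (LINT x:{0<..<1}|lborel. f x)"
    by (rule set_lebesgue_integral_cong) (use fx in auto)
  then have "(LINT x:{0<..<1}|lborel. (cmod (psi \<alpha> lam c (Suc n) x))\<^sup>2) = L" using fL by simp
  moreover have "0 \<le> (LINT x:{0<..<1}|lborel. (cmod (psi \<alpha> lam c (Suc n) x))\<^sup>2)"
    unfolding set_lebesgue_integral_def by (rule Bochner_Integration.integral_nonneg) simp
  ultimately have norm: "(Ltwo_norm {0<..<1} (psi \<alpha> lam c (Suc n)))\<^sup>2 = L"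
    by (simp add: Ltwo_norm_def)
  have inj: "inj_on \<tau> A" for A using \<tau>_inj by (auto simp: inj_on_def)
  have "(\<lambda>N. \<Sum>t\<in>{t \<in> bclif_zeros \<nu>. t < \<tau> N}. t / (s n - t)\<^sup>2) \<longlonglongrightarrow> bclif_kernel \<nu> (s n) (s n) / (bclif \<nu> (s n))\<^sup>2"
    by (rule filterlim_compose[OF bclif_kernel_diag_sum[OF \<nu>(1) bclif_s_nonzero] bclif_zero_enum(4)[OF \<nu>(1)]])
  then have "(\<lambda>N. \<Sum>k<N. \<tau> k / (s n - \<tau> k)\<^sup>2) \<longlonglongrightarrow> bclif_kernel \<nu> (s n) (s n) / (bclif \<nu> (s n))\<^sup>2"
    unfolding bclif_zero_enum(3)[OF \<nu>(1)] by (simp add: sum.reindex[OF inj])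
  moreover have "\<tau> k / (s n - \<tau> k)\<^sup>2 = \<tau> k * (w k n)\<^sup>2" for k
  proof -
    have "(s n - \<tau> k)\<^sup>2 = (\<tau> k - \<tau> n + \<sigma>)\<^sup>2"
    proof -
      have "\<tau> k - s n = \<tau> k - \<tau> n + \<sigma>" unfolding s_def by (rule diff_diff_eq2[THEN trans]) (simp only: add.commute add_diff_eq diff_add_eq)
      then show ?thesis by (metis power2_commute)
    qed
    then show ?thesis by (simp add: w_def power_divide)
  qed
  ultimately have lim: "(\<lambda>N. \<Sum>k<N. \<tau> k * (w k n)\<^sup>2) \<longlonglongrightarrow> bclif_kernel \<nu> (s n) (s n) / (bclif \<nu> (s n))\<^sup>2" by simp
  have lim2: "(\<lambda>N. 1 - 2 * (b n / \<sigma>) + (b n)\<^sup>2 / \<tau> n * (\<Sum>k<N. \<tau> k * (w k n)\<^sup>2)) \<longlonglongrightarrow>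
     1 - 2 * (b n / \<sigma>) + (b n)\<^sup>2 / \<tau> n * (bclif_kernel \<nu> (s n) (s n) / (bclif \<nu> (s n))\<^sup>2)"
    by (intro tendsto_intros lim)
  have "(b n)\<^sup>2 / \<tau> n * (bclif_kernel \<nu> (s n) (s n) / (bclif \<nu> (s n))\<^sup>2) = (nrm n)\<^sup>2 * (bclif_kernel \<nu> (s n) (s n) / \<beta>)"
    using bclif_s_nonzero[of n] \<tau>_root[of n] \<beta> by (simp add: b_def nrm_def power_divide power_mult_distrib)
  then have lim3: "(\<lambda>N. 1 - 2 * (b n / \<sigma>) + (b n)\<^sup>2 / \<tau> n * (\<Sum>k<N. \<tau> k * (w k n)\<^sup>2)) \<longlonglongrightarrow> L"
    using lim2 by (simp add: L_def)
  show ?thesis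
    unfolding norm
  proof (rule Lim_transform_eventually[OF lim3])
    show "\<forall>\<^sub>F N in sequentially. 1 - 2 * (b n / \<sigma>) + (b n)\<^sup>2 / \<tau> n * (\<Sum>k<N. \<tau> k * (w k n)\<^sup>2)
        = (1 - b n / \<sigma>)\<^sup>2 + (\<sigma> * (b n / \<sigma>))\<^sup>2 * (\<Sum>k\<in>{..<N} - {n}. \<tau> k / \<tau> n * (w k n)\<^sup>2)"
      using eventually_gt_at_top[of n]
    proof eventually_elim
      case (elim N)
      have t: "\<tau> n \<noteq> 0" using \<tau>_root(2)[of n] by simp
      have f1: "(\<Sum>k<N. \<tau> k * (w k n)\<^sup>2) = \<tau> n * (w n n)\<^sup>2 + (\<Sum>k\<in>{..<N} - {n}. \<tau> k * (w k n)\<^sup>2)"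
        using elim by (subst sum.remove[of "{..<N}" n]) auto
      have f2: "(\<Sum>k\<in>{..<N} - {n}. \<tau> k / \<tau> n * (w k n)\<^sup>2) = (\<Sum>k\<in>{..<N} - {n}. \<tau> k * (w k n)\<^sup>2) / \<tau> n"
        by (simp add: sum_divide_distrib)
      have f3: "w n n = 1 / \<sigma>" by (simp add: w_def)
      have alg: "1 - 2 * (x / q) + x\<^sup>2 / T * (T * (1 / q)\<^sup>2 + R) = (1 - x / q)\<^sup>2 + (q * (x / q))\<^sup>2 * (R / T)"
        if "q \<noteq> 0" "T \<noteq> 0" for q T x R :: real
        using that by (simp add: power2_eq_square field_simps)
      show ?case unfolding f1 f2 f3 by (rule alg[OF \<sigma> t])
    qed
  qed
qed

lemma kernel_Ltwo:
  assumes c: "kernel_coeffs \<alpha> lam c"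
  shows "\<exists>k. Ltwo_sums ({0<..<1} \<times> {0<..<1}) (\<lambda>n (x, y). psi \<alpha> lam c n x * phi \<alpha> n y) k"
proof (rule Ltwo_sums_orthonormal_products)
  show "summable (\<lambda>n. (Ltwo_norm {0<..<1} (psi \<alpha> lam c (Suc n)))\<^sup>2)"
    by (rule cauchy_energy_summable[OF sprod_limit psi_energy[OF kernel_coeffs_unique[OF c]]])
  show "psi \<alpha> lam c n \<in> Ltwo {0<..<1}" if "n \<ge> 1" for n
    using that continuous_on_unit_interval_Ltwo(3)[OF psi_continuous] by (cases n) auto
  show "set_borel_measurable lborel {0<..<1} (phi \<alpha> n)" if "n \<ge> 1" for n
    using that continuous_on_unit_interval_Ltwo(2)[OF phi_continuous] by (cases n) auto
  fix n m :: nat assume "n \<ge> 1" "m \<ge> 1"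
  then obtain i j where ij: "n = Suc i" "m = Suc j" by (cases n; cases m) auto
  have cont: "continuous_on {0..1} (\<lambda>y. phi \<alpha> n y * cnj (phi \<alpha> m y))"
    unfolding ij by (intro continuous_intros phi_continuous)
  show "set_integrable lborel {0<..<1} (\<lambda>y. phi \<alpha> n y * cnj (phi \<alpha> m y))"
    by (rule continuous_on_unit_interval_Ltwo(1)[OF cont])
  have "((\<lambda>x. complex_of_real (nrm i * nrm j * (U (\<tau> i) x * U (\<tau> j) x))) has_integral of_real (nrm i * nrm j * (bclif_kernel \<nu> (\<tau> i) (\<tau> j) / \<beta>))) {0..1}"
    by (intro has_integral_of_real has_integral_mult_right U_inner)
  then have "((\<lambda>y. phi \<alpha> n y * cnj (phi \<alpha> m y)) has_integral of_real (nrm i * nrm j * (bclif_kernel \<nu> (\<tau> i) (\<tau> j) / \<beta>))) {0..1}"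
    by (rule has_integral_eq[rotated]) (simp add: ij phi_Suc)
  from continuous_on_unit_interval_Ltwo(4)[OF cont this]
  show "(LINT y:{0<..<1}|lborel. phi \<alpha> n y * cnj (phi \<alpha> m y)) = (if n = m then 1 else 0)"
    by (simp only: nrm_\<tau>\<tau> ij) auto
qed auto

lemma kernel_coeffs_ex1: "\<exists>!c. c \<in> {1..} \<rightarrow>\<^sub>E UNIV \<and> kernel_coeffs \<alpha> lam c"
proof (rule ex1I[of _ cstar])
  show "cstar \<in> {1..} \<rightarrow>\<^sub>E UNIV \<and> kernel_coeffs \<alpha> lam cstar"
    using kernel_coeffs_cstar by (auto simp: PiE_def extensional_def cstar_def)
  fix c :: "nat \<Rightarrow> complex" assume c: "c \<in> {1..} \<rightarrow>\<^sub>E UNIV \<and> kernel_coeffs \<alpha> lam c"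
  show "c = cstar"
  proof
    fix n
    show "c n = cstar n"
    proof (cases n)
      case 0
      then show ?thesis using c by (auto simp: PiE_def extensional_def cstar_def)
    next
      case (Suc m)
      have "gam c m = 1" using kernel_coeffs_unique c by blast
      then show ?thesis using Suc shift_ratio_nonzero[OF lam_not_eigval, of m] by (simp add: gam_def cstar_def field_simps)
    qed
  qed
qed

end

theorem theorem1:
  fixes \<alpha> lam :: real
  assumes "0 < \<alpha>" "\<alpha> < 1"
    and "lam > 0"
    and "\<And>n. n \<ge> 1 \<Longrightarrow> lam \<noteq> eigval \<alpha> n"
    and "\<And>k n. k \<ge> 1 \<Longrightarrow> n \<ge> 1 \<Longrightarrow> eigval \<alpha> n - lam \<noteq> eigval \<alpha> k"
  shows "(\<exists>!c. c \<in> {1..} \<rightarrow>\<^sub>E UNIV \<and> kernel_coeffs \<alpha> lam c) \<and>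
    (\<forall>c. kernel_coeffs \<alpha> lam c \<longrightarrow>
       (\<exists>k. Ltwo_sums ({0<..<1} \<times> {0<..<1}) (\<lambda>n (x, y). psi \<alpha> lam c n x * phi \<alpha> n y) k))"
proof -
  interpret backstepping_kernel \<alpha> lam
    by unfold_locales (use assms in auto)
  show ?thesis using kernel_coeffs_ex1 kernel_Ltwo by blast
qed

end
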